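(* For $q=e^{2\pi i\tau}$ with $\operatorname{Im}(\tau)>0$, the following identities hold: \begin{align*} q\rho(q)-2A_2(-q^6)&=q\,\frac{\Theta_{2}^2\Theta_{3}^2\Theta_{6}\Theta_{8}\Theta_{24}}{\Theta_{1}^2\Theta_{4}\Theta_{12}^3},\\ q\rho(q)+\frac12\mu_2(q^6)&=\frac12\frac{\Theta_{2}\Theta_{3}^2\Theta_{4}^2}{\Theta_{1}^2\Theta_{8}\Theta_{24}},\\ q\rho(q)+\frac14\mu_2(q^6)-A_2(-q^6)&=\frac14\frac{\Theta_{2}^6\Theta_{3}^4}{\Theta_{1}^4\Theta_{4}^2\Theta_{6}\Theta_{12}^2}. \end{align*}
   Context: Here $q=e^{2\pi i\tau}$, $\operatorname{Im}(\tau)>0$ (so $0<|q|<1$). Notation: $(x;q)_n=\prod_{i=0}^{n-1}(1-q^ix)$, $(x)_n=(x;q)_n$, and $\Theta_m=\prod_{i\ge1}(1-q^{mi})$ for positive integers $m$. The sixth-order mock theta function $\rho$ is $$\rho(q)=\sum_{n\ge0}\frac{q^{\binom{n+1}2}(-q)_n}{(q;q^2)_{n+1}},$$ and the second-order mock theta functions $A_2,\mu_2$ are $$A_2(q)=\sum_{n\ge0}\frac{q^{n+1}(-q^2;q^2)_n}{(q;q^2)_{n+1}}=\sum_{n\ge0}\frac{q^{(n+1)^2}(-q;q^2)_n}{(q;q^2)_{n+1}^2},\qquad \mu_2(q)=\sum_{n\ge0}\frac{(-1)^nq^{n^2}(q;q^2)_n}{(-q^2;q^2)_n^2}.$$ 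*)

theory Defs
  imports "HOL-Analysis.Analysis"
begin

definition qpoch :: "complex \<Rightarrow> complex \<Rightarrow> nat \<Rightarrow> complex" where
  "qpoch x q n = (\<Prod>i<n. 1 - q ^ i * x)"

text \<open>The product of 1 - q ^ (m * i) over i \<ge> 1, with the index shifted to start at 0.\<close>

definition Theta :: "nat \<Rightarrow> complex \<Rightarrow> complex" where
  "Theta m q = (\<Prod>i. 1 - q ^ (m * Suc i))"

text \<open>
  For norm q < 1 the denominators below do not vanish and the three series converge
  absolutely, so the default values of division and suminf play no role there.
\<close>

definition rho6 :: "complex \<Rightarrow> complex" where
  "rho6 q = (\<Sum>n. q ^ (Suc n choose 2) * qpoch (- q) q n / qpoch q (q^2) (n + 1))"

text \<open>
  Of the two classical series for the second-order function A, the Eulerian form with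
  simple denominators is taken as the definition.
\<close>

definition A2 :: "complex \<Rightarrow> complex" where
  "A2 q = (\<Sum>n. q ^ (n + 1) * qpoch (- (q^2)) (q^2) n / qpoch q (q^2) (n + 1))"

definition mu2 :: "complex \<Rightarrow> complex" where
  "mu2 q = (\<Sum>n. (-1) ^ n * q ^ (n^2) * qpoch q (q^2) n / (qpoch (- (q^2)) (q^2) n)^2)"

end

theory Submission imports Defs begin

text \<open>
  Put Q = q^6 and let jtheta u Q be the theta series \<Sum> (-1)^k Q^(k(k-1)/2) u^k.  The three functions
  are, up to theta factors, values of one level-four Appell series
    appell u Q = \<Sum> Q^(2 s^2) u^(4 s) (1 + u Q^s) / (1 - u Q^s),  s over the integers:
  rho at u = q, mu at u = \<i>, and A at u = \<i> q^3.

  Bailey's lemma (bailey_sum), whose weights come from a 1phi1 summation (phi11), turns an Eulerian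
  series into a bilateral one once part of its summand is written as a Bailey pair.  For mu and A the
  pairs are elementary and give Lambert series; for A this applies to the Eulerian series with squared
  denominators, which Fine's transformation connects with the one that defines A.  At \<i> and \<i> q^3 the Appell series splits into such
  a Lambert series and an antisymmetric part, which sums to zero (mu2_appell, A2_appell).
  For rho the pair leads to a double sum of Hecke type.  Multiplied by the theta series at -1, this
  double sum has coefficients h_k with (1 - q^k) h_k = c_k, where c_k is itself a theta series.  Only odd k
  matter, and for these c_k is zero or, up to sign, a power of q times the Euler product; dividing by
  1 - q^k produces exactly the terms of the Appell series (rho_appell).

  To compare the three values, multiply by the theta series that cancels the poles.  The Laurent
  coefficients y_k of u * jtheta u Q * appell u Q in |Q| < |u| < 1/|Q| satisfy y_(k+5) = - Q^(k+1) y_k and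
  y_(3-k) = y_k, laws which have a two-dimensional solution space spanned by
  theta functions (theta5_span).  After division by jtheta (u^2) Q this reads
    u * appell u Q / jtheta (u^2) Q = J (c0 E0 u + c1 E1 u) / (jtheta u Q)^2,   J = (Q;Q)(Q^2;Q^2),
  with E0 the even and E1 the odd theta series of degree two, and likewise
  (jtheta u Q)^2 = a0 E0 u - b0 E1 u with a0 = E1 1 and b0 = E0 1 (appell_quotient, jtheta_square).
  Since E0 vanishes at \<i> and E1 at \<i> q^3, the values there are the constants - J c1 / b0 and J c0 / a0,
  and subtracting them from the value at q leaves J (c0 b0 + c1 a0) times the single quotient
  E0 q / (b0 (jtheta q Q)^2) or E1 q / (a0 (jtheta q Q)^2).  The constant J (c0 b0 + c1 a0) is found at
  u = 1, where the pole of the Appell series meets the zero of the theta series, whose derivative is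
  - (Q;Q)^3 (sum_index_theta_coeff).  These are the first two identities.  The third one is their average,
  because (jtheta (-u) Q)^2 = a0 E0 u + b0 E1 u.  The Jacobi triple product expresses every theta value by
  the products Theta m q.
\<close>

section \<open>Sums over the integers\<close>

text \<open>
  Tannery's theorem, carried to the integers by the enumeration int_decode.
\<close>

lemma int_dominated_convergence:
  fixes f :: "nat \<Rightarrow> int \<Rightarrow> complex"
  assumes lim: "\<And>k. (\<lambda>n. f n k) \<longlonglongrightarrow> g k"
    and bound: "\<And>n k. norm (f n k) \<le> h k" and h: "h summable_on UNIV"
  shows "(\<lambda>n. \<Sum>\<^sub>\<infinity>k. f n k) \<longlonglongrightarrow> (\<Sum>\<^sub>\<infinity>k. g k)"
proof -
  have bij: "bij_betw int_decode UNIV UNIV" by (simp add: bij_int_decode)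
  have h': "summable (\<lambda>i. h (int_decode i))"
    using h summable_on_reindex_bij_betw[OF bij, of h] summable_on_imp_summable by blast
  have nonneg: "h k \<ge> 0" for k using bound[of 0 k] norm_ge_zero order_trans by blast
  have gb: "norm (g k) \<le> h k" for k
    by (rule tendsto_upperbound[OF tendsto_norm[OF lim[of k]]]) (auto simp: bound)
  have conv: "(\<Sum>\<^sub>\<infinity>k. F k) = (\<Sum>i. F (int_decode i))" if "\<And>k. norm (F k) \<le> h k" for F :: "int \<Rightarrow> complex"
  proof -
    have s: "summable (\<lambda>i. norm (F (int_decode i)))"
      by (rule summable_comparison_test'[OF h', of 0]) (simp add: that)
    have "((\<lambda>i. F (int_decode i)) has_sum (\<Sum>i. F (int_decode i))) UNIV"
      using s by (intro norm_summable_imp_has_sum) (auto intro: summable_sums summable_norm_cancel)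
    then show ?thesis using infsum_reindex_bij_betw[OF bij, of F] infsumI by metis
  qed
  have "(\<lambda>n. \<Sum>i. f n (int_decode i)) \<longlonglongrightarrow> (\<Sum>i. g (int_decode i))"
    using tannerys_theorem[of "\<lambda>i n. f n (int_decode i)" "\<lambda>i. g (int_decode i)" sequentially "\<lambda>i. h (int_decode i)"]
    by (simp add: lim bound h' case_prod_unfold)
  then show ?thesis by (simp add: conv bound gb)
qed

lemma summable_on_int:
  fixes f :: "int \<Rightarrow> complex"
  assumes "(\<lambda>n. f (int n)) summable_on UNIV" "(\<lambda>n. f (- int n)) summable_on UNIV"
  shows "f summable_on UNIV"
proof -
  have "f summable_on (range int)"
    using assms(1) by (subst summable_on_reindex) (auto simp: o_def)
  moreover have "f summable_on (range (\<lambda>n. - int n))"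
    using assms(2) by (subst summable_on_reindex) (auto simp: o_def inj_def)
  ultimately have "f summable_on (range int \<union> range (\<lambda>n. - int n))" by (rule summable_on_union)
  moreover have "range int \<union> range (\<lambda>n. - int n) = UNIV"
    by (metis (no_types, lifting) UNIV_eq_I UnCI int_cases2 rangeI)
  ultimately show ?thesis by simp
qed

text \<open>
  The bound r n for the quotient of consecutive terms may depend on n: for theta series and basic
  hypergeometric series the quotients only converge.
\<close>

lemma summable_on_nat_ratio:
  fixes f :: "nat \<Rightarrow> complex"
  assumes "\<And>n. norm (f (Suc n)) \<le> r n * norm (f n)" "r \<longlonglongrightarrow> c" "c < 1"
  shows "f summable_on UNIV"
proof -
  obtain d where d: "c < d" "d < 1" using assms(3) dense by blast
  have "\<forall>\<^sub>F n in sequentially. r n < d" using order_tendstoD(2)[OF assms(2) d(1)] .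
  then obtain N where N: "\<And>n. n \<ge> N \<Longrightarrow> r n < d" by (auto simp: eventually_sequentially)
  have "summable (\<lambda>n. norm (f n))"
  proof (rule summable_ratio_test[OF d(2)])
    fix n assume "n \<ge> N"
    then have "r n * norm (f n) \<le> d * norm (f n)" using N by (intro mult_right_mono) (auto intro: less_imp_le)
    then show "norm (norm (f (Suc n))) \<le> d * norm (norm (f n))" using assms(1)[of n] by simp
  qed
  then show ?thesis by (rule norm_summable_imp_summable_on)
qed

lemma infsum_int_shift: "(\<Sum>\<^sub>\<infinity>k::int. f (k + a)) = (\<Sum>\<^sub>\<infinity>k. f k)"
  by (rule infsum_reindex_bij_witness[of _ "\<lambda>k. k - a" "\<lambda>k. k + a"]) auto

lemma infsum_int_reflect: "(\<Sum>\<^sub>\<infinity>k::int. f (a - k)) = (\<Sum>\<^sub>\<infinity>k. f k)"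
  by (rule infsum_reindex_bij_witness[of _ "\<lambda>k. a - k" "\<lambda>k. a - k"]) auto

lemma summable_on_int_shift: "(\<lambda>k::int. f (k + a)) summable_on UNIV \<longleftrightarrow> f summable_on UNIV"
  by (rule summable_on_reindex_bij_witness[of _ "\<lambda>k. k - a" "\<lambda>k. k + a"]) auto

lemma summable_on_int_reflect: "(\<lambda>k::int. f (a - k)) summable_on UNIV \<longleftrightarrow> f summable_on UNIV"
  by (rule summable_on_reindex_bij_witness[of _ "\<lambda>k. a - k" "\<lambda>k. a - k"]) auto

lemma infsum_antisym:
  fixes f :: "int \<Rightarrow> complex"
  assumes "\<And>s. f (a - s) = - f s" shows "infsum f UNIV = 0"
proof -
  have "infsum f UNIV = (\<Sum>\<^sub>\<infinity>s. - f s)" using infsum_int_reflect[of f a] assms by simp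
  then show ?thesis unfolding infsum_uminus by simp
qed

lemma summable_mult_bounded:
  fixes f g :: "'a \<Rightarrow> complex"
  assumes f: "f summable_on A" and B: "\<And>x. x \<in> A \<Longrightarrow> norm (g x) \<le> B"
  shows "(\<lambda>x. f x * g x) summable_on A"
proof -
  have "(\<lambda>x. norm (f x * g x)) summable_on A"
  proof (rule Infinite_Sum.abs_summable_on_comparison_test'[where g = "\<lambda>k. norm (f k) * B"])
    show "(\<lambda>k. norm (f k) * B) summable_on A"
      using f by (intro summable_on_cmult_left) (simp flip: summable_on_iff_abs_summable_on_complex)
  qed (simp add: norm_mult B mult_left_mono)
  then show ?thesis by (rule abs_summable_summable)
qed

lemma infsum_lincomb:
  fixes f g :: "'a \<Rightarrow> complex"
  assumes "f summable_on A" "g summable_on A"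
  shows "infsum (\<lambda>x. a * f x + b * g x) A = a * infsum f A + b * infsum g A"
proof -
  have "infsum (\<lambda>x. a * f x + b * g x) A = infsum (\<lambda>x. a * f x) A + infsum (\<lambda>x. b * g x) A"
    by (intro infsum_add summable_on_cmult_right assms)
  then show ?thesis by (simp add: infsum_cmult_right')
qed

lemma summable_on_norm_product:
  fixes a :: "'a \<Rightarrow> complex" and b :: "'b \<Rightarrow> complex"
  assumes "a summable_on UNIV" "b summable_on UNIV"
  shows "(\<lambda>(x, y). norm (a x) * norm (b y)) summable_on UNIV \<times> UNIV"
proof -
  have "(\<lambda>x. norm (case x of (s, m) \<Rightarrow> a s * b m)) summable_on UNIV \<times> UNIV"
    by (rule iffD2[OF Infinite_Sum.abs_summable_on_Sigma_iff[of "\<lambda>(s,m). a s * b m" UNIV "\<lambda>_. UNIV"]])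
      (use assms in \<open>auto simp: norm_mult abs_mult infsum_cmult_right' intro!: summable_on_cmult_right summable_on_cmult_left
         simp flip: summable_on_iff_abs_summable_on_complex\<close>)
  then show ?thesis by (simp add: case_prod_unfold norm_mult)
qed

section \<open>Convolution and Laurent series\<close>

definition conv :: "(int \<Rightarrow> complex) \<Rightarrow> (int \<Rightarrow> complex) \<Rightarrow> int \<Rightarrow> complex" where
  "conv a b k = (\<Sum>\<^sub>\<infinity>s. a (k - s) * b s)"

text \<open>
  The bijection (k, s) \<mapsto> (s, k - s) turns the double sum into a product of two sums.
\<close>

lemma conv_has_sum:
  assumes a: "a summable_on UNIV" and b: "b summable_on UNIV"
  shows "(conv a b has_sum (infsum a UNIV * infsum b UNIV)) UNIV"
proof -
  have P: "(\<lambda>(s, m). b s * a m) summable_on UNIV \<times> UNIV"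
    by (rule abs_summable_summable) (use summable_on_norm_product[OF b a] in \<open>simp add: case_prod_unfold norm_mult\<close>)
  define S where "S = infsum (\<lambda>(s, m). b s * a m) (UNIV \<times> UNIV)"
  have "((\<lambda>(s, m). b s * a m) has_sum S) (UNIV \<times> UNIV)" using P S_def by simp
  then have Q: "((\<lambda>(k, s). a (k - s) * b s) has_sum S) (UNIV \<times> UNIV)"
    by (subst has_sum_reindex_bij_witness[of _ "\<lambda>(s,m). (s+m, s)" "\<lambda>(k,s). (s, k - s)" _ "\<lambda>(s, m). b s * a m"]) auto
  have "((\<lambda>s. a (k - s) * b s) has_sum conv a b k) UNIV" for k
    unfolding conv_def using summable_on_SigmaD1[OF has_sum_imp_summable[OF Q], of k] by simp
  then have 1: "(conv a b has_sum S) UNIV"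
    using has_sum_SigmaD[OF Q, of "conv a b"] by simp
  have "((\<lambda>m. b s * a m) has_sum b s * infsum a UNIV) UNIV" for s
    using a by (intro has_sum_cmult_right) simp
  then have "((\<lambda>s. b s * infsum a UNIV) has_sum S) UNIV"
    using has_sum_SigmaD[OF \<open>((\<lambda>(s, m). b s * a m) has_sum S) (UNIV \<times> UNIV)\<close>, of "\<lambda>s. b s * infsum a UNIV"] by simp
  then have "S = infsum b UNIV * infsum a UNIV" by (metis infsumI infsum_cmult_left')
  then show ?thesis using 1 by (simp add: mult.commute)
qed

lemma conv_summand:
  fixes a b :: "int \<Rightarrow> complex"
  assumes a: "a summable_on UNIV" and B: "\<And>s. norm (b s) \<le> B"
  shows "(\<lambda>s. a (k - s) * b s) summable_on UNIV"
  by (rule summable_mult_bounded[OF summable_on_int_reflect[THEN iffD2, OF a] B])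

definition laurent :: "(int \<Rightarrow> complex) \<Rightarrow> complex \<Rightarrow> complex" where
  "laurent a u = (\<Sum>\<^sub>\<infinity>k. a k * u powi k)"

text \<open>
  Theta series have this property, which allows an identity between coefficient sequences to be
  evaluated at every u \<noteq> 0.
\<close>

definition entire :: "(int \<Rightarrow> complex) \<Rightarrow> bool" where
  "entire a \<longleftrightarrow> (\<forall>u. u \<noteq> 0 \<longrightarrow> (\<lambda>k. a k * u powi k) summable_on UNIV)"

lemma entireD: "entire a \<Longrightarrow> u \<noteq> 0 \<Longrightarrow> (\<lambda>k. a k * u powi k) summable_on UNIV"
  unfolding entire_def by blast

lemma conv_powi: "u \<noteq> 0 \<Longrightarrow> conv a b k * u powi k = conv (\<lambda>k. a k * u powi k) (\<lambda>k. b k * u powi k) k"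
  unfolding conv_def
  by (subst infsum_cmult_left'[symmetric])
     (rule infsum_cong, simp add: algebra_simps flip: power_int_add)

lemma laurent_conv:
  assumes "u \<noteq> 0" "(\<lambda>k. a k * u powi k) summable_on UNIV" "(\<lambda>k. b k * u powi k) summable_on UNIV"
  shows "(\<lambda>k. conv a b k * u powi k) summable_on UNIV"
    "laurent (conv a b) u = laurent a u * laurent b u"
  using conv_has_sum[OF assms(2,3)] unfolding laurent_def conv_powi[OF assms(1)]
  by (auto simp: has_sum_iff)

lemma entire_conv: "entire a \<Longrightarrow> entire b \<Longrightarrow> entire (conv a b)"
  unfolding entire_def by (auto intro: laurent_conv)

section \<open>The q-Pochhammer symbol and its limit\<close>

lemma qpoch_0 [simp]: "qpoch x q 0 = 1" by (simp add: qpoch_def)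
lemma qpoch_Suc: "qpoch x q (Suc n) = qpoch x q n * (1 - q ^ n * x)" by (simp add: qpoch_def)
lemma qpoch_Suc': "qpoch x q (Suc n) = (1 - x) * qpoch (q * x) q n"
  unfolding qpoch_def by (subst prod.lessThan_Suc_shift) (simp add: mult_ac)
lemma qpoch_add: "qpoch x q (m + n) = qpoch x q m * qpoch (q ^ m * x) q n"
  by (induction m arbitrary: x) (simp_all add: qpoch_Suc' mult.assoc power_Suc2 del: power_Suc)

lemma qpoch_square: "qpoch (x\<^sup>2) (q\<^sup>2) n = qpoch x q n * qpoch (- x) q n"
  unfolding qpoch_def prod.distrib[symmetric]
  by (rule prod.cong) (auto simp: algebra_simps power2_eq_square power_mult_distrib)

lemma qpoch_split2: "qpoch x q (2 * n) = qpoch x (q\<^sup>2) n * qpoch (q * x) (q\<^sup>2) n"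
  by (induction n) (simp_all add: qpoch_Suc power_mult[symmetric] algebra_simps)

lemma qpoch_split3:
  "qpoch x q (3 * n) = qpoch x (q ^ 3) n * qpoch (q * x) (q ^ 3) n * qpoch (q\<^sup>2 * x) (q ^ 3) n"
proof (induction n)
  case (Suc n)
  have "3 * Suc n = Suc (Suc (Suc (3 * n)))" by simp
  moreover have "(q ^ 3) ^ n = q ^ (3 * n)" by (simp add: power_mult)
  ultimately show ?case using Suc by (simp only: qpoch_Suc) (simp add: power2_eq_square mult_ac)
qed simp

definition qinf :: "complex \<Rightarrow> complex \<Rightarrow> complex" where
  "qinf x q = (\<Prod>n. 1 - q ^ n * x)"

lemma qinf_convergent: assumes "norm q < 1" shows "convergent_prod (\<lambda>n. 1 - q ^ n * (x::complex))"
proof -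
  have "summable (\<lambda>n. norm (1 - q ^ n * x - 1))"
    using assms by (simp add: norm_mult norm_power summable_mult2 summable_geometric)
  then show ?thesis by (simp add: abs_convergent_prod_conv_summable abs_convergent_prod_imp_convergent_prod)
qed

lemma qpoch_LIMSEQ: assumes "norm q < 1" shows "(\<lambda>n. qpoch x q n) \<longlonglongrightarrow> qinf x q"
proof -
  have "(\<lambda>n. qpoch x q (Suc n)) \<longlonglongrightarrow> qinf x q"
    using convergent_prod_LIMSEQ[OF qinf_convergent[OF assms, of x]]
    unfolding qpoch_def qinf_def lessThan_Suc_atMost .
  then show ?thesis by (simp only: filterlim_sequentially_Suc)
qed

lemma qinf_nonzero:
  assumes "norm q < 1" "\<And>n. q ^ n * x \<noteq> 1" shows "qinf x q \<noteq> 0"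
  unfolding qinf_def using assms by (intro prodinf_nonzero qinf_convergent) auto

lemma qinf_nonzero_norm:
  assumes "norm q < 1" "norm x < 1" shows "qinf x q \<noteq> 0"
proof (rule qinf_nonzero[OF assms(1)])
  fix n show "q ^ n * x \<noteq> 1"
  proof
    assume "q ^ n * x = 1"
    then have "norm q ^ n * norm x = 1" by (metis norm_mult norm_one norm_power)
    moreover have "norm q ^ n * norm x \<le> 1 * norm x"
      using assms(1) by (intro mult_right_mono) (auto simp: power_le_one)
    ultimately show False using assms(2) by simp
  qed
qed

lemma qpoch_nonzero: "(\<And>n. q ^ n * x \<noteq> 1) \<Longrightarrow> qpoch x q m \<noteq> 0"
  by (auto simp: qpoch_def)

lemma qpoch_eq_0_iff: "qpoch x q n = 0 \<longleftrightarrow> (\<exists>i<n. q ^ i * x = 1)"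
  by (auto simp: qpoch_def)

lemma power_ne_1: assumes "norm (x::complex) < 1" "n > 0" shows "x ^ n \<noteq> 1"
proof
  assume "x ^ n = 1"
  then have "norm x ^ n = 1" by (metis norm_one norm_power)
  then show False using assms by (metis norm_ge_zero power_less_one_iff less_irrefl)
qed

lemma norm_lt_1_power: "norm (q::complex) < 1 \<Longrightarrow> n > 0 \<Longrightarrow> norm (q ^ n) < 1"
  by (simp add: norm_power power_less_one_iff)

lemma sq_norm: "norm Q < 1 \<Longrightarrow> Q \<noteq> 0 \<Longrightarrow> norm (Q\<^sup>2) < 1 \<and> Q\<^sup>2 \<noteq> (0::complex)"
  using norm_lt_1_power[of Q 2] by simp

lemma qpoch_self_nonzero: assumes "norm q < 1" shows "qpoch q q n \<noteq> 0"
  by (rule qpoch_nonzero) (use power_ne_1[OF assms, of "Suc _"] in \<open>simp add: power_commutes\<close>)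

lemma qinf_self_nonzero: "norm q < 1 \<Longrightarrow> qinf q q \<noteq> 0" by (rule qinf_nonzero_norm)

lemma qinf_Suc: "norm q < 1 \<Longrightarrow> qinf x q = (1 - x) * qinf (q * x) q"
proof -
  assume q: "norm q < 1"
  have "(\<lambda>n. qpoch x q (Suc n)) \<longlonglongrightarrow> qinf x q"
    by (simp only: filterlim_sequentially_Suc) (rule qpoch_LIMSEQ[OF q])
  moreover have "(\<lambda>n. qpoch x q (Suc n)) \<longlonglongrightarrow> (1 - x) * qinf (q * x) q"
    unfolding qpoch_Suc' by (intro tendsto_intros qpoch_LIMSEQ[OF q])
  ultimately show ?thesis by (rule LIMSEQ_unique)
qed

lemma qinf_1: assumes "norm q < 1" shows "qinf 1 q = 0"
  using qinf_Suc[OF assms, of 1] by simp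

lemma qinf_square: assumes "norm q < 1" shows "qinf (x\<^sup>2) (q\<^sup>2) = qinf x q * qinf (- x) q"
proof (rule LIMSEQ_unique)
  show "(\<lambda>n. qpoch (x\<^sup>2) (q\<^sup>2) n) \<longlonglongrightarrow> qinf (x\<^sup>2) (q\<^sup>2)"
    using assms by (intro qpoch_LIMSEQ) (simp add: norm_power power_less_one_iff)
  show "(\<lambda>n. qpoch (x\<^sup>2) (q\<^sup>2) n) \<longlonglongrightarrow> qinf x q * qinf (- x) q"
    unfolding qpoch_square by (intro tendsto_intros qpoch_LIMSEQ assms)
qed

lemma qinf_split2: assumes "norm q < 1" shows "qinf x q = qinf x (q\<^sup>2) * qinf (q * x) (q\<^sup>2)"
proof (rule LIMSEQ_unique)
  have "filterlim (\<lambda>n::nat. 2 * n) sequentially sequentially"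
    by (rule filterlim_subseq) (auto simp: strict_mono_def)
  then show "(\<lambda>n. qpoch x q (2 * n)) \<longlonglongrightarrow> qinf x q" by (rule filterlim_compose[OF qpoch_LIMSEQ[OF assms]])
  show "(\<lambda>n. qpoch x q (2 * n)) \<longlonglongrightarrow> qinf x (q\<^sup>2) * qinf (q * x) (q\<^sup>2)"
    unfolding qpoch_split2 using assms by (intro tendsto_intros qpoch_LIMSEQ) (simp_all add: norm_power power_less_one_iff)
qed

lemma qinf_split3:
  assumes "norm q < 1"
  shows "qinf x q = qinf x (q ^ 3) * qinf (q * x) (q ^ 3) * qinf (q\<^sup>2 * x) (q ^ 3)"
proof (rule LIMSEQ_unique)
  have "filterlim (\<lambda>n::nat. 3 * n) sequentially sequentially"
    by (rule filterlim_subseq) (auto simp: strict_mono_def)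
  then show "(\<lambda>n. qpoch x q (3 * n)) \<longlonglongrightarrow> qinf x q" by (rule filterlim_compose[OF qpoch_LIMSEQ[OF assms]])
  show "(\<lambda>n. qpoch x q (3 * n)) \<longlonglongrightarrow> qinf x (q ^ 3) * qinf (q * x) (q ^ 3) * qinf (q\<^sup>2 * x) (q ^ 3)"
    unfolding qpoch_split3 using assms by (intro tendsto_intros qpoch_LIMSEQ) (simp_all add: norm_power power_less_one_iff)
qed

text \<open>
  A sequence of nonzero numbers with nonzero limit stays away from 0.  The two bounds supply the
  dominating series wherever a quotient of q-Pochhammer symbols passes to the limit.
\<close>

lemma qpoch_bounds:
  assumes "norm q < 1" "\<And>n. q ^ n * x \<noteq> 1"
  obtains e C where "e > 0" "\<And>n. e \<le> norm (qpoch x q n)" "\<And>n. norm (qpoch x q n) \<le> C"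
proof -
  have "Bseq (\<lambda>n. qpoch x q n)" using qpoch_LIMSEQ[OF assms(1)] convergentI convergent_imp_Bseq by blast
  then obtain C where C: "\<And>n. norm (qpoch x q n) \<le> C" unfolding Bseq_def by blast
  have "(\<lambda>n. inverse (qpoch x q n)) \<longlonglongrightarrow> inverse (qinf x q)"
    by (intro tendsto_inverse qpoch_LIMSEQ qinf_nonzero assms)
  then have "Bseq (\<lambda>n. inverse (qpoch x q n))" using convergentI convergent_imp_Bseq by blast
  then obtain D where D: "D > 0" "\<And>n. norm (inverse (qpoch x q n)) \<le> D" unfolding Bseq_def by blast
  have "1 / D \<le> norm (qpoch x q n)" for n
    using D(2)[of n] D(1) qpoch_nonzero[of q x n, OF assms(2)]
    by (simp add: norm_inverse field_simps norm_divide)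
  with C D(1) that[of "1/D" C] show thesis by simp
qed

section \<open>The Jacobi triple product\<close>

text \<open>
  The value 0 at negative indices is the usual convention for 1 / (q;q)_m.  It truncates bilateral
  sums, so that finite sums can be shifted and reflected like sums over all integers; it is also what
  makes rec_qpoch_diff_1 true for m \<le> 0.
\<close>

definition rec_qpoch :: "complex \<Rightarrow> int \<Rightarrow> complex" where
  "rec_qpoch q m = (if m < 0 then 0 else 1 / qpoch q q (nat m))"

lemma rec_qpoch_neg [simp]: "m < 0 \<Longrightarrow> rec_qpoch q m = 0" by (simp add: rec_qpoch_def)
lemma rec_qpoch_0 [simp]: "rec_qpoch q 0 = 1" by (simp add: rec_qpoch_def)

lemma rec_qpoch_diff_1: assumes "norm q < 1" shows "rec_qpoch q (m - 1) = (1 - q powi m) * rec_qpoch q m"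
proof (cases "m \<le> 0")
  case True then show ?thesis by (cases "m = 0") auto
next
  case False
  then obtain k where k: "m = int (Suc k)" by (metis not_le zero_less_imp_eq_int gr0_implies_Suc)
  have "q ^ Suc k \<noteq> 1" by (rule power_ne_1[OF assms]) simp
  then show ?thesis using qpoch_self_nonzero[OF assms, of k] unfolding k rec_qpoch_def
    by (simp add: qpoch_Suc power_commutes del: of_nat_Suc power_Suc flip: power_Suc2) (simp add: field_simps)
qed

lemma rec_qpoch_bound: assumes "norm q < 1" obtains C where "\<And>m. norm (rec_qpoch q m) \<le> C" "C \<ge> 1"
proof -
  obtain e C where e: "e > 0" "\<And>n. e \<le> norm (qpoch q q n)"
    using qpoch_bounds[OF assms, of q] power_ne_1[OF assms, of "Suc _"] by (metis power_Suc2 zero_less_Suc)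
  have "norm (rec_qpoch q m) \<le> 1 / e" for m
    using e(1) e(2)[of "nat m"] by (auto simp: rec_qpoch_def norm_divide intro!: divide_left_mono mult_pos_pos)
  moreover have "1 / e \<ge> 1" using e(2)[of 0] e(1) by simp
  ultimately show thesis using that by blast
qed

lemma rec_qpoch_LIMSEQ: assumes "norm q < 1" shows "(\<lambda>n. rec_qpoch q (int n + c)) \<longlonglongrightarrow> 1 / qinf q q"
proof -
  have *: "(\<lambda>n. rec_qpoch q (int n)) \<longlonglongrightarrow> 1 / qinf q q"
    unfolding rec_qpoch_def using qpoch_LIMSEQ[OF assms, of q] qinf_self_nonzero[OF assms] by (auto intro!: tendsto_intros)
  show ?thesis
  proof (cases "c \<ge> 0")
    case True
    have "(\<lambda>n. rec_qpoch q (int (n + nat c))) \<longlonglongrightarrow> 1 / qinf q q" using * by (rule LIMSEQ_ignore_initial_segment)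
    then show ?thesis using True by simp
  next
    case False
    have "(\<lambda>n. rec_qpoch q (int (n + nat (- c)) + c)) \<longlonglongrightarrow> 1 / qinf q q" using * False by simp
    then show ?thesis by (rule LIMSEQ_offset)
  qed
qed

definition tri :: "int \<Rightarrow> int" where "tri k = k * (k - 1) div 2"

lemma tri_double: "2 * tri k = k * (k - 1)" unfolding tri_def by simp
lemma tri_Suc: "tri (k + 1) = tri k + k" using tri_double[of k] tri_double[of "k + 1"] by (simp add: algebra_simps)
lemma tri_reflect: "tri (1 - k) = tri k" using tri_double[of k] tri_double[of "1 - k"] by (simp add: algebra_simps)
lemma tri_uminus: "tri (- k) = tri k + k" using tri_double[of k] tri_double[of "- k"] by (simp add: algebra_simps)
lemma tri_nonneg: "tri k \<ge> 0" proof -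
  have "k * (k - 1) \<ge> 0" by (cases "k \<ge> 1") (auto intro: mult_nonneg_nonneg mult_nonpos_nonpos)
  then show ?thesis using tri_double[of k] by linarith
qed
lemma tri_0 [simp]: "tri 0 = 0" and tri_1 [simp]: "tri 1 = 0" by (simp_all add: tri_def)

definition msgn :: "int \<Rightarrow> complex" where "msgn k = (if even k then 1 else -1)"

lemma msgn_add: "msgn (a + b) = msgn a * msgn b" by (auto simp: msgn_def)
lemma msgn_simps [simp]: "msgn 0 = 1" "msgn 1 = -1" "msgn (- k) = msgn k" "msgn k * msgn k = 1" "msgn (2 * k) = 1"
   "norm (msgn k) = 1" "msgn k \<noteq> 0" "msgn (k + 1) = - msgn k" "msgn (1 - k) = - msgn k" "msgn (k - 1) = - msgn k"
  by (auto simp: msgn_def)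

lemma msgn_powi: "(-1) powi k = msgn k"
proof (cases "k \<ge> 0")
  case True
  then obtain n where "k = int n" using nonneg_int_cases by blast
  then show ?thesis by (simp add: msgn_def uminus_power_if)
next
  case False
  then obtain n where "k = - int n" by (metis int_cases2 nle_le of_nat_0_le_iff)
  then show ?thesis by (simp add: msgn_def uminus_power_if power_int_minus)
qed

text \<open>
  The coefficients of Jacobi's theta function jtheta u q, which has a simple zero at u = 1.
\<close>

definition theta_coeff :: "complex \<Rightarrow> int \<Rightarrow> complex" where "theta_coeff q k = msgn k * q powi tri k"

lemma theta_coeff_Suc: "q \<noteq> 0 \<Longrightarrow> theta_coeff q (k + 1) = - (q powi k) * theta_coeff q k"
  by (simp add: theta_coeff_def tri_Suc power_int_add)

lemma theta_coeff_reflect: "theta_coeff q (1 - k) = - theta_coeff q k" by (simp add: theta_coeff_def tri_reflect)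

text \<open>
  A truncated theta series: only - N \<le> j \<le> M contributes, and the weights are the q-binomial
  coefficients divided by (q;q)_(M+N).
\<close>

definition finite_jtheta :: "complex \<Rightarrow> complex \<Rightarrow> nat \<Rightarrow> nat \<Rightarrow> complex" where
  "finite_jtheta q z M N = (\<Sum>\<^sub>\<infinity>j. theta_coeff q j * z powi j * rec_qpoch q (int M - j) * rec_qpoch q (int N + j))"

lemma summable_on_finite_support:
  fixes f :: "int \<Rightarrow> complex"
  assumes "\<And>j. j < a \<or> j > b \<Longrightarrow> f j = 0" shows "f summable_on UNIV"
proof -
  have "f summable_on {a..b}" by simp
  then show ?thesis by (rule summable_on_cong_neutral[THEN iffD1, rotated -1]) (use assms in auto)
qed

text \<open>
  The factor 1 - q^(M+N+1) splits as (1 - q^(M+1-j)) + q^(M+1-j) (1 - q^(N+j)), and rec_qpoch_diff_1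
  absorbs each piece into one of the two weights.
\<close>

lemma finite_jtheta_Suc_left:
  assumes q: "norm q < 1" "q \<noteq> 0" and z: "z \<noteq> 0"
  shows "(1 - q ^ (M + N + 1)) * finite_jtheta q z (Suc M) N = (1 - q ^ M * z) * finite_jtheta q z M N"
proof -
  define f where "f = (\<lambda>j. theta_coeff q j * z powi j * rec_qpoch q (int M - j) * rec_qpoch q (int N + j))"
  have s: "f summable_on UNIV" unfolding f_def by (rule summable_on_finite_support[of "- int N" "int M"]) auto
  have c: "(1 - q ^ (M + N + 1)) * (theta_coeff q j * z powi j * rec_qpoch q (int (Suc M) - j) * rec_qpoch q (int N + j))
        = f j - q ^ M * z * f (j + (-1))" for j
  proof -
    define A where "A = rec_qpoch q (int M + 1 - j)"
    define B where "B = rec_qpoch q (int N + j)"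
    have 1: "rec_qpoch q (int M - j) = (1 - q powi (int M + 1 - j)) * A"
      unfolding A_def using rec_qpoch_diff_1[OF q(1), of "int M + 1 - j"] by (simp add: algebra_simps)
    have 2: "rec_qpoch q (int N + j - 1) = (1 - q powi (int N + j)) * B"
      unfolding B_def using rec_qpoch_diff_1[OF q(1), of "int N + j"] by simp
    have 3: "theta_coeff q j = - (q powi (j - 1)) * theta_coeff q (j - 1)" using theta_coeff_Suc[OF q(2), of "j - 1"] by simp
    have 4: "z powi j = z * z powi (j - 1)" using z by (simp add: power_int_diff)
    have "f (j + (-1)) = theta_coeff q (j-1) * z powi (j-1) * A * ((1 - q powi (int N + j)) * B)"
    proof -
      have "int M - (j + (-1)) = int M + 1 - j" "int N + (j + (-1)) = int N + j - 1" "j + (-1) = j - 1" by simp_all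
      then show ?thesis unfolding f_def A_def by (simp only: 2)
    qed
    moreover have "f j = - (q powi (j - 1)) * theta_coeff q (j - 1) * (z * z powi (j - 1)) * ((1 - q powi (int M + 1 - j)) * A) * B"
      unfolding f_def 1 3 4 B_def by simp
    moreover have "q powi (j - 1) * q powi (int M + 1 - j) = q ^ M"
      using q(2) by (simp flip: power_int_add power_int_of_nat)
    moreover have "q ^ M * q powi (int N + j) = q powi (j - 1) * q ^ (M + N + 1)"
      using q(2) by (simp add: algebra_simps flip: power_int_add power_int_of_nat)
    moreover have "rec_qpoch q (int (Suc M) - j) = A" unfolding A_def by (simp add: algebra_simps)
    moreover have "(1 - R) * (- X * P * (z * Z) * A * B) = - X * P * (z * Z) * ((1 - Y) * A) * B - T * z * (P * Z * A * ((1 - W) * B))"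
      if "X * Y = T" "T * W = X * R" for X Y T W R P Z :: complex
    proof -
      have "(1 - R) * (- X * P * (z * Z) * A * B) - (- X * P * (z * Z) * ((1 - Y) * A) * B - T * z * (P * Z * A * ((1 - W) * B)))
         = z * P * Z * A * B * ((X * R - T * W) + (T - X * Y))" by (simp add: algebra_simps)
      then show ?thesis using that by simp
    qed
    ultimately show ?thesis unfolding 3 4 B_def[symmetric] by simp
  qed
  have "(1 - q ^ (M + N + 1)) * finite_jtheta q z (Suc M) N
      = (\<Sum>\<^sub>\<infinity>j. f j + - (q ^ M * z) * f (j + (-1)))"
    unfolding finite_jtheta_def infsum_cmult_right'[symmetric] by (rule infsum_cong) (simp only: c, simp)
  also have "\<dots> = (\<Sum>\<^sub>\<infinity>j. f j) + (\<Sum>\<^sub>\<infinity>j. - (q ^ M * z) * f (j + (-1)))"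
    using s summable_on_int_shift[of f "-1"] by (intro infsum_add summable_on_cmult_right) auto
  also have "\<dots> = (1 - q ^ M * z) * (\<Sum>\<^sub>\<infinity>j. f j)"
    unfolding infsum_cmult_right' infsum_int_shift[of f "-1"] by (simp add: algebra_simps)
  finally show ?thesis unfolding finite_jtheta_def f_def .
qed

text \<open>
  Reflection j \<mapsto> -j exchanges M and N, so that the recursion in M also serves for N.
\<close>

lemma finite_jtheta_swap: assumes "q \<noteq> 0" "z \<noteq> 0" shows "finite_jtheta q z M N = finite_jtheta q (q / z) N M"
proof -
  have "finite_jtheta q z M N = (\<Sum>\<^sub>\<infinity>j. theta_coeff q (0 - j) * z powi (0 - j) * rec_qpoch q (int M - (0 - j)) * rec_qpoch q (int N + (0 - j)))"
    unfolding finite_jtheta_def by (rule infsum_int_reflect[symmetric])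
  also have "\<dots> = finite_jtheta q (q / z) N M"
    unfolding finite_jtheta_def
    by (rule infsum_cong) (use assms in \<open>simp add: theta_coeff_def tri_uminus power_int_add power_int_divide_distrib power_int_minus field_simps\<close>)
  finally show ?thesis .
qed

theorem finite_jacobi_triple:
  assumes q: "norm q < 1" "q \<noteq> 0" and z: "z \<noteq> 0"
  shows "finite_jtheta q z M N = qpoch z q M * qpoch (q / z) q N / qpoch q q (M + N)"
proof (induction M)
  case 0
  have nz: "1 - q ^ (k + 1) \<noteq> 0" for k using power_ne_1[OF q(1), of "k+1"] by simp
  have "finite_jtheta q z 0 N = qpoch (q / z) q N / qpoch q q N"
  proof (induction N)
    case 0
    have "finite_jtheta q z 0 0 = (\<Sum>\<^sub>\<infinity>j\<in>{0}. theta_coeff q j * z powi j * rec_qpoch q (int 0 - j) * rec_qpoch q (int 0 + j))"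
      unfolding finite_jtheta_def by (rule infsum_cong_neutral) (auto simp: linorder_neq_iff)
    then show ?case by (simp add: theta_coeff_def)
  next
    case (Suc N)
    have "(1 - q ^ (N + 1)) * finite_jtheta q (q / z) (Suc N) 0 = (1 - q ^ N * (q / z)) * finite_jtheta q (q / z) N 0"
      using finite_jtheta_Suc_left[OF q, of "q / z" N 0] q z by simp
    then have "(1 - q ^ (N + 1)) * finite_jtheta q z 0 (Suc N) = (1 - q ^ N * (q / z)) * (qpoch (q / z) q N / qpoch q q N)"
      using Suc finite_jtheta_swap[OF q(2) z, of 0] by simp
    then show ?case using nz[of N] qpoch_self_nonzero[OF q(1), of N]
      by (simp add: qpoch_Suc field_simps)
  qed
  then show ?case by simp
next
  case (Suc M)
  have nz: "1 - q ^ (M + N + 1) \<noteq> 0" using power_ne_1[OF q(1), of "M+N+1"] by simp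
  have 2: "qpoch q q (Suc M + N) = qpoch q q (M + N) * (1 - q ^ (M + N + 1))" by (simp add: qpoch_Suc)
  show ?case using finite_jtheta_Suc_left[OF q z, of M N] nz qpoch_self_nonzero[OF q(1), of "M+N"]
    unfolding Suc 2 qpoch_Suc[of z] by (simp add: field_simps del: power_Suc)
qed

lemma theta_coeff_summable:
  assumes q: "norm q < 1" "q \<noteq> 0" shows "entire (theta_coeff q)"
  unfolding entire_def
proof (intro allI impI)
  have *: "(\<lambda>n. theta_coeff q (int n) * u powi (int n)) summable_on UNIV" if "u \<noteq> 0" for u
  proof (rule summable_on_nat_ratio[where r = "\<lambda>n. norm q ^ n * norm u" and c = 0])
    show "norm (theta_coeff q (int (Suc n)) * u powi int (Suc n)) \<le> norm q ^ n * norm u * norm (theta_coeff q (int n) * u powi int n)" for n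
      using theta_coeff_Suc[OF q(2), of "int n"] that by (simp add: norm_mult norm_power norm_power_int add.commute power_int_add)
    have "(\<lambda>n. norm q ^ n) \<longlonglongrightarrow> 0" using q by (intro LIMSEQ_power_zero) simp
    then show "(\<lambda>n. norm q ^ n * norm u) \<longlonglongrightarrow> 0" by (rule tendsto_mult_left_zero)
  qed simp
  fix u :: complex assume u: "u \<noteq> 0"
  show "(\<lambda>k. theta_coeff q k * u powi k) summable_on UNIV"
  proof (rule summable_on_int)
    show "(\<lambda>n. theta_coeff q (int n) * u powi (int n)) summable_on UNIV" by (rule *[OF u])
    have "theta_coeff q (- int n) * u powi - int n = theta_coeff q (int n) * (q / u) powi int n" for n
      using u q by (simp add: theta_coeff_def tri_uminus power_int_add power_int_divide_distrib power_int_minus field_simps)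
    then show "(\<lambda>n. theta_coeff q (- int n) * u powi - int n) summable_on UNIV" using *[of "q / u"] u q by simp
  qed
qed

definition jtheta :: "complex \<Rightarrow> complex \<Rightarrow> complex" where "jtheta u q = laurent (theta_coeff q) u"

text \<open>
  Both weights tend to 1 / (q;q) and are bounded uniformly in n and j, so the limit may be taken
  termwise.
\<close>

lemma finite_jtheta_limit:
  assumes q: "norm q < 1" "q \<noteq> 0" and b: "(\<lambda>j. b j) summable_on (UNIV :: int set)"
  shows "(\<lambda>n. \<Sum>\<^sub>\<infinity>j. b j * rec_qpoch q (int (n + M) - j) * rec_qpoch q (int n + j)) \<longlonglongrightarrow> (\<Sum>\<^sub>\<infinity>j. b j) / (qinf q q)\<^sup>2"
proof -
  obtain C where C: "\<And>m. norm (rec_qpoch q m) \<le> C" "C \<ge> 1" using rec_qpoch_bound[OF q(1)] by blast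
  have "(\<lambda>n. \<Sum>\<^sub>\<infinity>j. b j * rec_qpoch q (int (n + M) - j) * rec_qpoch q (int n + j)) \<longlonglongrightarrow> (\<Sum>\<^sub>\<infinity>j. b j * (1 / qinf q q) * (1 / qinf q q))"
  proof (rule int_dominated_convergence[where h = "\<lambda>j. norm (b j) * C * C"])
    show "(\<lambda>n. b k * rec_qpoch q (int (n + M) - k) * rec_qpoch q (int n + k)) \<longlonglongrightarrow> b k * (1 / qinf q q) * (1 / qinf q q)" for k
      using rec_qpoch_LIMSEQ[OF q(1), of "int M - k"] rec_qpoch_LIMSEQ[OF q(1), of k]
      by (intro tendsto_mult tendsto_const) (simp_all add: algebra_simps)
    show "norm (b k * rec_qpoch q (int (n + M) - k) * rec_qpoch q (int n + k)) \<le> norm (b k) * C * C" for n k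
      unfolding norm_mult using C by (intro mult_mono) auto
    show "(\<lambda>j. norm (b j) * C * C) summable_on UNIV"
      using b by (intro summable_on_cmult_left) (simp flip: summable_on_iff_abs_summable_on_complex)
  qed
  then show ?thesis unfolding infsum_cmult_left' by (simp add: power2_eq_square)
qed

text \<open>
  The limit of the finite identity with M = N.
\<close>

theorem jacobi_triple:
  assumes q: "norm q < 1" "q \<noteq> 0" and z: "z \<noteq> 0"
  shows "jtheta z q = qinf z q * qinf (q / z) q * qinf q q"
proof -
  have "(\<lambda>n. finite_jtheta q z n n) \<longlonglongrightarrow> jtheta z q / (qinf q q)\<^sup>2"
    using finite_jtheta_limit[OF q entireD[OF theta_coeff_summable[OF q] z], of 0] unfolding finite_jtheta_def jtheta_def laurent_def by simp
  moreover have "(\<lambda>n. finite_jtheta q z n n) \<longlonglongrightarrow> qinf z q * qinf (q / z) q / qinf q q"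
  proof -
    have "filterlim (\<lambda>n::nat. n + n) sequentially sequentially"
      by (rule filterlim_subseq) (auto simp: strict_mono_def)
    then have "(\<lambda>n. qpoch q q (n + n)) \<longlonglongrightarrow> qinf q q" by (rule filterlim_compose[OF qpoch_LIMSEQ[OF q(1)]])
    then show ?thesis unfolding finite_jacobi_triple[OF q z]
      by (intro tendsto_intros qpoch_LIMSEQ q qinf_self_nonzero)
  qed
  ultimately have "jtheta z q / (qinf q q)\<^sup>2 = qinf z q * qinf (q / z) q / qinf q q" by (rule LIMSEQ_unique)
  then show ?thesis using qinf_self_nonzero[OF q(1)] by (simp add: field_simps power2_eq_square)
qed

section \<open>A 1phi1 summation\<close>

text \<open>
  For y \<noteq> 0 this is (-y)^n q^(n(n-1)/2) (c/y;q)_n, the numerator of a 1phi1 series with denominator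
  parameter c; the product form avoids the division by y.  With c = q^(e+1) the same numbers are the
  weights \<delta>_n in Bailey's lemma.
\<close>

definition bailey_delta :: "complex \<Rightarrow> complex \<Rightarrow> complex \<Rightarrow> nat \<Rightarrow> complex" where
  "bailey_delta q c y n = (\<Prod>i<n. c * q ^ (2 * i) - y * q ^ i)"

lemma bailey_delta_simps [simp]: "bailey_delta q c y 0 = 1" "bailey_delta q c y (Suc n) = bailey_delta q c y n * (c * q ^ (2 * n) - y * q ^ n)"
  by (simp_all add: bailey_delta_def)

lemma bailey_delta_scale: "bailey_delta q (c * q ^ (2 * r)) (y * q ^ r) k * bailey_delta q c y r = bailey_delta q c y (r + k)"
  by (induction k) (simp_all add: algebra_simps power_add)

lemma bailey_delta_scale': "bailey_delta q (c * q ^ n) (y * q ^ n) k = q ^ (n * k) * bailey_delta q c y k"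
  by (induction k) (simp_all add: algebra_simps power_add)

lemma bailey_delta_summable:
  assumes q: "norm q < 1" and c: "\<And>n. q ^ n * c' \<noteq> 1"
  shows "(\<lambda>k. bailey_delta q c y k / (qpoch q q k * qpoch c' q k)) summable_on UNIV"
proof (rule summable_on_nat_ratio[where c = 0])
  let ?r = "\<lambda>n. norm ((c * q ^ (2 * n) - y * q ^ n) / ((1 - q ^ n * q) * (1 - q ^ n * c')))"
  show "norm (bailey_delta q c y (Suc k) / (qpoch q q (Suc k) * qpoch c' q (Suc k)))
      \<le> ?r k * norm (bailey_delta q c y k / (qpoch q q k * qpoch c' q k))" for k
    by (simp add: qpoch_Suc norm_mult norm_divide mult_ac)
  have 1: "(\<lambda>n. q ^ n) \<longlonglongrightarrow> 0" using q by (rule LIMSEQ_power_zero)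
  have "(\<lambda>n. (q ^ n)\<^sup>2) \<longlonglongrightarrow> 0\<^sup>2" by (intro tendsto_power 1)
  then have 2: "(\<lambda>n. q ^ (2 * n)) \<longlonglongrightarrow> 0" by (simp add: power_mult[symmetric] mult.commute)
  have "?r \<longlonglongrightarrow> norm ((c * 0 - y * 0) / ((1 - 0 * q) * (1 - 0 * c')))"
    by (intro tendsto_intros 1 2) auto
  then show "?r \<longlonglongrightarrow> 0" by simp
qed simp

lemma power_mult_ne_1_shift: assumes "\<And>n. q ^ n * c \<noteq> (1::complex)" shows "q ^ n * (c * q ^ m) \<noteq> 1"
  using assms[of "m + n"] by (simp add: power_add mult_ac)

text \<open>
  Both sides, expanded with the common factor U k = bailey_delta q c y k / ((q;q)_k (c q;q)_k), differ
  termwise by X k - X (k + 1) where X k = (1 - q^k)(1 - c q^k) U k.  The difference telescopes to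
  X 0 = 0.
\<close>

lemma phi11_step:
  assumes q: "norm q < 1" and c: "\<And>n. q ^ n * c \<noteq> 1"
  defines "S \<equiv> \<lambda>c y. \<Sum>\<^sub>\<infinity>k. bailey_delta q c y k / (qpoch q q k * qpoch c q k)"
  shows "(1 - c) * S c y = (1 - y) * S (c * q) (y * q)"
proof -
  define U where "U k = bailey_delta q c y k / (qpoch q q k * qpoch (q * c) q k)" for k
  have nz: "qpoch (q * c) q k \<noteq> 0" for k
    using power_mult_ne_1_shift[OF c, of _ 1] by (intro qpoch_nonzero) (simp add: mult.commute)
  have nz1: "1 - c \<noteq> 0" "1 - q ^ k * c \<noteq> 0" "1 - q ^ k * (q * c) \<noteq> 0" for k
    using c[of 0] c[of k] c[of "Suc k"] by (auto simp: mult_ac)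
  have nz2: "1 - q ^ k * q \<noteq> 0" for k using power_ne_1[OF q, of "Suc k"] by (simp add: mult.commute)
  have Us: "U summable_on UNIV" unfolding U_def
    using power_mult_ne_1_shift[OF c, of _ 1] by (intro bailey_delta_summable q) (simp add: mult.commute)
  have t1: "(1 - c) * (bailey_delta q c y k / (qpoch q q k * qpoch c q k)) = U k * (1 - c * q ^ k)" for k
  proof -
    have "qpoch c q k * (1 - q ^ k * c) = (1 - c) * qpoch (q * c) q k"
      using qpoch_Suc'[of c q k] qpoch_Suc[of c q k] by simp
    moreover have "qpoch c q k \<noteq> 0" by (rule qpoch_nonzero[OF c])
    moreover have "(1 - c) * (B / (Q * x)) = B / (Q * z) * (1 - c * w)"
      if "x * (1 - w * c) = (1 - c) * z" "x \<noteq> 0" "z \<noteq> 0" for B Q x z w :: complex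
    proof -
      have e: "1 - c = x * (1 - w * c) / z" using that by (simp add: nonzero_eq_divide_eq)
      show ?thesis unfolding e using that by (cases "Q = 0") (simp_all add: divide_simps mult_ac)
    qed
    ultimately show ?thesis using nz[of k] unfolding U_def by blast
  qed
  have t2: "(1 - y) * (bailey_delta q (c * q) (y * q) k / (qpoch q q k * qpoch (c * q) q k)) = U k * (q ^ k * (1 - y))" for k
    using bailey_delta_scale'[of q c 1 y k] by (simp add: U_def mult.commute)
  define X where "X k = (1 - q ^ k) * (1 - c * q ^ k) * U k" for k
  have Ulim: "U \<longlonglongrightarrow> 0" using summable_on_imp_summable[OF Us] by (rule summable_LIMSEQ_zero)
  have qlim: "(\<lambda>n. q ^ n) \<longlonglongrightarrow> 0" using q by (rule LIMSEQ_power_zero)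
  have "X \<longlonglongrightarrow> (1 - 0) * (1 - c * 0) * 0" unfolding X_def by (intro tendsto_intros Ulim qlim)
  then have "(\<lambda>k. X k - X (Suc k)) sums (X 0 - 0)" by (intro telescope_sums') simp
  moreover have "X k - X (Suc k) = U k * (1 - c * q ^ k) - U k * (q ^ k * (1 - y))" for k
  proof -
    have "X (Suc k) = U k * (c * q ^ (2 * k) - y * q ^ k)"
    proof -
      have "U (Suc k) = U k * (c * q ^ (2 * k) - y * q ^ k) / ((1 - q ^ k * q) * (1 - q ^ k * (q * c)))"
        unfolding U_def by (simp add: qpoch_Suc mult_ac)
      moreover have "X (Suc k) = ((1 - q ^ k * q) * (1 - q ^ k * (q * c))) * U (Suc k)"
        unfolding X_def by (simp add: mult_ac)
      ultimately show ?thesis using nz1(3)[of k] nz2[of k] by simp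
    qed
    then show ?thesis unfolding X_def by (simp add: algebra_simps power2_eq_square flip: power_mult mult_2 power_add)
  qed
  moreover have bd: "(\<lambda>k. U k * f k) summable_on UNIV" if "f \<longlonglongrightarrow> l" for f l
  proof -
    have "Bseq f" by (rule convergent_imp_Bseq[OF convergentI[OF that]])
    then obtain B where B: "\<And>k. norm (f k) \<le> B" unfolding Bseq_def by blast
    then show ?thesis by (rule summable_mult_bounded[OF Us])
  qed
  have s1: "(\<lambda>k. U k * (1 - c * q ^ k)) summable_on UNIV" and s2: "(\<lambda>k. U k * (q ^ k * (1 - y))) summable_on UNIV"
    by (rule bd[where l = "1 - c * 0"], intro tendsto_intros qlim) (rule bd[where l = "0 * (1 - y)"], intro tendsto_intros qlim)
  have "((\<lambda>k. U k * (1 - c * q ^ k) - U k * (q ^ k * (1 - y))) sums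
      ((\<Sum>\<^sub>\<infinity>k. U k * (1 - c * q ^ k)) - (\<Sum>\<^sub>\<infinity>k. U k * (q ^ k * (1 - y)))))"
    using s1 s2 by (intro sums_diff has_sum_imp_sums) simp_all
  ultimately have "(\<Sum>\<^sub>\<infinity>k. U k * (1 - c * q ^ k)) - (\<Sum>\<^sub>\<infinity>k. U k * (q ^ k * (1 - y))) = X 0"
    using sums_unique2 by auto
  then show ?thesis unfolding S_def infsum_cmult_right'[symmetric] t1 t2 by (simp add: X_def)
qed

text \<open>
  Iterating phi11_step pushes c and y to 0, where only the term k = 0 of the series survives.
\<close>

theorem phi11:
  assumes q: "norm q < 1" and c: "\<And>n. q ^ n * c \<noteq> 1"
  shows "(\<Sum>\<^sub>\<infinity>k. bailey_delta q c y k / (qpoch q q k * qpoch c q k)) = qinf y q / qinf c q"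
proof -
  define S where "S = (\<lambda>c y. \<Sum>\<^sub>\<infinity>k. bailey_delta q c y k / (qpoch q q k * qpoch c q k))"
  have it: "qpoch c q n * S c y = qpoch y q n * S (c * q ^ n) (y * q ^ n)" for n
  proof (induction n)
    case (Suc n)
    have "(1 - c * q ^ n) * S (c * q ^ n) (y * q ^ n) = (1 - y * q ^ n) * S (c * q ^ n * q) (y * q ^ n * q)"
      unfolding S_def by (rule phi11_step[OF q power_mult_ne_1_shift[OF c]])
    note step = this
    have "qpoch c q (Suc n) * S c y = (qpoch c q n * S c y) * (1 - c * q ^ n)" by (simp add: qpoch_Suc mult_ac)
    also have "\<dots> = qpoch y q n * ((1 - c * q ^ n) * S (c * q ^ n) (y * q ^ n))" unfolding Suc by (simp add: mult_ac)
    also have "\<dots> = qpoch y q (Suc n) * S (c * q ^ Suc n) (y * q ^ Suc n)" unfolding step by (simp add: qpoch_Suc mult_ac)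
    finally show ?case .
  qed simp
  have lim: "(\<lambda>n. S (c * q ^ n) (y * q ^ n)) \<longlonglongrightarrow> 1"
  proof -
    obtain e C where e: "e > 0" "\<And>n. e \<le> norm (qpoch c q n)" and C: "\<And>n. norm (qpoch c q n) \<le> C"
      using qpoch_bounds[OF q c] by blast
    have C0: "C > 0" using e C[of 0] by simp
    define a where "a = (\<lambda>k n. bailey_delta q (c * q ^ n) (y * q ^ n) k / (qpoch q q k * qpoch (c * q ^ n) q k))"
    define M where "M = (\<lambda>k. norm (bailey_delta q c y k / (qpoch q q k * qpoch c q k)) * (C * C / e))"
    have a: "a k n = q ^ (n * k) * (bailey_delta q c y k / (qpoch q q k * qpoch c q k)) * (qpoch c q k * qpoch c q n / qpoch c q (n + k))" for k n
    proof -
      have "qpoch c q (n + k) = qpoch c q n * qpoch (c * q ^ n) q k" by (simp add: qpoch_add mult.commute)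
      moreover have "qpoch c q n \<noteq> 0" "qpoch c q k \<noteq> 0" using qpoch_nonzero[OF c] by blast+
      ultimately show ?thesis unfolding a_def bailey_delta_scale' by simp
    qed
    have bound: "norm (a k n) \<le> M k" for k n
    proof -
      have "norm (qpoch c q k * qpoch c q n / qpoch c q (n + k)) \<le> C * C / e"
        unfolding norm_mult norm_divide using e C C0 by (intro frac_le mult_mono) auto
      moreover have "norm (q ^ (n * k)) \<le> 1" using q by (simp add: norm_power power_le_one)
      ultimately have "norm (a k n) \<le> 1 * norm (bailey_delta q c y k / (qpoch q q k * qpoch c q k)) * (C * C / e)"
        unfolding a norm_mult by (intro mult_mono) (auto simp: norm_mult)
      then show ?thesis by (simp add: M_def)
    qed
    have Ms: "summable M" unfolding M_def
      using bailey_delta_summable[OF q c, of c y] unfolding summable_on_iff_abs_summable_on_complex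
      by (intro summable_mult2 summable_on_imp_summable)
    have qn: "(\<lambda>n. q ^ n) \<longlonglongrightarrow> 0" using q by (rule LIMSEQ_power_zero)
    have l: "(\<lambda>n. a k n) \<longlonglongrightarrow> (if k = 0 then 1 else 0)" for k
    proof (cases "k = 0")
      case False
      have "(\<lambda>n. (q ^ n) ^ k) \<longlonglongrightarrow> 0 ^ k" by (intro tendsto_intros qn)
      then have 1: "(\<lambda>n. q ^ (n * k)) \<longlonglongrightarrow> 0" using False by (simp add: power_mult zero_power)
      have qc: "qinf c q \<noteq> 0" by (rule qinf_nonzero[OF q c])
      have "(\<lambda>n. a k n) \<longlonglongrightarrow> 0 * (bailey_delta q c y k / (qpoch q q k * qpoch c q k)) * (qpoch c q k * qinf c q / qinf c q)"
        unfolding a by (intro tendsto_mult tendsto_divide tendsto_const 1 qpoch_LIMSEQ[OF q] LIMSEQ_ignore_initial_segment[OF qpoch_LIMSEQ[OF q]] qc)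
      then show ?thesis using False by simp
    qed (simp add: a_def)
    have "(\<lambda>n. \<Sum>k. a k n) \<longlonglongrightarrow> (\<Sum>k. if k = 0 then 1 else 0)"
      using tannerys_theorem[of a "\<lambda>k. if k = 0 then 1 else 0" sequentially M] l bound Ms
      by (simp add: case_prod_unfold)
    moreover have "(\<Sum>k. a k n) = S (c * q ^ n) (y * q ^ n)" for n
    proof -
      have "(\<lambda>k. a k n) summable_on UNIV" unfolding a_def by (rule bailey_delta_summable[OF q power_mult_ne_1_shift[OF c]])
      then have "(\<lambda>k. a k n) sums (\<Sum>\<^sub>\<infinity>k. a k n)" by (intro has_sum_imp_sums) simp
      then show ?thesis unfolding S_def a_def by (simp add: sums_iff)
    qed
    moreover have "(\<Sum>k. if k = 0 then 1 else (0::complex)) = 1" using suminf_finite[of "{0}" "\<lambda>k. if k = 0 then 1 else (0::complex)"] by simp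
    ultimately show ?thesis by simp
  qed
  have "(\<lambda>n. qpoch c q n * S c y) \<longlonglongrightarrow> qinf c q * S c y" by (intro tendsto_intros qpoch_LIMSEQ q)
  moreover have "(\<lambda>n. qpoch c q n * S c y) \<longlonglongrightarrow> qinf y q * 1"
    unfolding it by (intro tendsto_intros qpoch_LIMSEQ q lim)
  ultimately have "qinf c q * S c y = qinf y q * 1" by (rule LIMSEQ_unique)
  then have "S c y = qinf y q / qinf c q" using qinf_nonzero[OF q c] by (simp add: field_simps)
  then show ?thesis unfolding S_def .
qed

lemma summable_bailey_delta: assumes q: "norm q < 1" shows "bailey_delta q c y summable_on UNIV"
proof (rule summable_on_nat_ratio[where c = 0])
  let ?r = "\<lambda>n. norm (c * q ^ (2 * n) - y * q ^ n)"
  have 1: "(\<lambda>n. q ^ n) \<longlonglongrightarrow> 0" using q by (rule LIMSEQ_power_zero)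
  have "(\<lambda>n. (q ^ n)\<^sup>2) \<longlonglongrightarrow> 0\<^sup>2" by (intro tendsto_power 1)
  then have 2: "(\<lambda>n. q ^ (2 * n)) \<longlonglongrightarrow> 0" by (simp add: power_mult[symmetric] mult.commute)
  have "?r \<longlonglongrightarrow> norm (c * 0 - y * 0)" by (intro tendsto_intros 1 2)
  then show "?r \<longlonglongrightarrow> 0" by simp
qed (simp_all add: norm_mult)

section \<open>Bailey's lemma\<close>

text \<open>
  The sequence \<gamma>_r of the conjugate Bailey pair that belongs to the weights bailey_delta.  Pairs
  relative to 1 have e = 0 and pairs relative to q have e = 1.
\<close>

definition bailey_gamma :: "complex \<Rightarrow> nat \<Rightarrow> complex \<Rightarrow> nat \<Rightarrow> complex" where
  "bailey_gamma q e y r = bailey_delta q (q ^ (e + 1)) y r * qinf (y * q ^ r) q / qinf q q"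

text \<open>
  The weight 1 / (q;q)_(n-r) starts the sum at n = r.  After the substitution n = r + k it is a 1phi1
  series with parameters c q^(2r) and y q^r, where c = q^(e+1).
\<close>

lemma conjugate_bailey:
  assumes q: "norm q < 1" 
  shows "(\<Sum>\<^sub>\<infinity>n. bailey_delta q (q ^ (e + 1)) y n * (rec_qpoch q (int n - int r) * rec_qpoch q (int n + int r + int e))) = bailey_gamma q e y r"
proof -
  define c where "c = q ^ (e + 1) * q ^ (2 * r)"
  have aux: "B3 * (1 / a * (1 / (b * d))) = B2 / b * (B1 / (a * d))" if "B1 * B2 = B3" for B1 B2 B3 a b d :: complex
    unfolding that[symmetric] by (simp add: mult_ac)
  let ?f = "\<lambda>n. bailey_delta q (q ^ (e + 1)) y n * (rec_qpoch q (int n - int r) * rec_qpoch q (int n + int r + int e))"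
  have c: "q ^ n * c \<noteq> 1" for n
    using power_ne_1[OF q, of "n + (e + 1) + 2 * r"] by (simp add: c_def power_add mult_ac)
  have "infsum ?f UNIV = infsum ?f {r..}"
    by (rule infsum_cong_neutral) auto
  also have "\<dots> = (\<Sum>\<^sub>\<infinity>k. ?f (r + k))"
    by (rule infsum_reindex_bij_witness[of _ "\<lambda>k. r + k" "\<lambda>n. n - r"]) auto
  also have "\<dots> = (\<Sum>\<^sub>\<infinity>k. bailey_delta q (q ^ (e + 1)) y r / qpoch q q (2 * r + e) * (bailey_delta q c (y * q ^ r) k / (qpoch q q k * qpoch c q k)))"
  proof (rule infsum_cong)
    fix k
    have "nat (int (r + k) + int r + int e) = (2 * r + e) + k" by simp
    moreover have "q ^ (2 * r + e) * q = c" by (simp add: c_def power_add mult_ac)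
    ultimately have "rec_qpoch q (int (r + k) + int r + int e) = 1 / (qpoch q q (2 * r + e) * qpoch c q k)"
      using qpoch_add[of q q "2 * r + e" k] by (simp only: rec_qpoch_def) simp
    moreover have "rec_qpoch q (int (r + k) - int r) = 1 / qpoch q q k" by (simp add: rec_qpoch_def)
    moreover have "bailey_delta q c (y * q ^ r) k * bailey_delta q (q ^ (e + 1)) y r = bailey_delta q (q ^ (e + 1)) y (r + k)"
      unfolding c_def by (rule bailey_delta_scale)
    ultimately show "?f (r + k) = bailey_delta q (q ^ (e + 1)) y r / qpoch q q (2 * r + e) * (bailey_delta q c (y * q ^ r) k / (qpoch q q k * qpoch c q k))"
      by (metis aux)
  qed
  also have "\<dots> = bailey_delta q (q ^ (e + 1)) y r / qpoch q q (2 * r + e) * (qinf (y * q ^ r) q / qinf c q)"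
    unfolding infsum_cmult_right' phi11[OF q c] ..
  also have "\<dots> = bailey_gamma q e y r"
  proof -
    have "qpoch q q (2 * r + e) * qinf c q = qinf q q"
    proof (rule LIMSEQ_unique)
      show "(\<lambda>n. qpoch q q (2 * r + e) * qpoch c q n) \<longlonglongrightarrow> qpoch q q (2 * r + e) * qinf c q"
        by (intro tendsto_intros qpoch_LIMSEQ q)
      have "q ^ (2 * r + e) * q = c" by (simp add: c_def power_add mult_ac)
      then have "(\<lambda>n. qpoch q q (2 * r + e) * qpoch c q n) = (\<lambda>n. qpoch q q (n + (2 * r + e)))"
        using qpoch_add[of q q "2 * r + e"] by (simp add: add.commute)
      then show "(\<lambda>n. qpoch q q (2 * r + e) * qpoch c q n) \<longlonglongrightarrow> qinf q q"
        using LIMSEQ_ignore_initial_segment[OF qpoch_LIMSEQ[OF q]] by simp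
    qed
    then show ?thesis unfolding bailey_gamma_def by (simp add: field_simps)
  qed
  finally show ?thesis .
qed

text \<open>
  The product of the two weights in a Bailey pair is invariant under r \<mapsto> - r - e, which extends \<gamma>_r to
  negative r.  Allowing r to run over all integers keeps \<alpha>_r a single fraction for mu and A.
\<close>

definition bailey_gamma_int :: "complex \<Rightarrow> nat \<Rightarrow> complex \<Rightarrow> int \<Rightarrow> complex" where
  "bailey_gamma_int q e y r = bailey_gamma q e y (nat (if r \<ge> 0 then r else - r - int e))"

lemma conjugate_bailey_int:
  assumes q: "norm q < 1" and e: "e \<le> 1"
  shows "(\<Sum>\<^sub>\<infinity>n. bailey_delta q (q ^ (e + 1)) y n * (rec_qpoch q (int n - r) * rec_qpoch q (int n + r + int e))) = bailey_gamma_int q e y r"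
proof (cases "r \<ge> 0")
  case True then show ?thesis using conjugate_bailey[OF q, of e y "nat r"] by (simp add: bailey_gamma_int_def)
next
  case False
  have *: "int n + int (nat (- r - int e)) + int e = int n - r" "int n - int (nat (- r - int e)) = int n + r + int e" for n
    using False e by auto
  show ?thesis using conjugate_bailey[OF q, of e y "nat (- r - int e)"] False
    unfolding bailey_gamma_int_def * by (simp only: mult.commute[of "rec_qpoch q (int _ - r)"] if_False)
qed

text \<open>
  Insert the expression for \<beta>_n, exchange the summations, and evaluate the sum over n.
\<close>

theorem bailey_sum:
  assumes q: "norm q < 1" and e: "e \<le> 1" and \<alpha>: "\<alpha> summable_on UNIV"
    and \<beta>: "\<And>n. \<beta> n = (\<Sum>\<^sub>\<infinity>r. \<alpha> r * (rec_qpoch q (int n - r) * rec_qpoch q (int n + r + int e)))"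
  shows "(\<lambda>n. bailey_delta q (q ^ (e + 1)) y n * \<beta> n) sums (\<Sum>\<^sub>\<infinity>r. \<alpha> r * bailey_gamma_int q e y r)"
proof -
  obtain C where C: "\<And>m. norm (rec_qpoch q m) \<le> C" "C \<ge> 1" using rec_qpoch_bound[OF q] by blast
  let ?d = "bailey_delta q (q ^ (e + 1)) y"
  let ?F = "\<lambda>n r. ?d n * (\<alpha> r * (rec_qpoch q (int n - r) * rec_qpoch q (int n + r + int e)))"
  have d: "?d summable_on UNIV" by (rule summable_bailey_delta[OF q])
  have "(\<lambda>x. norm (case x of (n, r) \<Rightarrow> ?F n r)) summable_on UNIV \<times> UNIV"
  proof (rule Infinite_Sum.abs_summable_on_comparison_test'[where g = "\<lambda>x. norm (?d (fst x)) * norm (\<alpha> (snd x)) * (C * C)"])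
    have "(\<lambda>x. norm (?d (fst x)) * norm (\<alpha> (snd x))) summable_on UNIV \<times> UNIV"
      using summable_on_norm_product[OF d \<alpha>] by (simp add: case_prod_unfold)
    then show "(\<lambda>x. norm (?d (fst x)) * norm (\<alpha> (snd x)) * (C * C)) summable_on UNIV \<times> UNIV"
      by (rule summable_on_cmult_left)
    show "norm (case x of (n, r) \<Rightarrow> ?F n r) \<le> norm (?d (fst x)) * norm (\<alpha> (snd x)) * (C * C)" for x
    proof -
      have "norm (\<alpha> r) * (norm (rec_qpoch q i) * norm (rec_qpoch q k)) \<le> norm (\<alpha> r) * (C * C)" for r i k
        using C by (intro mult_left_mono mult_mono) auto
      then show ?thesis by (simp add: case_prod_unfold norm_mult mult.assoc mult_left_mono)
    qed
  qed
  then have P: "(\<lambda>(n, r). ?F n r) summable_on UNIV \<times> UNIV" by (rule abs_summable_summable)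
  have "((\<lambda>n. ?d n * \<beta> n) has_sum infsum (\<lambda>(n, r). ?F n r) (UNIV \<times> UNIV)) UNIV"
  proof (rule has_sum_SigmaD[where f = "\<lambda>(n, r). ?F n r" and A = UNIV and B = "\<lambda>_. UNIV"])
    show "((\<lambda>(n, r). ?F n r) has_sum (\<Sum>\<^sub>\<infinity>(n, r)\<in>UNIV \<times> UNIV. ?F n r)) (UNIV \<times> UNIV)" using P by simp
    fix n
    have "?F n summable_on UNIV" using summable_on_SigmaD1[OF P, of n] by simp
    then show "((\<lambda>r. case (n, r) of (n, r) \<Rightarrow> ?F n r) has_sum ?d n * \<beta> n) UNIV"
      unfolding \<beta> infsum_cmult_right'[symmetric] by simp
  qed
  then have 1: "(\<lambda>n. ?d n * \<beta> n) sums (\<Sum>\<^sub>\<infinity>(n, r)\<in>UNIV \<times> UNIV. ?F n r)" by (rule has_sum_imp_sums)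
  have "(\<Sum>\<^sub>\<infinity>(n, r)\<in>UNIV \<times> UNIV. ?F n r) = (\<Sum>\<^sub>\<infinity>n. \<Sum>\<^sub>\<infinity>r. ?F n r)"
    using infsum_Sigma'_banach[OF P] by simp
  also have "\<dots> = (\<Sum>\<^sub>\<infinity>r. \<Sum>\<^sub>\<infinity>n. ?F n r)" by (rule infsum_swap_banach[OF P])
  also have "\<dots> = (\<Sum>\<^sub>\<infinity>r. \<alpha> r * bailey_gamma_int q e y r)"
    unfolding conjugate_bailey_int[OF q e, symmetric] infsum_cmult_right'[symmetric]
    by (intro infsum_cong) (simp add: mult_ac)
  finally show ?thesis using 1 by simp
qed

section \<open>Bounds for Lambert series\<close>

text \<open>
  Powers q^k with k \<noteq> 0 keep the distance 1 - |q| from the unit circle, so the denominators of Lambert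
  series are uniformly bounded away from 0.
\<close>

lemma norm_one_minus_powi_ge:
  assumes q: "norm q < 1" "q \<noteq> 0" and \<epsilon>: "norm \<epsilon> = 1" and k: "k \<noteq> 0"
  shows "1 - norm q \<le> norm (1 - \<epsilon> * (q::complex) powi k)"
proof -
  have "\<bar>1 - norm q powi k\<bar> \<le> norm (1 - \<epsilon> * q powi k)"
    using norm_triangle_ineq3[of 1 "\<epsilon> * q powi k"] \<epsilon> by (simp add: norm_mult norm_power_int)
  moreover have "1 - norm q \<le> \<bar>1 - norm q powi k\<bar>"
  proof (cases "k > 0")
    case True
    have "norm q powi k \<le> norm q powi 1" using q True by (intro power_int_decreasing) auto
    then show ?thesis by simp
  next
    case False
    have "norm q powi (-1) \<le> norm q powi k" using q False k by (intro power_int_decreasing) auto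
    then have "1 / norm q \<le> norm q powi k" by (simp add: power_int_minus inverse_eq_divide)
    moreover have "1 / norm q - 1 = (1 - norm q) / norm q" using q by (simp add: field_simps)
    moreover have "(1 - norm q) / norm q \<ge> 1 - norm q" using q by (simp add: pos_le_divide_eq mult_left_le)
    ultimately show ?thesis by linarith
  qed
  ultimately show ?thesis by linarith
qed

lemma norm_recip_bound:
  assumes q: "norm q < 1" "q \<noteq> 0" and \<epsilon>: "norm \<epsilon> = 1" and k: "k \<noteq> 0"
  shows "norm (1 / (1 - \<epsilon> * (q::complex) powi k)) \<le> 1 / (1 - norm q)"
  using norm_one_minus_powi_ge[OF assms] q by (auto simp: norm_divide intro!: divide_left_mono mult_pos_pos)

lemma powi_ne:
  assumes q: "norm q < 1" "q \<noteq> 0" and \<epsilon>: "norm \<epsilon> = 1" and k: "k \<noteq> 0"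
  shows "1 - \<epsilon> * (q::complex) powi k \<noteq> 0"
  using norm_one_minus_powi_ge[OF assms] q by auto

lemma qinf_add: assumes "norm q < 1" shows "qinf x q = qpoch x q n * qinf (x * q ^ n) q"
proof (rule LIMSEQ_unique)
  show "(\<lambda>m. qpoch x q (m + n)) \<longlonglongrightarrow> qinf x q" by (rule LIMSEQ_ignore_initial_segment[OF qpoch_LIMSEQ[OF assms]])
  show "(\<lambda>m. qpoch x q (m + n)) \<longlonglongrightarrow> qpoch x q n * qinf (x * q ^ n) q"
    unfolding add.commute[of _ n] qpoch_add mult.commute[of "q ^ n"] by (intro tendsto_intros qpoch_LIMSEQ assms)
qed

text \<open>
  The theta function vanishes at 1 and at q, and so do its truncations.  These zeros are what closes
  the inductions for the Bailey pairs.
\<close>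

lemma finite_jtheta_at_1: assumes "norm q < 1" "q \<noteq> 0" "M > 0" shows "finite_jtheta q 1 M N = 0"
  using finite_jacobi_triple[OF assms(1,2), of 1 M N] assms(3) by (auto simp: qpoch_eq_0_iff)

lemma finite_jtheta_at_q: assumes "norm q < 1" "q \<noteq> 0" "N > 0" shows "finite_jtheta q q M N = 0"
  using finite_jtheta_swap[of q q M N] finite_jtheta_at_1[OF assms(1,2,3), of M] assms(2) by simp

section \<open>The Lambert series of mu\<close>

lemma recip_square_mult:
  fixes S X Y :: complex
  assumes "Y\<^sup>2 * S = 1 / X\<^sup>2" "Y \<noteq> 0" shows "S = 1 / (X * Y)\<^sup>2"
proof -
  have "S = (Y\<^sup>2 * S) / Y\<^sup>2" using assms(2) by simp
  then show ?thesis unfolding assms(1) by (simp add: power_mult_distrib)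
qed

lemma pair_factor: "a * (x * (A * B)) - x * ((u * A) * (v * B)) = x * (A * B) * (a - u * v)" for a :: complex
  by (simp add: algebra_simps)

text \<open>
  Induction on n.  Put m = n + 1, T = p^m and R = p^r.  Multiply the claim for m by (1 + T)^2 and
  subtract the claim for n: since (1 + T)^2 - (1 - T/R)(1 - T R) = (T/R)(1 + R)^2, the denominator 1 + R
  cancels and two vanishing truncated theta series remain.
\<close>

lemma mu2_pair:
  assumes p: "norm p < 1" "p \<noteq> 0"
  shows "1 / (qpoch (- p) p n)\<^sup>2 = (\<Sum>\<^sub>\<infinity>r. (2 * msgn r * p powi tri (r + 1) / (1 + p powi r)) * (rec_qpoch p (int n - r) * rec_qpoch p (int n + r + int 0)))"
proof (induction n)
  case 0
  have "(\<Sum>\<^sub>\<infinity>r. (2 * msgn r * p powi tri (r + 1) / (1 + p powi r)) * (rec_qpoch p (int 0 - r) * rec_qpoch p (int 0 + r + int 0)))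
    = (\<Sum>\<^sub>\<infinity>r\<in>{0}. (2 * msgn r * p powi tri (r + 1) / (1 + p powi r)) * (rec_qpoch p (int 0 - r) * rec_qpoch p (int 0 + r + int 0)))"
    by (rule infsum_cong_neutral) (auto simp: linorder_neq_iff)
  then show ?case by simp
next
  case (Suc n)
  define \<alpha> where "\<alpha> = (\<lambda>r. 2 * msgn r * p powi tri (r + 1) / (1 + p powi r))"
  define U where "U = (\<lambda>m r. rec_qpoch p (int m - r) * rec_qpoch p (int m + r))"
  define m where "m = Suc n"
  have nz: "1 + p powi r \<noteq> 0" for r
    using powi_ne[OF p, of "-1" r] by (cases "r = 0") auto
  have nz': "1 + p ^ m \<noteq> 0" using nz[of "int m"] by simp
  have s: "(\<lambda>r. f r * U k r) summable_on UNIV" for f k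
    by (rule summable_on_finite_support[of "- int k" "int k"]) (auto simp: U_def)
  have key: "(1 + p ^ m)\<^sup>2 * (\<alpha> r * U m r) - \<alpha> r * U n r
      = 2 * p ^ m * (msgn r * p powi tri r * U m r + msgn r * p powi (tri r + r) * U m r)" for r
  proof -
    have a: "rec_qpoch p (int n - r) = (1 - p powi (int m - r)) * rec_qpoch p (int m - r)"
      "rec_qpoch p (int n + r) = (1 - p powi (int m + r)) * rec_qpoch p (int m + r)"
      using rec_qpoch_diff_1[OF p(1), of "int m - r"] rec_qpoch_diff_1[OF p(1), of "int m + r"] unfolding m_def by (simp_all add: algebra_simps)
    have b: "p powi (int m - r) = p ^ m / p powi r" "p powi (int m + r) = p ^ m * p powi r"
      using p by (simp_all add: power_int_diff power_int_add)
    have c: "p powi tri (r + 1) = p powi tri r * p powi r" "p powi (tri r + r) = p powi tri r * p powi r"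
      using p by (simp_all add: tri_Suc power_int_add)
    have r0: "p powi r \<noteq> 0" using p by simp
    have "(1 + T)\<^sup>2 * (2 * S * (P * R) / (1 + R) * (A * B)) - 2 * S * (P * R) / (1 + R) * ((1 - T / R) * A * ((1 - T * R) * B))
      = 2 * T * (S * P * (A * B) + S * (P * R) * (A * B))" if "R \<noteq> 0" "1 + R \<noteq> 0" for T S P R A B :: complex
    proof -
      have "(1 + T)\<^sup>2 - (1 - T / R) * (1 - T * R) = T / R * (1 + R)\<^sup>2" using that(1) by (simp add: field_simps power2_eq_square)
      then have "2 * S * (P * R) / (1 + R) * (A * B) * ((1 + T)\<^sup>2 - (1 - T / R) * (1 - T * R)) = 2 * T * S * P * (1 + R) * A * B"
        using that by (simp add: power2_eq_square)
      then show ?thesis unfolding pair_factor by (simp add: algebra_simps)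
    qed
    then show ?thesis using r0 nz[of r] unfolding U_def \<alpha>_def a b c by blast
  qed
  have "(1 + p ^ m)\<^sup>2 * (\<Sum>\<^sub>\<infinity>r. \<alpha> r * U m r) - (\<Sum>\<^sub>\<infinity>r. \<alpha> r * U n r) = (\<Sum>\<^sub>\<infinity>r. (1 + p ^ m)\<^sup>2 * (\<alpha> r * U m r) + - (\<alpha> r * U n r))"
    using s by (subst infsum_add) (auto intro: summable_on_cmult_right simp: infsum_cmult_right' summable_on_uminus infsum_uminus)
  also have "\<dots> = (\<Sum>\<^sub>\<infinity>r. 2 * p ^ m * (msgn r * p powi tri r * U m r + msgn r * p powi (tri r + r) * U m r))"
    using key by (intro infsum_cong) simp
  also have "\<dots> = 2 * p ^ m * ((\<Sum>\<^sub>\<infinity>r. msgn r * p powi tri r * U m r) + (\<Sum>\<^sub>\<infinity>r. msgn r * p powi (tri r + r) * U m r))"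
    using s by (simp only: infsum_cmult_right' infsum_add)
  also have "(\<Sum>\<^sub>\<infinity>r. msgn r * p powi tri r * U m r) = finite_jtheta p 1 m m"
    unfolding finite_jtheta_def U_def theta_coeff_def by (intro infsum_cong) simp
  also have "(\<Sum>\<^sub>\<infinity>r. msgn r * p powi (tri r + r) * U m r) = finite_jtheta p p m m"
    unfolding finite_jtheta_def U_def theta_coeff_def using p by (intro infsum_cong) (simp add: power_int_add)
  also have "finite_jtheta p 1 m m = 0" by (rule finite_jtheta_at_1[OF p]) (simp add: m_def)
  also have "finite_jtheta p p m m = 0" by (rule finite_jtheta_at_q[OF p]) (simp add: m_def)
  finally have "(1 + p ^ m)\<^sup>2 * (\<Sum>\<^sub>\<infinity>r. \<alpha> r * U m r) = 1 / (qpoch (- p) p n)\<^sup>2"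
    using Suc unfolding \<alpha>_def U_def by simp
  moreover have "qpoch (- p) p (Suc n) = qpoch (- p) p n * (1 + p ^ m)" by (simp add: qpoch_Suc m_def)
  ultimately have "(\<Sum>\<^sub>\<infinity>r. \<alpha> r * U m r) = 1 / (qpoch (- p) p (Suc n))\<^sup>2" using nz' recip_square_mult by simp
  then show ?case unfolding \<alpha>_def U_def m_def by simp
qed

text \<open>
  Bailey's lemma in base q^2 with e = 0 and y = q.  The products (q;q^2)_r and (q^(1+2r);q^2) in \<gamma>_r
  combine to (q;q^2), so \<gamma>_r is a monomial up to a factor that does not depend on r.
\<close>

theorem mu2_lambert:
  assumes q: "norm q < 1" "q \<noteq> 0"
  shows "mu2 q = qinf q (q\<^sup>2) / qinf (q\<^sup>2) (q\<^sup>2) * (\<Sum>\<^sub>\<infinity>r. 2 * q powi (2 * r * r + r) / (1 + q powi (2 * r)))"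
proof -
  define p where "p = q\<^sup>2"
  have p: "norm p < 1" "p \<noteq> 0" using q norm_lt_1_power[OF q(1), of 2] by (auto simp: p_def)
  define \<alpha> where "\<alpha> = (\<lambda>r. 2 * msgn r * p powi tri (r + 1) / (1 + p powi r))"
  \<comment> \<open>The weights are the numerators in the series of mu.\<close>
  have d: "bailey_delta p (p ^ (0 + 1)) q n = (-1) ^ n * q ^ n\<^sup>2 * qpoch q p n" for n
  proof (induction n)
    case (Suc n)
    have e: "(Suc n)\<^sup>2 = n\<^sup>2 + (2 * n + 1)" by (simp add: power2_eq_square)
    have P: "p ^ (2 * n) = p ^ n * p ^ n" "q ^ (2 * n + 1) = p ^ n * q" "p ^ (0 + 1) = q * q"
      by (simp add: mult_2 power_add) (simp add: p_def power_add power_mult, simp add: p_def power2_eq_square)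
    have "p ^ (0 + 1) * p ^ (2 * n) - q * p ^ n = - (q ^ (2 * n + 1) * (1 - p ^ n * q))"
      unfolding P by (simp add: algebra_simps)
    then show ?case using Suc unfolding e bailey_delta_simps qpoch_Suc power_add[of q "n\<^sup>2"] by simp
  qed simp
  have "(\<lambda>r. theta_coeff p (r + 1)) summable_on UNIV"
    using entireD[OF theta_coeff_summable[OF p], of 1] summable_on_int_shift[of "theta_coeff p" 1] by simp
  then have "(\<lambda>r. theta_coeff p (r + 1) * (- 2 / (1 + p powi r))) summable_on UNIV"
  proof (rule summable_mult_bounded[where B = "2 * (1 / (1 - norm p)) + 1"])
    fix r
    have "norm (1 / (1 - (-1) * p powi r)) \<le> 1 / (1 - norm p)" if "r \<noteq> 0" by (rule norm_recip_bound[OF p]) (auto simp: that)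
    then show "norm (- 2 / (1 + p powi r)) \<le> 2 * (1 / (1 - norm p)) + 1" using p
      by (cases "r = 0") (auto simp: norm_divide)
  qed
  also have "(\<lambda>r. theta_coeff p (r + 1) * (- 2 / (1 + p powi r))) = \<alpha>" by (auto simp: \<alpha>_def theta_coeff_def fun_eq_iff)
  finally have \<alpha>: "\<alpha> summable_on UNIV" .
  have "(\<lambda>n. bailey_delta p (p ^ (0 + 1)) q n * (1 / (qpoch (- p) p n)\<^sup>2)) sums (\<Sum>\<^sub>\<infinity>r. \<alpha> r * bailey_gamma_int p 0 q r)"
    unfolding mu2_pair[OF p] by (rule bailey_sum[OF p(1) _ \<alpha>]) (simp_all add: \<alpha>_def)
  from this[unfolded d] have "mu2 q = (\<Sum>\<^sub>\<infinity>r. \<alpha> r * bailey_gamma_int p 0 q r)" unfolding mu2_def p_def by (simp add: sums_iff)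
  also have "\<dots> = (\<Sum>\<^sub>\<infinity>r. qinf q p / qinf p p * (2 * q powi (2 * r * r + r) / (1 + q powi (2 * r))))"
  proof (rule infsum_cong)
    fix r
    define n where "n = nat (if r \<ge> 0 then r else - r - int 0)"
    have n: "int n = \<bar>r\<bar>" by (simp add: n_def)
    have "(-1) ^ n = msgn (int n)" by (simp add: msgn_def uminus_power_if)
    also have "\<dots> = msgn r" unfolding n by (simp add: msgn_def)
    finally have sg: "(-1) ^ n = msgn r" .
    have "q ^ n\<^sup>2 = q powi (int n * int n)" by (simp add: power2_eq_square flip: power_int_of_nat)
    also have "int n * int n = r * r" unfolding n by simp
    finally have "bailey_gamma_int p 0 q r = msgn r * q powi (r * r) * (qpoch q p n * qinf (q * p ^ n) p) / qinf p p"
      unfolding bailey_gamma_int_def bailey_gamma_def n_def[symmetric] d by (simp add: sg)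
    also have "qpoch q p n * qinf (q * p ^ n) p = qinf q p" by (rule qinf_add[OF p(1), symmetric])
    finally have b: "bailey_gamma_int p 0 q r = msgn r * q powi (r * r) * qinf q p / qinf p p" .
    have "p powi tri (r + 1) = q powi (r * r + r)"
      using tri_double[of "r + 1"] by (simp add: p_def power_int_power algebra_simps)
    moreover have "p powi r = q powi (2 * r)" by (simp add: p_def power_int_power)
    moreover have "q powi (2 * r * r + r) = q powi (r * r + r) * q powi (r * r)"
      using q by (simp add: algebra_simps flip: power_int_add)
    moreover have "msgn r * (msgn r * x) = x" for x by (simp flip: mult.assoc)
    ultimately show "\<alpha> r * bailey_gamma_int p 0 q r = qinf q p / qinf p p * (2 * q powi (2 * r * r + r) / (1 + q powi (2 * r)))"
      unfolding b \<alpha>_def by (simp add: mult_ac)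
  qed
  finally show ?thesis unfolding infsum_cmult_right' p_def .
qed

section \<open>The Lambert series of A\<close>

text \<open>
  The same induction as for mu, with the identity (1 - x)^2 - (1 - x/R)(1 - x R) = (x/R)(1 - R)^2 for
  x = q^(2m+1) and R = q^(2r+1).  One of the two remaining sums is a vanishing truncated theta series, the
  other one is antisymmetric under r \<mapsto> - 1 - r.
\<close>

lemma A2_pair:
  assumes q: "norm q < 1" "q \<noteq> 0"
  defines "p \<equiv> q\<^sup>2"
  shows "1 / (qpoch q p (n + 1))\<^sup>2 = (\<Sum>\<^sub>\<infinity>r. (msgn r * q powi (r * r + r) / (1 - q powi (2 * r + 1))) * (rec_qpoch p (int n - r) * rec_qpoch p (int n + r + int 1)))"
proof (induction n)
  case 0
  have p: "norm p < 1" "p \<noteq> 0" using q norm_lt_1_power[OF q(1), of 2] by (auto simp: p_def)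
  let ?f = "\<lambda>r. (msgn r * q powi (r * r + r) / (1 - q powi (2 * r + 1))) * (rec_qpoch p (int 0 - r) * rec_qpoch p (int 0 + r + int 1))"
  have "infsum ?f UNIV = infsum ?f {-1, 0}"
    by (rule infsum_cong_neutral) (auto simp: linorder_neq_iff)
  also have "\<dots> = ?f (-1) + ?f 0" by simp
  also have "\<dots> = 1 / (qpoch q p (0 + 1))\<^sup>2"
  proof -
    have "q \<noteq> 1" "q\<^sup>2 \<noteq> 1" using power_ne_1[OF q(1), of 1] power_ne_1[OF q(1), of 2] by auto
    moreover have "1 + q \<noteq> 0" using \<open>q\<^sup>2 \<noteq> 1\<close> by (metis add_eq_0_iff power2_minus one_power2)
    ultimately have "1 - q \<noteq> 0" "1 + q \<noteq> 0" "1 - q * q = (1 - q) * (1 + q)" "q - 1 = - (1 - q)"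
      by (auto simp: power2_eq_square algebra_simps square_eq_1_iff)
    then have "- (1 / (1 - 1 / q)) * (1 / (1 - q * q)) + 1 / (1 - q) * (1 / (1 - q * q)) = 1 / (1 - q)\<^sup>2"
      using q(2) by (simp add: divide_simps power2_eq_square) (simp add: algebra_simps)
    then show ?thesis by (simp add: qpoch_Suc rec_qpoch_def p_def msgn_def power_int_minus inverse_eq_divide power2_eq_square)
  qed
  finally show ?case by simp
next
  case (Suc n)
  have p: "norm p < 1" "p \<noteq> 0" using q norm_lt_1_power[OF q(1), of 2] by (auto simp: p_def)
  define \<alpha> where "\<alpha> = (\<lambda>r. msgn r * q powi (r * r + r) / (1 - q powi (2 * r + 1)))"
  define U where "U = (\<lambda>m r. rec_qpoch p (int m - r) * rec_qpoch p (int m + r + 1))"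
  define m where "m = Suc n"
  define x where "x = q ^ (2 * m + 1)"
  have nz: "1 - q powi (2 * r + 1) \<noteq> 0" for r using powi_ne[OF q, of 1 "2 * r + 1"] by auto presburger
  have nz': "1 - x \<noteq> 0" using power_ne_1[OF q(1), of "2 * m + 1"] by (simp add: x_def)
  have s: "(\<lambda>r. f r * U k r) summable_on UNIV" for f k
    by (rule summable_on_finite_support[of "- int k - 1" "int k"]) (auto simp: U_def)
  have key: "(1 - x)\<^sup>2 * (\<alpha> r * U m r) - \<alpha> r * U n r
      = x / q * (theta_coeff p r * U m r) + - x * (msgn r * q powi (r * r + r) * U m r)" for r
  proof -
    have a: "rec_qpoch p (int n - r) = (1 - p powi (int m - r)) * rec_qpoch p (int m - r)"
      "rec_qpoch p (int n + r + 1) = (1 - p powi (int m + r + 1)) * rec_qpoch p (int m + r + 1)"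
      using rec_qpoch_diff_1[OF p(1), of "int m - r"] rec_qpoch_diff_1[OF p(1), of "int m + r + 1"] unfolding m_def by (simp_all add: algebra_simps)
    define R where "R = q powi (2 * r + 1)"
    have R: "R \<noteq> 0" "1 - R \<noteq> 0" using nz[of r] q by (auto simp: R_def)
    have "x = q powi int (2 * m + 1)" unfolding x_def by (simp only: power_int_of_nat)
    also have "int (2 * m + 1) = 2 * int m + 1" by simp
    finally have x: "x = q powi (2 * int m + 1)" .
    have b: "p powi (int m - r) = x / R" "p powi (int m + r + 1) = x * R"
      unfolding x R_def p_def using q by (simp_all add: power_int_power algebra_simps flip: power_int_add power_int_diff)
    have e: "q powi (r * r + r) = theta_coeff p r * msgn r * R / q"
    proof -
      have "q powi (r * r + r) * q = q powi (r * r + r + 1)" using q by (simp add: power_int_add)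
      also have "r * r + r + 1 = 2 * tri r + (2 * r + 1)" using tri_double[of r] by (simp add: algebra_simps)
      also have "q powi \<dots> = q powi (2 * tri r) * R" using q by (simp add: power_int_add R_def)
      also have "q powi (2 * tri r) = theta_coeff p r * msgn r" by (simp add: theta_coeff_def p_def power_int_power mult_ac)
      finally show ?thesis using q by (simp add: field_simps)
    qed
    have "(1 - x)\<^sup>2 * (S * (P * S * R / q) / (1 - R) * (A * B)) - S * (P * S * R / q) / (1 - R) * ((1 - x / R) * A * ((1 - x * R) * B))
      = x / q * (P * (A * B)) + - x * (S * (P * S * R / q) * (A * B))" if "S * S = 1" for S P A B :: complex
    proof -
      have "(1 - x)\<^sup>2 - (1 - x / R) * (1 - x * R) = x / R * (1 - R)\<^sup>2" using R by (simp add: field_simps power2_eq_square)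
      then have "S * (P * S * R / q) / (1 - R) * (A * B) * ((1 - x)\<^sup>2 - (1 - x / R) * (1 - x * R)) = (S * S) * P / q * x * (1 - R) * A * B"
        using R by (simp add: power2_eq_square)
      moreover have "- x * (S * (P * S * R / q) * (A * B)) = - x * ((S * S) * (P * R / q) * (A * B))" by simp
      ultimately show ?thesis unfolding pair_factor using that by (simp add: algebra_simps diff_divide_distrib)
    qed
    then show ?thesis unfolding U_def \<alpha>_def a b e R_def[symmetric] by simp
  qed
  have z: "(\<Sum>\<^sub>\<infinity>r. msgn r * q powi (r * r + r) * U m r) = 0"
  proof -
    let ?g = "\<lambda>r. msgn r * q powi (r * r + r) * U m r"
    have "?g (-1 - r) = - ?g r" for r
    proof -
      have e: "(-1 - r) * (-1 - r) + (-1 - r) = r * r + r" by (simp add: algebra_simps)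
      have "U m (-1 - r) = U m r" unfolding U_def by (simp add: algebra_simps)
      moreover have "msgn (-1 - r) = - msgn r" by (auto simp: msgn_def)
      ultimately show ?thesis unfolding e by simp
    qed
    then show ?thesis by (rule infsum_antisym)
  qed
  have "(1 - x)\<^sup>2 * (\<Sum>\<^sub>\<infinity>r. \<alpha> r * U m r) - (\<Sum>\<^sub>\<infinity>r. \<alpha> r * U n r) = (\<Sum>\<^sub>\<infinity>r. (1 - x)\<^sup>2 * (\<alpha> r * U m r) + - (\<alpha> r * U n r))"
    using s by (subst infsum_add) (auto intro: summable_on_cmult_right simp: infsum_cmult_right' summable_on_uminus infsum_uminus)
  also have "\<dots> = (\<Sum>\<^sub>\<infinity>r. x / q * (theta_coeff p r * U m r) + - x * (msgn r * q powi (r * r + r) * U m r))"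
    using key by (intro infsum_cong) simp
  also have "\<dots> = x / q * (\<Sum>\<^sub>\<infinity>r. theta_coeff p r * U m r) + - x * (\<Sum>\<^sub>\<infinity>r. msgn r * q powi (r * r + r) * U m r)"
    by (rule infsum_lincomb[OF s s])
  also have "(\<Sum>\<^sub>\<infinity>r. theta_coeff p r * U m r) = finite_jtheta p 1 m (m + 1)"
    unfolding finite_jtheta_def U_def by (intro infsum_cong) (simp add: algebra_simps)
  also have "finite_jtheta p 1 m (m + 1) = 0" by (rule finite_jtheta_at_1[OF p]) (simp add: m_def)
  finally have "(1 - x)\<^sup>2 * (\<Sum>\<^sub>\<infinity>r. \<alpha> r * U m r) = 1 / (qpoch q p (n + 1))\<^sup>2"
    using Suc unfolding \<alpha>_def U_def z[unfolded U_def] by simp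
  moreover have "p ^ Suc n * q = x" unfolding x_def m_def p_def power_mult[symmetric] by (simp only: power_add power_one_right)
  then have "qpoch q p (Suc n + 1) = qpoch q p (n + 1) * (1 - x)" by (simp only: qpoch_Suc Suc_eq_plus1[symmetric])
  ultimately have "(\<Sum>\<^sub>\<infinity>r. \<alpha> r * U m r) = 1 / (qpoch q p (Suc n + 1))\<^sup>2" using nz' recip_square_mult by simp
  then show ?case unfolding \<alpha>_def U_def m_def by simp
qed

text \<open>
  Bailey's lemma in base q^2 with e = 1 and y = - q^3.  Here \<gamma>_r carries an additional denominator
  1 + q^(2r+1), which completes the denominator 1 - q^(2r+1) of the pair to 1 - q^(4r+2).
\<close>

theorem A2_eulerian_lambert:
  assumes q: "norm q < 1" "q \<noteq> 0"
  shows "(\<lambda>n. q ^ (n + 1)\<^sup>2 * qpoch (- q) (q\<^sup>2) n / (qpoch q (q\<^sup>2) (n + 1))\<^sup>2) sums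
    (qinf (- q) (q\<^sup>2) / qinf (q\<^sup>2) (q\<^sup>2) * (\<Sum>\<^sub>\<infinity>r. msgn r * q powi (2 * r * r + 3 * r + 1) / (1 - q powi (4 * r + 2))))"
proof -
  define p where "p = q\<^sup>2"
  have p: "norm p < 1" "p \<noteq> 0" using q norm_lt_1_power[OF q(1), of 2] by (auto simp: p_def)
  define \<alpha> where "\<alpha> = (\<lambda>r. msgn r * q powi (r * r + r) / (1 - q powi (2 * r + 1)))"
  have d: "bailey_delta p (p ^ (1 + 1)) (- (q ^ 3)) n = q ^ (n\<^sup>2 + 2 * n) * qpoch (- q) p n" for n
  proof (induction n)
    case (Suc n)
    have e: "(Suc n)\<^sup>2 + 2 * Suc n = (n\<^sup>2 + 2 * n) + (2 * n + 3)" by (simp add: power2_eq_square)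
    have P: "p ^ (2 * n) = p ^ n * p ^ n" "q ^ (2 * n + 3) = p ^ n * q ^ 3" "p ^ (1 + 1) = q ^ 3 * q"
      by (simp add: mult_2 power_add) (simp add: p_def power_add power_mult, simp add: p_def power2_eq_square power3_eq_cube)
    have "p ^ (1 + 1) * p ^ (2 * n) - - (q ^ 3) * p ^ n = q ^ (2 * n + 3) * (1 - p ^ n * - q)"
      unfolding P by (simp add: algebra_simps)
    then show ?case using Suc unfolding e bailey_delta_simps qpoch_Suc power_add[of q "n\<^sup>2 + 2 * n"] by simp
  qed simp
  have tp: "p powi tri (r + 1) = q powi (r * r + r)" for r
    using tri_double[of "r + 1"] by (simp add: p_def power_int_power algebra_simps)
  have "(\<lambda>r. theta_coeff p (r + 1)) summable_on UNIV"
    using entireD[OF theta_coeff_summable[OF p], of 1] summable_on_int_shift[of "theta_coeff p" 1] by simp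
  then have "(\<lambda>r. theta_coeff p (r + 1) * (- 1 / (1 - q powi (2 * r + 1)))) summable_on UNIV"
  proof (rule summable_mult_bounded[where B = "1 / (1 - norm q)"])
    fix r :: int
    have "2 * r + 1 \<noteq> 0" by presburger
    then show "norm (- 1 / (1 - q powi (2 * r + 1))) \<le> 1 / (1 - norm q)"
      using norm_recip_bound[OF q, of 1 "2 * r + 1"] by (simp add: norm_divide)
  qed
  also have "(\<lambda>r. theta_coeff p (r + 1) * (- 1 / (1 - q powi (2 * r + 1)))) = \<alpha>" by (auto simp: \<alpha>_def theta_coeff_def fun_eq_iff tp)
  finally have \<alpha>: "\<alpha> summable_on UNIV" .
  have "(\<lambda>n. bailey_delta p (p ^ (1 + 1)) (- (q ^ 3)) n * (1 / (qpoch q p (n + 1))\<^sup>2)) sums (\<Sum>\<^sub>\<infinity>r. \<alpha> r * bailey_gamma_int p 1 (- (q ^ 3)) r)"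
  proof (rule bailey_sum[OF p(1) _ \<alpha>])
    show "1 / (qpoch q p (n + 1))\<^sup>2 = (\<Sum>\<^sub>\<infinity>r. \<alpha> r * (rec_qpoch p (int n - r) * rec_qpoch p (int n + r + int 1)))" for n
      unfolding \<alpha>_def p_def by (rule A2_pair[OF q])
  qed simp
  then have "(\<lambda>n. q * (bailey_delta p (p ^ (1 + 1)) (- (q ^ 3)) n * (1 / (qpoch q p (n + 1))\<^sup>2))) sums (q * (\<Sum>\<^sub>\<infinity>r. \<alpha> r * bailey_gamma_int p 1 (- (q ^ 3)) r))"
    by (rule sums_mult)
  also have "(\<lambda>n. q * (bailey_delta p (p ^ (1 + 1)) (- (q ^ 3)) n * (1 / (qpoch q p (n + 1))\<^sup>2)))
     = (\<lambda>n. q ^ (n + 1)\<^sup>2 * qpoch (- q) p n / (qpoch q p (n + 1))\<^sup>2)"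
  proof
    fix n :: nat
    have "(n + 1)\<^sup>2 = Suc (n\<^sup>2 + 2 * n)" by (simp add: power2_eq_square)
    then have e: "q ^ (n + 1)\<^sup>2 = q * q ^ (n\<^sup>2 + 2 * n)" by simp
    have 1: "q * ((E * X) * (1 / Y)) = (q * E) * X / Y" for E X Y :: complex
      by (simp only: mult.assoc times_divide_eq_right mult_1_right)
    show "q * (bailey_delta p (p ^ (1 + 1)) (- (q ^ 3)) n * (1 / (qpoch q p (n + 1))\<^sup>2)) = q ^ (n + 1)\<^sup>2 * qpoch (- q) p n / (qpoch q p (n + 1))\<^sup>2"
      by (subst d, subst 1, subst e, rule refl)
  qed
  also have "q * (\<Sum>\<^sub>\<infinity>r. \<alpha> r * bailey_gamma_int p 1 (- (q ^ 3)) r) =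
     (\<Sum>\<^sub>\<infinity>r. qinf (- q) p / qinf p p * (msgn r * q powi (2 * r * r + 3 * r + 1) / (1 - q powi (4 * r + 2))))"
    unfolding infsum_cmult_right'[symmetric]
  proof (rule infsum_cong)
    fix r
    define n where "n = nat (if r \<ge> 0 then r else - r - int 1)"
    have n: "int n = (if r \<ge> 0 then r else - r - 1)" by (simp add: n_def)
    define T where "T = q powi (2 * int n + 1)"
    have nz: "1 + q powi (2 * k + 1) \<noteq> 0" for k using powi_ne[OF q, of "-1" "2 * k + 1"] by auto presburger
    have nz': "1 - q powi (2 * k + 1) \<noteq> 0" for k using powi_ne[OF q, of "1" "2 * k + 1"] by auto presburger
    have a1: "- (q ^ 3) * p ^ n = - q * p ^ (n + 1)" by (simp add: p_def power2_eq_square power3_eq_cube)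
    have a2: "qpoch (- q) p (n + 1) = qpoch (- q) p n * (1 + T)"
    proof -
      have "T = q powi int (2 * n + 1)" by (simp add: T_def add.commute)
      also have "\<dots> = p ^ n * q" by (simp only: power_int_of_nat p_def power_mult power_add power_one_right)
      finally show ?thesis by (simp add: qpoch_Suc)
    qed
    have a3: "qinf (- q) p = qpoch (- q) p (n + 1) * qinf (- q * p ^ (n + 1)) p" by (rule qinf_add[OF p(1)])
    have "1 + T \<noteq> 0" unfolding T_def by (rule nz)
    then have e1: "qpoch (- q) p n * qinf (- (q ^ 3) * p ^ n) p = qinf (- q) p / (1 + T)"
      unfolding a1 a3[unfolded a2] by simp
    have e2: "q ^ (n\<^sup>2 + 2 * n) / (1 + T) = q powi (r * r + 2 * r) / (1 + q powi (2 * r + 1))"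
    proof (cases "r \<ge> 0")
      case True
      have "q ^ (n\<^sup>2 + 2 * n) = q powi (int n * int n + 2 * int n)" by (simp add: power2_eq_square flip: power_int_of_nat)
      then show ?thesis using True by (simp add: T_def n)
    next
      case False
      have "q ^ (n\<^sup>2 + 2 * n) = q powi (int n * int n + 2 * int n)" by (simp add: power2_eq_square flip: power_int_of_nat)
      also have "int n * int n + 2 * int n = (r * r + 2 * r) - (2 * r + 1)" using False by (simp add: n algebra_simps)
      also have "q powi \<dots> = q powi (r * r + 2 * r) / q powi (2 * r + 1)" by (rule power_int_diff) (use q in simp)
      finally have 1: "q ^ (n\<^sup>2 + 2 * n) = q powi (r * r + 2 * r) / q powi (2 * r + 1)" .
      have "2 * int n + 1 = - (2 * r + 1)" using False by (simp add: n)
      then have 2: "T = 1 / q powi (2 * r + 1)" unfolding T_def by (simp only: power_int_minus_divide)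
      show ?thesis unfolding 1 2 using q nz[of r] by (simp add: field_simps)
    qed
    have b: "bailey_gamma_int p 1 (- (q ^ 3)) r = q powi (r * r + 2 * r) / (1 + q powi (2 * r + 1)) * qinf (- q) p / qinf p p"
      unfolding bailey_gamma_int_def bailey_gamma_def n_def[symmetric] d e2[symmetric] mult.assoc e1 by simp
    have "q powi (4 * r + 2) = q powi (2 * r + 1) * q powi (2 * r + 1)" using q by (simp flip: power_int_add)
    then have f1: "1 - q powi (4 * r + 2) = (1 - q powi (2 * r + 1)) * (1 + q powi (2 * r + 1))" by (simp add: algebra_simps)
    have f2: "q powi (2 * r * r + 3 * r + 1) = q * (q powi (r * r + r) * q powi (r * r + 2 * r))"
    proof -
      have e: "2 * r * r + 3 * r + 1 = 1 + ((r * r + r) + (r * r + 2 * r))" by (simp add: algebra_simps)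
      have "q powi (1 + (A + B)) = q * (q powi A * q powi B)" for A B using q by (simp add: power_int_add)
      then show ?thesis by (simp only: e)
    qed
    show "q * (\<alpha> r * bailey_gamma_int p 1 (- (q ^ 3)) r) = qinf (- q) p / qinf p p * (msgn r * q powi (2 * r * r + 3 * r + 1) / (1 - q powi (4 * r + 2)))"
      unfolding b \<alpha>_def f1 f2 by (simp add: mult_ac)
  qed
  finally show ?thesis unfolding infsum_cmult_right' p_def .
qed

section \<open>Fine's transformation\<close>

text \<open>
  Fine's function F(a/p, b/p; t) in base p.
\<close>

definition fineF :: "complex \<Rightarrow> complex \<Rightarrow> complex \<Rightarrow> complex \<Rightarrow> complex" where
  "fineF p a b t = (\<Sum>n. qpoch a p n / qpoch b p n * t ^ n)"

text \<open>
  Uniformity in m is needed because the iteration of fine_step replaces b by b p^m.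
\<close>

lemma fine_bound:
  assumes p: "norm p < 1" and b: "\<And>n. p ^ n * b \<noteq> 1"
  obtains C where "C \<ge> 0" "\<And>n m. norm (qpoch a p n / qpoch (b * p ^ m) p n) \<le> C"
proof -
  have "Bseq (\<lambda>n. qpoch a p n)" using qpoch_LIMSEQ[OF p] convergentI convergent_imp_Bseq by blast
  then obtain A where A: "\<And>n. norm (qpoch a p n) \<le> A" unfolding Bseq_def by blast
  obtain e C where e: "e > 0" "\<And>n. e \<le> norm (qpoch b p n)" and C: "\<And>n. norm (qpoch b p n) \<le> C"
    using qpoch_bounds[OF p b] by blast
  have A0: "A \<ge> 0" using A[of 0] by simp
  have C0: "C \<ge> 0" using C[of 0] by simp
  have "norm (qpoch a p n / qpoch (b * p ^ m) p n) \<le> A * C / e" for n m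
  proof -
    have "qpoch b p (m + n) = qpoch b p m * qpoch (b * p ^ m) p n" by (simp add: qpoch_add mult.commute)
    moreover have "qpoch b p m \<noteq> 0" using qpoch_nonzero[OF b] by blast
    ultimately have "qpoch a p n / qpoch (b * p ^ m) p n = qpoch a p n * qpoch b p m / qpoch b p (m + n)" by simp
    moreover have "norm (qpoch a p n * qpoch b p m / qpoch b p (m + n)) \<le> A * C / e"
      unfolding norm_mult norm_divide using e A C A0 C0 by (intro frac_le mult_mono) auto
    ultimately show ?thesis by (simp only:)
  qed
  then show thesis using that[of "A * C / e"] A0 C0 e by simp
qed

lemma fine_summable:
  assumes p: "norm p < 1" and b: "\<And>n. p ^ n * b \<noteq> 1" and t: "norm t < 1"
  shows "summable (\<lambda>n. qpoch a p n / qpoch b p n * t ^ n)"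
proof -
  obtain C where C: "C \<ge> 0" "\<And>n m. norm (qpoch a p n / qpoch (b * p ^ m) p n) \<le> C" using fine_bound[OF p b] by metis
  show ?thesis
  proof (rule summable_comparison_test'[where g = "\<lambda>n. C * norm t ^ n" and N = 0])
    show "summable (\<lambda>n. C * norm t ^ n)" using t by (intro summable_mult summable_geometric) simp
    show "norm (qpoch a p n / qpoch b p n * t ^ n) \<le> C * norm t ^ n" for n
      using mult_right_mono[OF C(2)[of n 0], of "norm t ^ n"] unfolding norm_mult norm_power by simp
  qed
qed

text \<open>
  Summation by parts: with u n = (a;p)_n / (b;p)_n, the difference u (n + 1) - u n is
  p^n (b - a) / (1 - b) times the quotient (a;p)_n / (b p;p)_n.
\<close>

lemma fine_step:
  assumes p: "norm p < 1" and b: "\<And>n. p ^ n * b \<noteq> 1" and t: "norm t < 1"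
  shows "(1 - t) * fineF p a b t = 1 + t * (b - a) / (1 - b) * fineF p a (b * p) (t * p)"
proof -
  define u where "u n = qpoch a p n / qpoch b p n" for n
  have s: "summable (\<lambda>n. u n * t ^ n)" unfolding u_def by (rule fine_summable[OF assms])
  have s1: "summable (\<lambda>n. u (Suc n) * t ^ Suc n)" using s by (subst summable_Suc_iff)
  have "(1 - t) * fineF p a b t = (\<Sum>n. u n * t ^ n) - (\<Sum>n. u n * t ^ Suc n)"
    unfolding fineF_def u_def[symmetric] using suminf_mult[OF s, of t] by (simp add: algebra_simps)
  also have "(\<Sum>n. u n * t ^ n) = u 0 + (\<Sum>n. u (Suc n) * t ^ Suc n)" using suminf_split_head[OF s] by simp
  also have "u 0 + (\<Sum>n. u (Suc n) * t ^ Suc n) - (\<Sum>n. u n * t ^ Suc n) = u 0 + (\<Sum>n. u (Suc n) * t ^ Suc n - u n * t ^ Suc n)"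
    using s1 summable_mult[OF s, of t] by (subst suminf_diff[symmetric]) (auto simp: mult_ac)
  also have "(\<lambda>n. u (Suc n) * t ^ Suc n - u n * t ^ Suc n) = (\<lambda>n. t * (b - a) / (1 - b) * (qpoch a p n / qpoch (b * p) p n * (t * p) ^ n))"
  proof
    fix n
    define Z where "Z = 1 - p ^ n * b"
    have Z: "Z \<noteq> 0" using b[of n] by (simp add: Z_def)
    have b1: "1 - b \<noteq> 0" using b[of 0] by simp
    have w: "qpoch b p n * Z = (1 - b) * qpoch (b * p) p n"
      using qpoch_Suc'[of b p n] qpoch_Suc[of b p n] by (simp add: Z_def mult.commute)
    have nz: "qpoch b p n \<noteq> 0" "qpoch (b * p) p n \<noteq> 0"
      using qpoch_nonzero[OF b] qpoch_nonzero[OF power_mult_ne_1_shift[OF b, of _ 1]] by auto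
    have "u (Suc n) - u n = qpoch a p n * (p ^ n * (b - a)) / (qpoch b p n * Z)"
      unfolding u_def qpoch_Suc Z_def[symmetric] using nz Z by (simp add: divide_simps) (simp add: Z_def algebra_simps)
    also have "\<dots> = (b - a) / (1 - b) * (qpoch a p n / qpoch (b * p) p n * p ^ n)"
      unfolding w using b1 nz by (simp add: divide_simps mult_ac)
    finally have "u (Suc n) - u n = (b - a) / (1 - b) * (qpoch a p n / qpoch (b * p) p n * p ^ n)" .
    moreover have "u (Suc n) * t ^ Suc n - u n * t ^ Suc n = (u (Suc n) - u n) * (t * t ^ n)" by (simp add: algebra_simps)
    ultimately show "u (Suc n) * t ^ Suc n - u n * t ^ Suc n = t * (b - a) / (1 - b) * (qpoch a p n / qpoch (b * p) p n * (t * p) ^ n)"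
      by (simp add: power_mult_distrib)
  qed
  also have "(\<Sum>n. t * (b - a) / (1 - b) * (qpoch a p n / qpoch (b * p) p n * (t * p) ^ n)) = t * (b - a) / (1 - b) * fineF p a (b * p) (t * p)"
    unfolding fineF_def
  proof (rule suminf_mult, rule fine_summable[OF p])
    show "p ^ n * (b * p) \<noteq> 1" for n using power_mult_ne_1_shift[OF b, of n 1] by simp
    have "norm t * norm p < 1 * 1" using p t by (intro mult_strict_mono) auto
    then show "norm (t * p) < 1" by (simp add: norm_mult)
  qed
  finally show ?thesis by (simp add: u_def)
qed

text \<open>
  The defining series of A is q / (1 - q) times a Fine function.  Each application of fine_step splits
  off one term of the series with squared denominators, and the remainder after N steps is of order q^((N+1)^2).
\<close>

theorem A2_eulerian:
  assumes q: "norm q < 1" "q \<noteq> 0"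
    and S: "(\<lambda>n. q ^ (n + 1)\<^sup>2 * qpoch (- q) (q\<^sup>2) n / (qpoch q (q\<^sup>2) (n + 1))\<^sup>2) sums S"
  shows "A2 q = S"
proof -
  define p where "p = q\<^sup>2"
  have p: "norm p < 1" "p \<noteq> 0" using q norm_lt_1_power[OF q(1), of 2] by (auto simp: p_def)
  \<comment> \<open>After N steps the terms t n with n < N have been split off and R N * f N is the remainder.\<close>
  define t where "t = (\<lambda>n. q ^ (n + 1)\<^sup>2 * qpoch (- q) p n / (qpoch q p (n + 1))\<^sup>2)"
  define R where "R = (\<lambda>n. q ^ (n + 1)\<^sup>2 * qpoch (- q) p n / (qpoch q p n * qpoch q p (n + 1)))"
  define f where "f = (\<lambda>n. fineF p (- p) (q ^ 3 * p ^ n) (q * p ^ n))"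
  have pq: "p ^ n * q = q ^ (2 * n + 1)" "p ^ n * q ^ 3 = q ^ (2 * n + 3)" for n
    by (simp_all only: p_def power_mult power_add power_one_right)
  have q1: "p ^ n * q \<noteq> 1" for n unfolding pq using power_ne_1[OF q(1), of "2 * n + 1"] by simp
  have q3: "p ^ n * q ^ 3 \<noteq> 1" for n
    unfolding pq using power_ne_1[OF q(1), of "2 * n + 3"] by simp
  have nq: "qpoch q p n \<noteq> 0" for n by (rule qpoch_nonzero[OF q1])
  have step: "R n * f n = t n + R (Suc n) * f (Suc n)" for n
  proof -
    have tn: "norm (q * p ^ n) < 1"
      unfolding mult.commute[of q] pq using norm_lt_1_power[OF q(1), of "2 * n + 1"] by simp
    have "(1 - q * p ^ n) * f n = 1 + q * p ^ n * (q ^ 3 * p ^ n - - p) / (1 - q ^ 3 * p ^ n) * f (Suc n)"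
      unfolding f_def using fine_step[OF p(1) power_mult_ne_1_shift[OF q3, of _ n] tn, where a = "- p"] by (simp add: mult_ac)
    moreover define X where "X = 1 - q * p ^ n"
    moreover define Y where "Y = 1 - q ^ 3 * p ^ n"
    ultimately have fs: "X * f n = 1 + q * p ^ n * (q ^ 3 * p ^ n + p) / Y * f (Suc n)" by simp
    have XY: "X \<noteq> 0" "Y \<noteq> 0" using q1[of n] q3[of n] by (auto simp: X_def Y_def mult.commute)
    have P1: "qpoch q p (n + 1) = qpoch q p n * X" by (simp add: qpoch_Suc X_def mult.commute)
    have P2: "qpoch q p (Suc n + 1) = qpoch q p n * X * Y"
      by (simp add: qpoch_Suc X_def Y_def p_def mult_ac power2_eq_square power3_eq_cube)
    have P3: "qpoch (- q) p (Suc n) = qpoch (- q) p n * (1 + q * p ^ n)" by (simp add: qpoch_Suc mult.commute)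
    have e: "(Suc n + 1)\<^sup>2 = (n + 1)\<^sup>2 + (2 * n + 3)" unfolding power2_eq_square by (simp add: algebra_simps)
    have qp: "q ^ (2 * n + 3) = q ^ 3 * p ^ n" unfolding pq(2)[symmetric] by (rule mult.commute)
    have R1: "R n = t n * X" unfolding R_def t_def P1 using XY nq[of n] by (simp add: power2_eq_square)
    have R2: "R (Suc n) = t n * (q * p ^ n * (q ^ 3 * p ^ n + p)) / Y"
      unfolding R_def t_def P2 P3 e power_add[of q "(n+1)\<^sup>2"] qp using XY nq[of n] P1
      by (simp add: power2_eq_square) (simp add: p_def power2_eq_square power3_eq_cube algebra_simps)
    have "R n * f n = t n * (X * f n)" unfolding R1 by simp
    also have "\<dots> = t n + R (Suc n) * f (Suc n)" unfolding fs R2 by (simp add: algebra_simps)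
    finally show ?thesis .
  qed
  have part: "R 0 * f 0 = (\<Sum>n<N. t n) + R N * f N" for N
    by (induction N) (simp_all add: step[symmetric])
  have "(\<lambda>N. R N * f N) \<longlonglongrightarrow> 0"
  proof -
    obtain C where C: "C \<ge> 0" "\<And>n m. norm (qpoch (- p) p n / qpoch (q ^ 3 * p ^ m) p n) \<le> C"
      using fine_bound[OF p(1) q3] by metis
    have fb: "norm (f N) \<le> C / (1 - norm q)" for N
    proof -
      have b: "norm (qpoch (- p) p n / qpoch (q ^ 3 * p ^ N) p n * (q * p ^ N) ^ n) \<le> C * norm q ^ n" for n
      proof -
        have "norm (q * p ^ N) \<le> norm q * 1" unfolding norm_mult using p by (intro mult_left_mono) (auto simp: norm_power power_le_one)
        then have "norm ((q * p ^ N) ^ n) \<le> norm q ^ n" by (simp add: norm_power power_mono)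
        then show ?thesis unfolding norm_mult using C by (intro mult_mono) (auto simp del: norm_divide)
      qed
      have g: "(\<lambda>n. C * norm q ^ n) sums (C * (1 / (1 - norm q)))" using q by (intro sums_mult geometric_sums) simp
      have "norm (f N) \<le> (\<Sum>n. C * norm q ^ n)" unfolding f_def fineF_def
        using b g by (intro norm_suminf_le) (auto simp: sums_iff)
      then show ?thesis using g by (simp add: sums_iff)
    qed
    have "Bseq (\<lambda>n. qpoch (- q) p n)" using qpoch_LIMSEQ[OF p(1)] convergentI convergent_imp_Bseq by blast
    have qn: "(\<lambda>n. q ^ n) \<longlonglongrightarrow> 0" using q by (intro LIMSEQ_power_zero) simp
    have "filterlim (\<lambda>n. (n + 1)\<^sup>2) sequentially (sequentially :: nat filter)"
      by (intro filterlim_subseq strict_monoI power_strict_mono) auto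
    then have "(\<lambda>n. q ^ (n + 1)\<^sup>2) \<longlonglongrightarrow> 0" by (rule filterlim_compose[OF qn])
    then have "R \<longlonglongrightarrow> 0 * qinf (- q) p / (qinf q p * qinf q p)" unfolding R_def
      by (intro tendsto_mult tendsto_divide qpoch_LIMSEQ[OF p(1)] LIMSEQ_ignore_initial_segment[OF qpoch_LIMSEQ[OF p(1)]])
        (auto simp: qinf_nonzero[OF p(1) q1])
    then have R0: "R \<longlonglongrightarrow> 0" by simp
    show ?thesis
    proof (rule Lim_null_comparison)
      show "\<forall>\<^sub>F N in sequentially. norm (R N * f N) \<le> norm (R N) * (C / (1 - norm q))"
        unfolding norm_mult by (intro always_eventually allI mult_left_mono fb norm_ge_zero)
      show "(\<lambda>N. norm (R N) * (C / (1 - norm q))) \<longlonglongrightarrow> 0" using tendsto_mult_left_zero[OF tendsto_norm_zero[OF R0]] .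
    qed
  qed
  then have "(\<lambda>N. R 0 * f 0 - R N * f N) \<longlonglongrightarrow> R 0 * f 0 - 0" by (intro tendsto_intros)
  also have "(\<lambda>N. R 0 * f 0 - R N * f N) = (\<lambda>N. \<Sum>n<N. t n)" using part by (simp add: fun_eq_iff algebra_simps)
  finally have "t sums (R 0 * f 0)" by (simp add: sums_def)
  then have SR: "S = R 0 * f 0" using S unfolding t_def p_def by (rule sums_unique2[symmetric])
  have tn: "norm (q * p ^ 0) < 1" using q by simp
  have "A2 q = (\<Sum>n. q / (1 - q) * (qpoch (- p) p n / qpoch (q ^ 3 * p ^ 0) p n * (q * p ^ 0) ^ n))"
    unfolding A2_def
  proof (intro suminf_cong)
    fix n
    have "p * q = q ^ 3 * p ^ 0" by (simp add: p_def power2_eq_square power3_eq_cube)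
    then have "qpoch q p (n + 1) = (1 - q) * qpoch (q ^ 3 * p ^ 0) p n" using qpoch_Suc'[of q p n] by simp
    then show "q ^ (n + 1) * qpoch (- (q\<^sup>2)) (q\<^sup>2) n / qpoch q (q\<^sup>2) (n + 1) = q / (1 - q) * (qpoch (- p) p n / qpoch (q ^ 3 * p ^ 0) p n * (q * p ^ 0) ^ n)"
      unfolding p_def by simp
  qed
  also have "\<dots> = q / (1 - q) * f 0"
    unfolding f_def fineF_def
    by (rule suminf_mult[OF fine_summable[OF p(1) _ tn]]) (use q3 in simp)
  also have "q / (1 - q) = R 0" by (simp add: R_def qpoch_Suc)
  finally show ?thesis using SR by simp
qed

theorem A2_lambert:
  assumes q: "norm q < 1" "q \<noteq> 0"
  shows "A2 q = qinf (- q) (q\<^sup>2) / qinf (q\<^sup>2) (q\<^sup>2) * (\<Sum>\<^sub>\<infinity>r. msgn r * q powi (2 * r * r + 3 * r + 1) / (1 - q powi (4 * r + 2)))"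
  by (rule A2_eulerian[OF q A2_eulerian_lambert[OF q]])

section \<open>The Hecke-type double sum of rho\<close>

text \<open>
  Up to the power of q in hecke_col, the sum over r of the Hecke-type double sum with j fixed.
\<close>

definition hecke_tail :: "complex \<Rightarrow> int \<Rightarrow> complex" where
  "hecke_tail q j = (\<Sum>\<^sub>\<infinity>r. if \<bar>j\<bar> \<le> r then msgn r * q powi (3 * tri (r + 1)) else 0)"

definition hecke_col :: "complex \<Rightarrow> int \<Rightarrow> complex" where
  "hecke_col q j = q powi (- tri (j + 1)) * hecke_tail q j"

text \<open>
  The sequence \<alpha>_r of the Bailey pair relative to q for 1 / (q;q^2)_(n+1); zero for negative r.
\<close>

definition rho_alpha :: "complex \<Rightarrow> int \<Rightarrow> complex" where
  "rho_alpha q r = msgn r * q powi (2 * tri (r + 1)) * (\<Sum>j\<in>{-r..r}. q powi (- tri (j + 1)))"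

lemma rho_alpha_neg [simp]: "r < 0 \<Longrightarrow> rho_alpha q r = 0" by (simp add: rho_alpha_def)

text \<open>
  The inner sums for r and r - 1 differ only in the two boundary terms j = r and j = - r.
\<close>

lemma rho_alpha_diff:
  assumes q: "q \<noteq> 0" and r: "r \<ge> 1"
  shows "rho_alpha q r * q powi (- r) + rho_alpha q (r - 1) * q powi r = msgn r * (q powi tri r + q powi (tri r + r))"
proof -
  define I where "I = (\<lambda>r. \<Sum>j\<in>{-r..r}. q powi (- tri (j + 1)))"
  have set: "{-r..r} = insert r (insert (- r) {-(r - 1)..r - 1})" using r by auto
  have I: "I r = q powi (- tri (r + 1)) + q powi (- tri r) + I (r - 1)"
  proof -
    have "tri (1 - r) = tri r" by (rule tri_reflect)
    then show ?thesis unfolding I_def set using r by (subst sum.insert, simp, simp, subst sum.insert, simp, simp) (simp add: algebra_simps)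
  qed
  have a: "tri (r - 1 + 1) = tri r" "tri (r + 1) = tri r + r" by (simp_all add: tri_Suc)
  have "rho_alpha q r * q powi (- r) + rho_alpha q (r - 1) * q powi r
    = msgn r * (q powi (2 * tri r + r) * (I r - I (r - 1)))"
  proof -
    have r1: "rho_alpha q r = msgn r * q powi (2 * (tri r + r)) * I r" "rho_alpha q (r - 1) = - msgn r * q powi (2 * tri r) * I (r - 1)"
      unfolding rho_alpha_def I_def a by simp_all
    have e: "2 * (tri r + r) + - r = 2 * tri r + r" by simp
    have "q powi x * q powi y = q powi (x + y)" for x y using q by (simp add: power_int_add)
    from this[of "2 * (tri r + r)" "- r"] this[of "2 * tri r" r]
    have r2: "q powi (2 * (tri r + r)) * q powi (- r) = q powi (2 * tri r + r)" "q powi (2 * tri r) * q powi r = q powi (2 * tri r + r)"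
      unfolding e by simp_all
    have "m * X * i * u + - m * Y * i' * v = m * (Z * (i - i'))" if "X * u = Z" "Y * v = Z" for m X Y u v Z i i' :: complex
    proof -
      have "m * X * i * u + - m * Y * i' * v = m * (X * u) * i - m * (Y * v) * i'" by (simp add: mult_ac)
      then show ?thesis unfolding that by (simp add: right_diff_distrib mult_ac)
    qed
    from this[OF r2] show ?thesis unfolding r1 .
  qed
  also have "\<dots> = msgn r * (q powi (2 * tri r + r) * (q powi (- (tri r + r)) + q powi (- tri r)))" unfolding I a by simp
  also have "\<dots> = msgn r * (q powi tri r + q powi (tri r + r))" using q by (simp add: distrib_left flip: power_int_add)
  finally show ?thesis .
qed

lemma recip_mult:
  fixes S X Y :: complex
  assumes "Y * S = 1 / X" "Y \<noteq> 0" shows "S = 1 / (X * Y)"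
proof -
  have "S = (Y * S) / Y" using assms(2) by simp
  then show ?thesis unfolding assms(1) by simp
qed

text \<open>
  Induction on n.  With m = n + 1, subtracting the claim for n from 1 - q^(2m+1) times the claim for m
  leaves a sum against the weights V r, which are even in r.  Only the even part of the other factor
  matters, and by rho_alpha_diff it is that of the theta coefficients.  So the sum is a truncated theta
  series at 1, which vanishes.
\<close>

lemma rho_pair:
  assumes q: "norm q < 1" "q \<noteq> 0"
  shows "1 / qpoch q (q\<^sup>2) (n + 1) = (\<Sum>\<^sub>\<infinity>r. rho_alpha q r * (rec_qpoch q (int n - r) * rec_qpoch q (int n + r + int 1)))"
proof (induction n)
  case 0
  have "(\<Sum>\<^sub>\<infinity>r. rho_alpha q r * (rec_qpoch q (int 0 - r) * rec_qpoch q (int 0 + r + int 1)))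
    = (\<Sum>\<^sub>\<infinity>r\<in>{0}. rho_alpha q r * (rec_qpoch q (int 0 - r) * rec_qpoch q (int 0 + r + int 1)))"
    by (rule infsum_cong_neutral) (auto simp: linorder_neq_iff)
  then show ?case by (simp add: rho_alpha_def rec_qpoch_def qpoch_Suc)
next
  case (Suc n)
  define U where "U = (\<lambda>m r. rec_qpoch q (int m - r) * rec_qpoch q (int m + r + 1))"
  define m where "m = Suc n"
  define V where "V = (\<lambda>r. rec_qpoch q (int m - r) * rec_qpoch q (int m + r))"
  define x where "x = q ^ (2 * m + 1)"
  have nz: "1 - x \<noteq> 0" using power_ne_1[OF q(1), of "2 * m + 1"] by (simp add: x_def)
  have s: "(\<lambda>r. f r * U k r) summable_on UNIV" for f k
    by (rule summable_on_finite_support[of "- int k - 1" "int k"]) (auto simp: U_def)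
  have sV: "(\<lambda>r. f r * V (r + c)) summable_on UNIV" for f c
    by (rule summable_on_finite_support[of "- int m - \<bar>c\<bar>" "int m + \<bar>c\<bar>"]) (auto simp: V_def)
  have V_sym: "V (- r) = V r" for r by (simp add: V_def mult.commute)
  have key: "(1 - x) * (rho_alpha q r * U m r) + - 1 * (rho_alpha q r * U n r)
      = q ^ m * (rho_alpha q r * q powi (- r) * V (r + 0)) + q ^ m * (rho_alpha q r * q powi (r + 1) * V (r + 1))" for r
  proof -
    define A where "A = rec_qpoch q (int m - r)"
    define B where "B = rec_qpoch q (int m + r + 1)"
    have a: "rec_qpoch q (int n - r) = (1 - q powi (int m - r)) * A" "rec_qpoch q (int m - (r + 1)) = (1 - q powi (int m - r)) * A"
      using rec_qpoch_diff_1[OF q(1), of "int m - r"] unfolding m_def A_def by (simp_all add: algebra_simps)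
    have b: "rec_qpoch q (int n + r + 1) = (1 - q powi (int m + r + 1)) * B" "rec_qpoch q (int m + r) = (1 - q powi (int m + r + 1)) * B"
      using rec_qpoch_diff_1[OF q(1), of "int m + r + 1"] unfolding m_def B_def by (simp_all add: algebra_simps)
    have c: "q powi (int m - r) = q ^ m * q powi (- r)" "q powi (int m + r + 1) = q ^ m * q powi (r + 1)"
      using q by (simp_all add: power_int_add power_int_minus power_int_diff field_simps)
    have x: "x = q ^ m * q ^ m * q" by (simp add: x_def power_add mult_2)
    have d: "q powi (- r) * q powi (r + 1) = q" using q by (simp flip: power_int_add)
    have "(1 - T * T * (u * v)) * (Z * (A * B)) + - 1 * (Z * ((1 - T * u) * A * ((1 - T * v) * B)))
      = T * (Z * u * (A * ((1 - T * v) * B))) + T * (Z * v * ((1 - T * u) * A * B))" for T u v Z :: complex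
      by (simp add: algebra_simps)
    from this[of "q ^ m" "q powi (- r)" "q powi (r + 1)" "rho_alpha q r"] show ?thesis
      unfolding U_def V_def d x[symmetric] add_0_right a b c A_def[symmetric] B_def[symmetric] add.assoc[of "int m" r 1, symmetric] .
  qed
  have "(1 - x) * (\<Sum>\<^sub>\<infinity>r. rho_alpha q r * U m r) + - 1 * (\<Sum>\<^sub>\<infinity>r. rho_alpha q r * U n r)
     = (\<Sum>\<^sub>\<infinity>r. (1 - x) * (rho_alpha q r * U m r) + - 1 * (rho_alpha q r * U n r))"
    by (rule infsum_lincomb[OF s s, symmetric])
  also have "\<dots> = q ^ m * (\<Sum>\<^sub>\<infinity>r. rho_alpha q r * q powi (- r) * V (r + 0)) + q ^ m * (\<Sum>\<^sub>\<infinity>r. rho_alpha q r * q powi (r + 1) * V (r + 1))"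
    unfolding key by (rule infsum_lincomb[OF sV sV])
  also have "(\<Sum>\<^sub>\<infinity>r. rho_alpha q r * q powi (r + 1) * V (r + 1)) = (\<Sum>\<^sub>\<infinity>r. rho_alpha q (r - 1) * q powi r * V r)"
    using infsum_int_shift[of "\<lambda>r. rho_alpha q (r - 1) * q powi r * V r" 1] by simp
  also have "q ^ m * (\<Sum>\<^sub>\<infinity>r. rho_alpha q r * q powi (- r) * V (r + 0)) + q ^ m * (\<Sum>\<^sub>\<infinity>r. rho_alpha q (r - 1) * q powi r * V r)
     = q ^ m * (\<Sum>\<^sub>\<infinity>r. (rho_alpha q r * q powi (- r) + rho_alpha q (r - 1) * q powi r) * V r)"
    using infsum_add[OF sV[of "\<lambda>r. rho_alpha q r * q powi (- r)" 0] sV[of "\<lambda>r. rho_alpha q (r - 1) * q powi r" 0]]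
    by (simp add: distrib_left distrib_right)
  also have "(\<Sum>\<^sub>\<infinity>r. (rho_alpha q r * q powi (- r) + rho_alpha q (r - 1) * q powi r) * V r) = 0"
  proof -
    define f where "f = (\<lambda>r. (rho_alpha q r * q powi (- r) + rho_alpha q (r - 1) * q powi r) * V r)"
    define g where "g = (\<lambda>r. theta_coeff q r * V r)"
    have sf: "f summable_on UNIV" "g summable_on UNIV" unfolding f_def g_def using sV[of _ 0] by simp_all
    have sf': "(\<lambda>r. f (- r)) summable_on UNIV" "(\<lambda>r. g (- r)) summable_on UNIV"
      using sf summable_on_int_reflect[of f 0] summable_on_int_reflect[of g 0] by simp_all
    have r1: "f r + f (- r) = g r + g (- r)" if "r \<ge> 1" for r
      unfolding f_def g_def V_sym rho_alpha_diff[OF q(2) that] using that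
      by (simp add: theta_coeff_def tri_uminus algebra_simps)
    have "f r + f (- r) = g r + g (- r)" for r
    proof -
      consider "r \<ge> 1" | "r = 0" | "- r \<ge> 1" by linarith
      then show ?thesis
      proof cases
        case 2 then show ?thesis by (simp add: f_def g_def theta_coeff_def rho_alpha_def)
      next
        case 3 then show ?thesis using r1[of "- r"] by (simp add: add.commute)
      qed (rule r1)
    qed
    then have "(\<Sum>\<^sub>\<infinity>r. f r + f (- r)) = (\<Sum>\<^sub>\<infinity>r. g r + g (- r))" by simp
    then have "infsum f UNIV + infsum f UNIV = infsum g UNIV + infsum g UNIV"
      using infsum_add[OF sf(1) sf'(1)] infsum_add[OF sf(2) sf'(2)] infsum_int_reflect[of f 0] infsum_int_reflect[of g 0] by simp
    also have "infsum g UNIV = finite_jtheta q 1 m m" unfolding g_def finite_jtheta_def V_def by (intro infsum_cong) simp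
    also have "finite_jtheta q 1 m m = 0" by (rule finite_jtheta_at_1[OF q]) (simp add: m_def)
    finally show ?thesis unfolding f_def by simp
  qed
  finally have "(1 - x) * (\<Sum>\<^sub>\<infinity>r. rho_alpha q r * U m r) = 1 / qpoch q (q\<^sup>2) (n + 1)"
    using Suc unfolding U_def by simp
  moreover have "(q\<^sup>2) ^ Suc n * q = x" unfolding x_def m_def power_mult[symmetric] by (simp only: power_add power_one_right)
  then have "qpoch q (q\<^sup>2) (Suc n + 1) = qpoch q (q\<^sup>2) (n + 1) * (1 - x)" by (simp only: qpoch_Suc Suc_eq_plus1[symmetric])
  ultimately have "(\<Sum>\<^sub>\<infinity>r. rho_alpha q r * U m r) = 1 / qpoch q (q\<^sup>2) (Suc n + 1)" using nz recip_mult by simp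
  then show ?case unfolding U_def m_def by simp
qed

lemma tri_mono: assumes "0 \<le> a" "a \<le> b" shows "tri (a + 1) \<le> tri (b + 1)"
proof -
  have "(a + 1) * a \<le> (b + 1) * b" using assms by (intro mult_mono) auto
  then show ?thesis using tri_double[of "a + 1"] tri_double[of "b + 1"] by simp
qed

text \<open>
  On the cone |j| \<le> r the exponent 3 tri (r + 1) - tri (j + 1) of the double sum is therefore at least
  tri (r + 1) + tri (j + 1), which makes the double sum converge.
\<close>

lemma tri_le: assumes "\<bar>j\<bar> \<le> r" shows "tri (j + 1) \<le> tri (r + 1)"
proof (cases "j \<ge> 0")
  case True then show ?thesis using assms by (intro tri_mono) auto
next
  case False
  have "tri (j + 1) = tri ((- j - 1) + 1)" using tri_reflect[of "j + 1"] by (simp add: algebra_simps)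
  also have "\<dots> \<le> tri (r + 1)" using False assms by (intro tri_mono) auto
  finally show ?thesis .
qed

text \<open>
  The exponents are values of an indefinite quadratic form, restricted to a cone on which they grow.
  Summation over j first gives the Bailey sum for rho, summation over r first gives hecke_col.
\<close>

definition hecke_term :: "complex \<Rightarrow> int \<times> int \<Rightarrow> complex" where
  "hecke_term q = (\<lambda>(r, j). if \<bar>j\<bar> \<le> r then msgn r * q powi (3 * tri (r + 1)) * q powi (- tri (j + 1)) else 0)"

lemma hecke_summable:
  assumes q: "norm q < 1" "q \<noteq> 0" shows "hecke_term q summable_on UNIV \<times> UNIV"
proof -
  let ?g = "\<lambda>x::int\<times>int. norm q powi tri (fst x + 1) * norm q powi tri (snd x + 1)"
  have "(\<lambda>x. norm (hecke_term q x)) summable_on UNIV \<times> UNIV"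
  proof (rule Infinite_Sum.abs_summable_on_comparison_test'[where g = ?g])
    have "(\<lambda>r. theta_coeff q (r + 1)) summable_on UNIV"
      using entireD[OF theta_coeff_summable[OF q], of 1] summable_on_int_shift[of "theta_coeff q" 1] by simp
    from summable_on_norm_product[OF this this] show "?g summable_on UNIV \<times> UNIV"
      by (simp add: case_prod_unfold theta_coeff_def norm_mult norm_power_int)
    fix x :: "int \<times> int"
    obtain r j where x: "x = (r, j)" by (cases x)
    show "norm (hecke_term q x) \<le> ?g x"
    proof (cases "\<bar>j\<bar> \<le> r")
      case True
      have "norm (hecke_term q x) = norm q powi (3 * tri (r + 1) - tri (j + 1))"
        unfolding x hecke_term_def using True q by (simp add: norm_mult norm_power_int flip: power_int_add)
      also have "\<dots> \<le> norm q powi (tri (r + 1) + tri (j + 1))"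
        using q tri_le[OF True] tri_nonneg[of "j + 1"] tri_nonneg[of "r + 1"] by (intro power_int_decreasing) auto
      finally show ?thesis unfolding x using q by (simp add: power_int_add)
    qed (use q in \<open>simp add: x hecke_term_def\<close>)
  qed
  then show ?thesis by (rule abs_summable_summable)
qed

lemma hecke_rows: "(\<Sum>\<^sub>\<infinity>j. hecke_term q (r, j)) = rho_alpha q r * q powi tri (r + 1)" if "q \<noteq> 0"
proof -
  have "(\<Sum>\<^sub>\<infinity>j. hecke_term q (r, j)) = (\<Sum>\<^sub>\<infinity>j\<in>{-r..r}. msgn r * q powi (3 * tri (r + 1)) * q powi (- tri (j + 1)))"
    by (rule infsum_cong_neutral) (auto simp: hecke_term_def)
  also have "\<dots> = msgn r * q powi (3 * tri (r + 1)) * (\<Sum>j\<in>{-r..r}. q powi (- tri (j + 1)))"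
    by (simp add: sum_distrib_left)
  also have "q powi (3 * tri (r + 1)) = q powi (2 * tri (r + 1)) * q powi tri (r + 1)" using that by (simp flip: power_int_add)
  finally show ?thesis by (simp add: rho_alpha_def mult_ac)
qed

lemma hecke_cols: "(\<Sum>\<^sub>\<infinity>r. hecke_term q (r, j)) = hecke_col q j"
  unfolding hecke_col_def hecke_tail_def infsum_cmult_right'[symmetric] by (intro infsum_cong) (simp add: hecke_term_def)

lemma hecke_tail_summand:
  assumes q: "norm q < 1" "q \<noteq> 0"
  shows "(\<lambda>r. if \<bar>j\<bar> \<le> r then msgn r * q powi (3 * tri (r + 1)) else 0) summable_on UNIV"
proof -
  have "(\<lambda>(j, r). hecke_term q (r, j)) summable_on UNIV \<times> UNIV"
    using hecke_summable[OF q] summable_on_swap[of "hecke_term q" UNIV UNIV] by simp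
  then have "(\<lambda>r. hecke_term q (r, j)) summable_on UNIV" using summable_on_SigmaD1 by fastforce
  then have "(\<lambda>r. q powi tri (j + 1) * hecke_term q (r, j)) summable_on UNIV" by (rule summable_on_cmult_right)
  then show ?thesis
    by (rule summable_on_cong[THEN iffD1, rotated]) (use q in \<open>simp add: hecke_term_def mult_ac power_int_minus\<close>)
qed

text \<open>
  Passing from j to j + 1 changes the condition |j| \<le> r for a single r, namely r = j if j \<ge> 0 and
  r = - j - 1 otherwise.  The power of q is chosen so that the two columns can be subtracted.
\<close>

lemma hecke_col_rec:
  assumes q: "norm q < 1" "q \<noteq> 0"
  shows "hecke_col q j - q powi (j + 1) * hecke_col q (j + 1) = msgn j * q powi (2 * tri (j + 1))"
proof -
  define s where "s = (\<lambda>r. msgn r * q powi (3 * tri (r + 1)))"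
  have d: "hecke_tail q a - hecke_tail q b = s \<bar>a\<bar>" if "\<bar>b\<bar> = \<bar>a\<bar> + 1" for a b
  proof -
    have "hecke_tail q a - hecke_tail q b = (\<Sum>\<^sub>\<infinity>r. (if \<bar>a\<bar> \<le> r then s r else 0) - (if \<bar>b\<bar> \<le> r then s r else 0))"
      unfolding hecke_tail_def s_def diff_conv_add_uminus
      using hecke_tail_summand[OF q, of a] hecke_tail_summand[OF q, of b]
      by (subst infsum_add) (auto simp: infsum_uminus summable_on_uminus)
    also have "\<dots> = (\<Sum>\<^sub>\<infinity>r\<in>{\<bar>a\<bar>}. s r)"
      by (rule infsum_cong_neutral) (use that in auto)
    finally show ?thesis by simp
  qed
  have e: "hecke_col q j - q powi (j + 1) * hecke_col q (j + 1) = q powi (- tri (j + 1)) * (hecke_tail q j - hecke_tail q (j + 1))"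
  proof -
    have "q powi (j + 1) * q powi (- tri (j + 1 + 1)) = q powi (- tri (j + 1))"
      using q unfolding tri_Suc[of "j + 1"] by (simp flip: power_int_add)
    then show ?thesis unfolding hecke_col_def by (simp add: right_diff_distrib flip: mult.assoc)
  qed
  have f: "q powi (- tri (j + 1)) * q powi (3 * tri (j + 1)) = q powi (2 * tri (j + 1))"
    using q by (simp flip: power_int_add)
  show ?thesis
  proof (cases "j \<ge> 0")
    case True
    then have "hecke_tail q j - hecke_tail q (j + 1) = s j" using d[of "j + 1" j] by simp
    then show ?thesis unfolding e s_def f[symmetric] by simp
  next
    case False
    then have "hecke_tail q (j + 1) - hecke_tail q j = s (- j - 1)" using d[of j "j + 1"] by simp
    then have "hecke_tail q j - hecke_tail q (j + 1) = - s (- j - 1)" by (simp add: algebra_simps)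
    moreover have "tri (- j - 1 + 1) = tri (j + 1)" by (simp add: tri_uminus tri_Suc)
    moreover have "msgn (- j - 1) = - msgn j" by (auto simp: msgn_def)
    ultimately show ?thesis unfolding e s_def f[symmetric] by simp
  qed
qed

text \<open>
  The inner sum has 2 r + 1 terms of size at most |q|^(- tri (r + 1)).
\<close>

lemma rho_alpha_summable:
  assumes q: "norm q < 1" "q \<noteq> 0" shows "rho_alpha q summable_on UNIV"
proof (rule summable_on_int)
  have *: "(\<lambda>n. of_nat (2 * n + 1) * of_real (norm q powi tri (int n + 1)) :: complex) summable_on UNIV"
  proof (rule summable_on_nat_ratio[where r = "\<lambda>n. 3 * norm q ^ (n + 1)" and c = 0])
    fix n
    have t: "norm q powi tri (int (Suc n) + 1) = norm q ^ (n + 1) * norm q powi tri (int n + 1)"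
      using q tri_Suc[of "int n + 1"] power_int_of_nat[of "norm q" "n + 1"] by (simp add: power_int_add algebra_simps del: power_int_of_nat)
    have ineq: "real (2 * Suc n + 1) * (norm q ^ (n + 1) * norm q powi tri (int n + 1))
        \<le> (3 * real (2 * n + 1)) * (norm q ^ (n + 1) * norm q powi tri (int n + 1))" by (rule mult_right_mono) auto
    show "norm (of_nat (2 * Suc n + 1) * of_real (norm q powi tri (int (Suc n) + 1)) :: complex)
      \<le> 3 * norm q ^ (n + 1) * norm (of_nat (2 * n + 1) * of_real (norm q powi tri (int n + 1)) :: complex)"
    proof -
      have n1: "norm (of_nat k * of_real X :: complex) = real k * X" if "X \<ge> 0" for k X using that by (simp add: norm_mult)
      have T: "norm q powi m \<ge> 0" for m by simp
      have T2: "norm q ^ (n + 1) * norm q powi m \<ge> 0" for m by simp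
      show ?thesis unfolding n1[OF T] t n1[OF T2] using ineq by (simp only: mult_ac)
    qed
    have "(\<lambda>n. norm q ^ n) \<longlonglongrightarrow> 0" using q by (intro LIMSEQ_power_zero) simp
    then have "(\<lambda>n. norm q ^ (n + 1)) \<longlonglongrightarrow> 0" by (rule LIMSEQ_ignore_initial_segment)
    then show "(\<lambda>n. 3 * norm q ^ (n + 1)) \<longlonglongrightarrow> 0" by (rule tendsto_mult_right_zero)
  qed simp
  have b: "norm (rho_alpha q (int n)) \<le> norm (of_nat (2 * n + 1) * of_real (norm q powi tri (int n + 1)) :: complex)" for n
  proof -
    let ?r = "int n"
    have "norm (\<Sum>j\<in>{-?r..?r}. q powi (- tri (j + 1))) \<le> of_nat (card {-?r..?r}) * norm q powi (- tri (?r + 1))"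
      by (rule sum_norm_bound) (use q tri_le[of _ ?r] in \<open>auto simp: norm_power_int intro!: power_int_decreasing\<close>)
    also have "card {-?r..?r} = 2 * n + 1" by simp
    finally have "norm (rho_alpha q ?r) \<le> norm q powi (2 * tri (?r + 1)) * (of_nat (2 * n + 1) * norm q powi (- tri (?r + 1)))"
      unfolding rho_alpha_def norm_mult by (simp add: norm_power_int mult_left_mono)
    also have "\<dots> = of_nat (2 * n + 1) * (norm q powi (2 * tri (?r + 1)) * norm q powi (- tri (?r + 1)))" by simp
    also have "norm q powi (2 * tri (?r + 1)) * norm q powi (- tri (?r + 1)) = norm q powi tri (?r + 1)"
      using q by (simp flip: power_int_add)
    finally have *: "norm (rho_alpha q ?r) \<le> real (2 * n + 1) * norm q powi tri (?r + 1)" .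
    have "norm (of_nat k * of_real X :: complex) = real k * X" if "X \<ge> 0" for k X using that by (simp add: norm_mult)
    from this[of "norm q powi tri (?r + 1)" "2 * n + 1"] * show ?thesis by (simp only: zero_le_power_int norm_ge_zero)
  qed
  show "(\<lambda>n. rho_alpha q (int n)) summable_on UNIV"
    using Infinite_Sum.abs_summable_on_comparison_test'[OF *[unfolded summable_on_iff_abs_summable_on_complex], of "\<lambda>n. rho_alpha q (int n)"] b
    by (simp add: summable_on_iff_abs_summable_on_complex)
  have "rho_alpha q (- int n) = (if n = 0 then rho_alpha q 0 else 0)" for n by simp
  moreover have "(\<lambda>n. if n = 0 then rho_alpha q 0 else 0) summable_on (UNIV :: nat set)"
    by (rule finite_nonzero_values_imp_summable_on) simp
  ultimately show "(\<lambda>n. rho_alpha q (- int n)) summable_on UNIV" by simp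
qed

text \<open>
  Bailey's lemma with e = 1 and y = - q, followed by an exchange of the two summations.
\<close>

theorem rho_hecke:
  assumes q: "norm q < 1" "q \<noteq> 0"
  shows "hecke_col q summable_on UNIV" "rho6 q = qinf (- q) q / qinf q q * (\<Sum>\<^sub>\<infinity>j. hecke_col q j)"
proof -
  have hs: "(\<lambda>(r, j). hecke_term q (r, j)) summable_on UNIV \<times> UNIV" using hecke_summable[OF q] by (simp add: case_prod_unfold)
  have hs': "(\<lambda>(j, r). hecke_term q (r, j)) summable_on UNIV \<times> UNIV"
    using hecke_summable[OF q] summable_on_swap[of "hecke_term q" UNIV UNIV] by simp
  show "hecke_col q summable_on UNIV" using summable_on_Sigma_banach[OF hs'] unfolding hecke_cols by simp
  have d: "bailey_delta q (q ^ (1 + 1)) (- q) n = q ^ (Suc n choose 2) * qpoch (- q) q n" for n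
  proof (induction n)
    case (Suc n)
    have e: "Suc (Suc n) choose 2 = (Suc n choose 2) + (n + 1)" by (simp add: numeral_2_eq_2)
    have "q ^ (1 + 1) * q ^ (2 * n) - - q * q ^ n = q ^ (n + 1) * (1 - q ^ n * - q)"
    proof -
      have "q ^ (2 * n) = q ^ n * q ^ n" by (simp add: mult_2 power_add)
      then show ?thesis by (simp only:) (simp add: algebra_simps)
    qed
    then show ?case using Suc unfolding e bailey_delta_simps qpoch_Suc power_add[of q "Suc n choose 2"] by simp
  qed (simp add: numeral_2_eq_2)
  have "(\<lambda>n. bailey_delta q (q ^ (1 + 1)) (- q) n * (1 / qpoch q (q\<^sup>2) (n + 1))) sums (\<Sum>\<^sub>\<infinity>r. rho_alpha q r * bailey_gamma_int q 1 (- q) r)"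
    by (rule bailey_sum[OF q(1) _ rho_alpha_summable[OF q] rho_pair[OF q]]) simp
  from this[unfolded d] have "rho6 q = (\<Sum>\<^sub>\<infinity>r. rho_alpha q r * bailey_gamma_int q 1 (- q) r)"
    unfolding rho6_def by (simp add: sums_iff)
  also have "\<dots> = (\<Sum>\<^sub>\<infinity>r. qinf (- q) q / qinf q q * (\<Sum>\<^sub>\<infinity>j. hecke_term q (r, j)))"
  proof (rule infsum_cong)
    fix r
    show "rho_alpha q r * bailey_gamma_int q 1 (- q) r = qinf (- q) q / qinf q q * (\<Sum>\<^sub>\<infinity>j. hecke_term q (r, j))"
    proof (cases "r \<ge> 0")
      case True
      define n where "n = nat r"
      have r: "r = int n" using True by (simp add: n_def)
      have "q ^ (Suc n choose 2) = q powi tri (r + 1)"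
      proof -
        have "int (Suc n choose 2) = tri (r + 1)" unfolding choose_two r tri_def by (simp add: zdiv_int algebra_simps)
        then show ?thesis by (metis power_int_of_nat)
      qed
      moreover have "bailey_gamma_int q 1 (- q) r = q ^ (Suc n choose 2) * (qpoch (- q) q n * qinf (- q * q ^ n) q) / qinf q q"
        using True d[of n] unfolding bailey_gamma_int_def bailey_gamma_def by (simp add: n_def)
      moreover have "qpoch (- q) q n * qinf (- q * q ^ n) q = qinf (- q) q" by (rule qinf_add[OF q(1), symmetric])
      ultimately show ?thesis unfolding hecke_rows[OF q(2)] by simp
    qed (simp add: hecke_rows[OF q(2)])
  qed
  also have "\<dots> = qinf (- q) q / qinf q q * (\<Sum>\<^sub>\<infinity>r. \<Sum>\<^sub>\<infinity>j. hecke_term q (r, j))" by (rule infsum_cmult_right')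
  also have "(\<Sum>\<^sub>\<infinity>r. \<Sum>\<^sub>\<infinity>j. hecke_term q (r, j)) = (\<Sum>\<^sub>\<infinity>j. \<Sum>\<^sub>\<infinity>r. hecke_term q (r, j))"
    by (rule infsum_swap_banach[OF hs])
  finally show "rho6 q = qinf (- q) q / qinf q q * (\<Sum>\<^sub>\<infinity>j. hecke_col q j)" unfolding hecke_cols .
qed

section \<open>From the double sum to an Appell series\<close>

text \<open>
  An Appell series of level four; the summand s has a simple pole at u = Q^(-s).
\<close>

definition appell :: "complex \<Rightarrow> complex \<Rightarrow> complex" where
  "appell u Q = (\<Sum>\<^sub>\<infinity>s. Q powi (2 * s * s) * u powi (4 * s) * (1 + u * Q powi s) / (1 - u * Q powi s))"

lemma jtheta_1: assumes "norm q < 1" "q \<noteq> 0" shows "jtheta 1 q = 0"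
  using jacobi_triple[OF assms, of 1] qinf_1[OF assms(1)] by simp

text \<open>
  The coefficients of jtheta (- u) q.
\<close>

definition ptheta_coeff :: "complex \<Rightarrow> int \<Rightarrow> complex" where "ptheta_coeff q k = q powi tri k"

lemma ptheta_coeff_msgn: "ptheta_coeff q k * (-1) powi k = theta_coeff q k" by (simp add: ptheta_coeff_def theta_coeff_def msgn_powi)
lemma ptheta_theta_coeff: "ptheta_coeff q k = theta_coeff q k * (-1) powi k" by (simp add: ptheta_coeff_def theta_coeff_def msgn_powi mult_ac)

text \<open>
  The right-hand side c_k of the equation (1 - q^k) h_k = c_k for the coefficients of the product of the
  double sum with a theta series.
\<close>

definition hecke_coeff :: "complex \<Rightarrow> int \<Rightarrow> complex" where
  "hecke_coeff q k = (\<Sum>\<^sub>\<infinity>j. msgn j * q powi (tri (k - j) + 2 * tri (j + 1)))"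

text \<open>
  The shift j \<mapsto> j + 2 s changes the exponent by an amount independent of j, so that only k modulo 6
  matters.
\<close>

lemma hecke_coeff_shift: "hecke_coeff q (6 * s + e) = q powi (12 * s * s + 4 * e * s) * hecke_coeff q e" if "q \<noteq> 0"
proof -
  have "hecke_coeff q (6 * s + e) = (\<Sum>\<^sub>\<infinity>j. msgn (j + 2 * s) * q powi (tri (6 * s + e - (j + 2 * s)) + 2 * tri (j + 2 * s + 1)))"
    unfolding hecke_coeff_def by (rule infsum_int_shift[symmetric])
  also have "\<dots> = (\<Sum>\<^sub>\<infinity>j. q powi (12 * s * s + 4 * e * s) * (msgn j * q powi (tri (e - j) + 2 * tri (j + 1))))"
  proof (rule infsum_cong)
    fix j
    have "2 * (tri (6 * s + e - (j + 2 * s)) + 2 * tri (j + 2 * s + 1)) = 2 * ((12 * s * s + 4 * e * s) + (tri (e - j) + 2 * tri (j + 1)))"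
      using tri_double[of "6 * s + e - (j + 2 * s)"] tri_double[of "j + 2 * s + 1"] tri_double[of "e - j"] tri_double[of "j + 1"]
      by (simp add: algebra_simps)
    then have e: "tri (6 * s + e - (j + 2 * s)) + 2 * tri (j + 2 * s + 1) = (12 * s * s + 4 * e * s) + (tri (e - j) + 2 * tri (j + 1))" by simp
    show "msgn (j + 2 * s) * q powi (tri (6 * s + e - (j + 2 * s)) + 2 * tri (j + 2 * s + 1))
       = q powi (12 * s * s + 4 * e * s) * (msgn j * q powi (tri (e - j) + 2 * tri (j + 1)))"
      unfolding e power_int_add[OF disjI1[OF that], of "12 * s * s + 4 * e * s"] by (simp add: msgn_add)
  qed
  finally show ?thesis unfolding infsum_cmult_right' hecke_coeff_def .
qed

lemma hecke_coeff_3: "hecke_coeff q 3 = 0"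
proof -
  let ?g = "\<lambda>j. msgn j * q powi (tri (3 - j) + 2 * tri (j + 1))"
  have "?g (1 - j) = - ?g j" for j
  proof -
    have "2 * (tri (3 - (1 - j)) + 2 * tri (1 - j + 1)) = 2 * (tri (3 - j) + 2 * tri (j + 1))"
      using tri_double[of "3 - (1 - j)"] tri_double[of "1 - j + 1"] tri_double[of "3 - j"] tri_double[of "j + 1"] by (simp add: algebra_simps)
    then have e: "tri (3 - (1 - j)) + 2 * tri (1 - j + 1) = tri (3 - j) + 2 * tri (j + 1)" by simp
    show ?thesis unfolding e by simp
  qed
  then show ?thesis unfolding hecke_coeff_def by (rule infsum_antisym)
qed

lemma hecke_coeff_minus_1: "hecke_coeff q (-1) = - hecke_coeff q 1"
proof -
  have "hecke_coeff q (-1) = (\<Sum>\<^sub>\<infinity>j. msgn (-1 - j) * q powi (tri (-1 - (-1 - j)) + 2 * tri (-1 - j + 1)))"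
    unfolding hecke_coeff_def by (rule infsum_int_reflect[symmetric])
  also have "\<dots> = (\<Sum>\<^sub>\<infinity>j. - (msgn j * q powi (tri (1 - j) + 2 * tri (j + 1))))"
  proof (rule infsum_cong)
    fix j
    have "2 * (tri (-1 - (-1 - j)) + 2 * tri (-1 - j + 1)) = 2 * (tri (1 - j) + 2 * tri (j + 1))"
      using tri_double[of "-1 - (-1 - j)"] tri_double[of "-1 - j + 1"] tri_double[of "1 - j"] tri_double[of "j + 1"] by (simp add: algebra_simps)
    then have e: "tri (-1 - (-1 - j)) + 2 * tri (-1 - j + 1) = tri (1 - j) + 2 * tri (j + 1)" by simp
    have "msgn (-1 - j) = - msgn j" by (auto simp: msgn_def)
    then show "msgn (-1 - j) * q powi (tri (-1 - (-1 - j)) + 2 * tri (-1 - j + 1)) = - (msgn j * q powi (tri (1 - j) + 2 * tri (j + 1)))"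
      unfolding e by simp
  qed
  finally show ?thesis unfolding infsum_uminus hecke_coeff_def .
qed

text \<open>
  Euler's pentagonal number theorem, by the triple product in base q^3.
\<close>

lemma hecke_coeff_1:
  assumes q: "norm q < 1" "q \<noteq> 0" shows "hecke_coeff q 1 = qinf q q"
proof -
  have q3: "norm (q ^ 3) < 1" "q ^ 3 \<noteq> 0" using norm_lt_1_power[OF q(1), of 3] q by auto
  have "hecke_coeff q 1 = (\<Sum>\<^sub>\<infinity>j. msgn (0 - j) * q powi (tri (1 - (0 - j)) + 2 * tri (0 - j + 1)))"
    unfolding hecke_coeff_def by (rule infsum_int_reflect[symmetric])
  also have "\<dots> = jtheta q (q ^ 3)" unfolding jtheta_def laurent_def
  proof (rule infsum_cong)
    fix j
    have "2 * (tri (1 - (0 - j)) + 2 * tri (0 - j + 1)) = 2 * (3 * tri j + j)"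
      using tri_double[of "1 - (0 - j)"] tri_double[of "0 - j + 1"] tri_double[of "j"] by (simp add: algebra_simps)
    then have e: "tri (1 - (0 - j)) + 2 * tri (0 - j + 1) = 3 * tri j + j" by simp
    show "msgn (0 - j) * q powi (tri (1 - (0 - j)) + 2 * tri (0 - j + 1)) = theta_coeff (q ^ 3) j * q powi j"
      unfolding e theta_coeff_def power_int_add[OF disjI1[OF q(2)]] by (simp add: power_int_power)
  qed
  also have "\<dots> = qinf q (q ^ 3) * qinf (q ^ 3 / q) (q ^ 3) * qinf (q ^ 3) (q ^ 3)" by (rule jacobi_triple[OF q3 q(2)])
  also have "q ^ 3 / q = q * q" using q by (simp add: power3_eq_cube)
  also have "qinf q (q ^ 3) * qinf (q * q) (q ^ 3) * qinf (q ^ 3) (q ^ 3) = qinf q q"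
    using qinf_split3[OF q(1), of q] by (simp add: power2_eq_square power3_eq_cube mult.assoc)
  finally show ?thesis .
qed

text \<open>
  Let h be the convolution of ptheta_coeff and hecke_col, so that its sum is the left-hand side.  By
  hecke_col_rec, (1 - q^k) h_k = c_k, which determines every h_k except h_0.  This gap is harmless: the
  alternating sum of h vanishes because jtheta 1 q = 0, so the sum of h is twice its sum over odd k.
  Among these, k = 3 modulo 6 contributes nothing, and k = 6 s + 1 and k = - 6 s - 1 together give the
  summand s of the Appell series.
\<close>

theorem hecke_to_appell:
  assumes q: "norm q < 1" "q \<noteq> 0"
  shows "jtheta (-1) q * (\<Sum>\<^sub>\<infinity>j. hecke_col q j) = 2 * qinf q q * appell q (q ^ 6)"
proof -
  have H: "hecke_col q summable_on UNIV" by (rule rho_hecke(1)[OF q])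
  have T: "ptheta_coeff q summable_on UNIV" using entireD[OF theta_coeff_summable[OF q], of "-1"] by (simp add: ptheta_theta_coeff[symmetric])
  define h where "h = conv (ptheta_coeff q) (hecke_col q)"
  have hs: "(h has_sum (jtheta (-1) q * (\<Sum>\<^sub>\<infinity>j. hecke_col q j))) UNIV"
    using conv_has_sum[OF T H] unfolding h_def jtheta_def laurent_def ptheta_theta_coeff[symmetric] .
  have hs': "((\<lambda>k. h k * msgn k) has_sum 0) UNIV"
  proof -
    have a: "(\<lambda>k. ptheta_coeff q k * (-1) powi k) summable_on UNIV"
      unfolding ptheta_coeff_msgn using entireD[OF theta_coeff_summable[OF q], of 1] by simp
    have b: "(\<lambda>k. hecke_col q k * (-1) powi k) summable_on UNIV"
      by (rule summable_mult_bounded[OF H, of _ 1]) (simp add: msgn_powi)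
    have "laurent (ptheta_coeff q) (-1) = jtheta 1 q" unfolding laurent_def ptheta_coeff_msgn jtheta_def by simp
    then have "laurent (conv (ptheta_coeff q) (hecke_col q)) (-1) = 0"
      using laurent_conv(2)[OF _ a b] jtheta_1[OF q] by simp
    moreover have "(\<lambda>k. conv (ptheta_coeff q) (hecke_col q) k * (-1) powi k) summable_on UNIV" using laurent_conv(1)[OF _ a b] by simp
    ultimately show ?thesis unfolding laurent_def h_def msgn_powi has_sum_iff by simp
  qed
  have eqn: "(1 - q powi k) * h k = hecke_coeff q k" for k
  proof -
    let ?f = "\<lambda>j. ptheta_coeff q (k - j) * hecke_col q j" and ?g = "\<lambda>j. ptheta_coeff q (k - j) * (q powi (j + 1) * hecke_col q (j + 1))"
    have tb: "norm (ptheta_coeff q m) \<le> 1" for m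
      using q tri_nonneg[of m] by (simp add: ptheta_coeff_def norm_power_int power_int_le_one)
    have fs: "?f summable_on UNIV"
      using summable_mult_bounded[OF H, of "\<lambda>j. ptheta_coeff q (k - j)" 1] tb by (simp add: mult.commute)
    have gf: "?g j = q powi k * ?f (j + 1)" for j
    proof -
      have "tri (k - j) + (j + 1) = k + tri (k - (j + 1))" using tri_Suc[of "k - (j + 1)"] by simp
      then have "ptheta_coeff q (k - j) * q powi (j + 1) = q powi k * ptheta_coeff q (k - (j + 1))"
        unfolding ptheta_coeff_def using q by (metis power_int_add)
      then show ?thesis by (metis mult.assoc)
    qed
    have gs: "?g summable_on UNIV" unfolding gf by (intro summable_on_cmult_right) (rule summable_on_int_shift[THEN iffD2, OF fs])
    have "q powi k * h k = (\<Sum>\<^sub>\<infinity>j. ?g j)"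
      unfolding gf infsum_cmult_right' infsum_int_shift[of ?f 1] h_def conv_def ..
    then have "(1 - q powi k) * h k = 1 * (\<Sum>\<^sub>\<infinity>j. ?f j) + (-1) * (\<Sum>\<^sub>\<infinity>j. ?g j)"
      by (simp add: h_def conv_def left_diff_distrib)
    also have "\<dots> = (\<Sum>\<^sub>\<infinity>j. 1 * ?f j + (-1) * ?g j)" by (rule infsum_lincomb[OF fs gs, symmetric])
    also have "\<dots> = hecke_coeff q k" unfolding hecke_coeff_def
    proof (rule infsum_cong)
      fix j
      have "1 * ?f j + (-1) * ?g j = ptheta_coeff q (k - j) * (hecke_col q j - q powi (j + 1) * hecke_col q (j + 1))" by (simp add: right_diff_distrib)
      also have "\<dots> = msgn j * q powi (tri (k - j) + 2 * tri (j + 1))"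
        unfolding hecke_col_rec[OF q] ptheta_coeff_def using q by (simp add: power_int_add)
      finally show "1 * ?f j + (-1) * ?g j = msgn j * q powi (tri (k - j) + 2 * tri (j + 1))" .
    qed
    finally show ?thesis .
  qed
  define w where "w = (\<lambda>k. h k - h k * msgn k)"
  have ws: "(w has_sum (jtheta (-1) q * (\<Sum>\<^sub>\<infinity>j. hecke_col q j))) UNIV"
    using has_sum_add[OF hs has_sum_uminusI[OF hs']] unfolding w_def by simp
  have w_even: "w k = 0" if "even k" for k using that by (simp add: w_def msgn_def)
  have nz: "1 - q powi k \<noteq> 0" if "k \<noteq> 0" for k using powi_ne[OF q, of 1 k] that by simp
  have w_odd: "w k = 2 * hecke_coeff q k / (1 - q powi k)" if "odd k" for k
  proof -
    have "k \<noteq> 0" using that by auto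
    then have "h k = hecke_coeff q k / (1 - q powi k)" using nz[of k] by (simp flip: eqn[of k])
    then show ?thesis using that by (simp add: w_def msgn_def)
  qed
  define A where "A = range (\<lambda>s::int. 6 * s + 1)"
  define B where "B = range (\<lambda>s::int. - 6 * s - 1)"
  have AB: "A \<inter> B = {}" unfolding A_def B_def by (auto, presburger)
  have w0: "w k = 0" if "k \<notin> A \<union> B" for k
  proof (cases "even k")
    case False
    have "k mod 6 = 3"
    proof (rule ccontr)
      assume "k mod 6 \<noteq> 3"
      then have "k mod 6 = 1 \<or> k mod 6 = 5" using False by presburger
      then have "(\<exists>s. k = 6 * s + 1) \<or> (\<exists>s. k = - 6 * s - 1)" by presburger
      then show False using that unfolding A_def B_def by auto
    qed
    then obtain s where "k = 6 * s + 3" by (metis mult_div_mod_eq)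
    then have "hecke_coeff q k = 0" using hecke_coeff_shift[OF q(2), of s 3] hecke_coeff_3 by simp
    then show ?thesis using w_odd[OF False] by simp
  qed (rule w_even)
  have sA: "w summable_on A" "w summable_on B" using ws summable_on_subset_banach has_sum_imp_summable by blast+
  have "jtheta (-1) q * (\<Sum>\<^sub>\<infinity>j. hecke_col q j) = infsum w UNIV" using ws by (simp add: has_sum_iff)
  also have "\<dots> = infsum w (A \<union> B)" by (rule infsum_cong_neutral) (use w0 in auto)
  also have "\<dots> = infsum w A + infsum w B" by (rule infsum_Un_disjoint[OF sA AB])
  also have "infsum w A = (\<Sum>\<^sub>\<infinity>s. w (6 * s + 1))" unfolding A_def by (subst infsum_reindex) (auto simp: inj_def o_def)
  also have "infsum w B = (\<Sum>\<^sub>\<infinity>s. w (- 6 * s - 1))" unfolding B_def by (subst infsum_reindex) (auto simp: inj_def o_def)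
  also have "(\<Sum>\<^sub>\<infinity>s. w (6 * s + 1)) + (\<Sum>\<^sub>\<infinity>s. w (- 6 * s - 1)) = (\<Sum>\<^sub>\<infinity>s. w (6 * s + 1) + w (- 6 * s - 1))"
  proof (rule infsum_add[symmetric])
    show "(\<lambda>s. w (6 * s + 1)) summable_on UNIV"
      using sA(1) unfolding A_def by (subst (asm) summable_on_reindex) (auto simp: inj_def o_def)
    show "(\<lambda>s. w (- 6 * s - 1)) summable_on UNIV"
      using sA(2) unfolding B_def by (subst (asm) summable_on_reindex) (auto simp: inj_def o_def)
  qed
  also have "\<dots> = (\<Sum>\<^sub>\<infinity>s. 2 * qinf q q * ((q ^ 6) powi (2 * s * s) * q powi (4 * s) * (1 + q * (q ^ 6) powi s) / (1 - q * (q ^ 6) powi s)))"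
  proof (rule infsum_cong)
    fix s :: int
    define T where "T = q powi (6 * s + 1)"
    have "6 * s + 1 \<noteq> 0" by presburger
    then have T0: "T \<noteq> 0" "1 - T \<noteq> 0" unfolding T_def using q nz[of "6 * s + 1"] by auto
    define E where "E = q powi (12 * s * s + 4 * s)"
    have 1: "w (6 * s + 1) = 2 * (E * qinf q q) / (1 - T)"
      unfolding w_odd[of "6 * s + 1", simplified] hecke_coeff_shift[OF q(2), of s 1] hecke_coeff_1[OF q] T_def E_def by simp
    have e: "- 6 * s - 1 = 6 * (- s) + (-1)" by simp
    have "w (- 6 * s - 1) = 2 * hecke_coeff q (6 * (- s) + (-1)) / (1 - q powi (- (6 * s + 1)))"
      using w_odd[of "- 6 * s - 1"] by simp
    also have "\<dots> = 2 * (E * - qinf q q) / (1 - 1 / T)"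
      unfolding hecke_coeff_shift[OF q(2), of "- s" "-1"] hecke_coeff_minus_1 hecke_coeff_1[OF q] T_def E_def power_int_minus_divide by simp
    also have "\<dots> = 2 * (E * qinf q q) * T / (1 - T)"
    proof -
      have "1 - 1 / T = - ((1 - T) / T)" using T0 by (simp add: field_simps)
      then show ?thesis by simp
    qed
    finally have 2: "w (- 6 * s - 1) = 2 * (E * qinf q q) * T / (1 - T)" .
    have "q * (q ^ 6) powi s = T" unfolding T_def using q by (simp add: power_int_power power_int_add)
    moreover have "(q ^ 6) powi (2 * s * s) * q powi (4 * s) = E" unfolding E_def using q by (simp add: power_int_power power_int_add mult.assoc)
    ultimately show "w (6 * s + 1) + w (- 6 * s - 1) = 2 * qinf q q * ((q ^ 6) powi (2 * s * s) * q powi (4 * s) * (1 + q * (q ^ 6) powi s) / (1 - q * (q ^ 6) powi s))"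
      unfolding 1 2 by (simp add: distrib_left add_divide_distrib mult_ac)
  qed
  also have "\<dots> = 2 * qinf q q * appell q (q ^ 6)" unfolding infsum_cmult_right' appell_def ..
  finally show ?thesis .
qed

theorem rho_appell:
  assumes q: "norm q < 1" "q \<noteq> 0"
  shows "rho6 q = appell q (q ^ 6) / qinf (q\<^sup>2) (q\<^sup>2)"
proof -
  have nz: "qinf q q \<noteq> 0" "qinf (- q) q \<noteq> 0"
    using qinf_nonzero_norm[OF q(1), of q] qinf_nonzero_norm[OF q(1), of "- q"] q by auto
  have "qinf (-1) q = 2 * qinf (- q) q" using qinf_Suc[OF q(1), of "-1"] by simp
  then have "jtheta (-1) q = 2 * qinf (- q) q * qinf (- q) q * qinf q q"
    using jacobi_triple[OF q, of "-1"] by simp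
  then have "qinf (- q) q * qinf (- q) q * qinf q q * (\<Sum>\<^sub>\<infinity>j. hecke_col q j) = qinf q q * appell q (q ^ 6)"
    using hecke_to_appell[OF q] by (simp add: mult_ac)
  then have "(\<Sum>\<^sub>\<infinity>j. hecke_col q j) = appell q (q ^ 6) / (qinf (- q) q * qinf (- q) q)" using nz by (simp add: field_simps)
  then show ?thesis unfolding rho_hecke(2)[OF q] qinf_square[OF q(1)] using nz by simp
qed

section \<open>The derivative of theta at its zero\<close>

text \<open>
  |k| is at most (x^k + x^(-k)) / (x - 1) by Bernoulli's inequality.
\<close>

lemma summable_times_index:
  fixes a :: "int \<Rightarrow> complex" and x :: real
  assumes x: "x > 1" and a: "(\<lambda>k. a k * complex_of_real x powi k) summable_on UNIV"
    "(\<lambda>k. a k * complex_of_real (1 / x) powi k) summable_on UNIV"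
  shows "(\<lambda>k. of_int k * a k) summable_on UNIV"
proof -
  have nat: "real n * (x - 1) \<le> x ^ n" for n
    using Bernoulli_inequality[of "x - 1" n] x by simp
  have key: "\<bar>real_of_int k\<bar> * (x - 1) \<le> x powi k + (1 / x) powi k" for k
  proof (cases "k \<ge> 0")
    case True
    then obtain n where k: "k = int n" using nonneg_int_cases by blast
    have "(1 / x) powi k \<ge> 0" using x by simp
    then show ?thesis using nat[of n] unfolding k by simp
  next
    case False
    then obtain n where k: "k = - int n" by (metis int_cases2 nle_le of_nat_0_le_iff)
    have "x powi k \<ge> 0" using x by simp
    moreover have "(1 / x) powi k = x ^ n" unfolding k using x by (simp add: power_int_minus power_divide field_simps)
    ultimately show ?thesis using nat[of n] unfolding k by simp
  qed
  have "(\<lambda>k. norm (of_int k * a k)) summable_on UNIV"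
  proof (rule Infinite_Sum.abs_summable_on_comparison_test'[where g = "\<lambda>k. (norm (a k * complex_of_real x powi k) + norm (a k * complex_of_real (1/x) powi k)) * (1 / (x - 1))"])
    show "(\<lambda>k. (norm (a k * complex_of_real x powi k) + norm (a k * complex_of_real (1/x) powi k)) * (1 / (x - 1))) summable_on UNIV"
      using a by (intro summable_on_cmult_left summable_on_add) (simp_all flip: summable_on_iff_abs_summable_on_complex)
    fix k
    have "norm (of_int k * a k) * (x - 1) = norm (a k) * (\<bar>real_of_int k\<bar> * (x - 1))" by (simp add: norm_mult)
    also have "\<dots> \<le> norm (a k) * (x powi k + (1 / x) powi k)" by (rule mult_left_mono[OF key]) simp
    also have "\<dots> = norm (a k * complex_of_real x powi k) + norm (a k * complex_of_real (1/x) powi k)"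
      using x by (simp add: norm_mult norm_power_int distrib_left norm_divide)
    finally show "norm (of_int k * a k) \<le> (norm (a k * complex_of_real x powi k) + norm (a k * complex_of_real (1/x) powi k)) * (1 / (x - 1))"
      using x by (simp add: pos_le_divide_eq)
  qed
  then show ?thesis by (rule abs_summable_summable)
qed

lemma entire_times_index: "entire a \<Longrightarrow> (\<lambda>k. of_int k * a k) summable_on UNIV"
  by (rule summable_times_index[of 2]) (auto simp: entire_def)

text \<open>
  The derivative at z = 1 of the finite triple product, where the product side has a simple zero.
\<close>

lemma finite_jtheta_deriv:
  assumes q: "norm q < 1" "q \<noteq> 0"
  shows "(\<Sum>\<^sub>\<infinity>j. of_int j * theta_coeff q j * rec_qpoch q (int (n + 1) - j) * rec_qpoch q (int (n + 1) + j))
       = - (qpoch q q n * qpoch q q (n + 1) / qpoch q q (n + 1 + (n + 1)))"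
proof -
  define m where "m = n + 1"
  define c where "c = (\<lambda>j. theta_coeff q j * rec_qpoch q (int m - j) * rec_qpoch q (int m + j))"
  define S where "S = {- int m..int m}"
  have c0: "c j = 0" if "j \<notin> S" for j using that by (auto simp: c_def S_def)
  have qb: "finite_jtheta q z m m = (\<Sum>j\<in>S. c j * z powi j)" for z
  proof -
    have "finite_jtheta q z m m = (\<Sum>\<^sub>\<infinity>j\<in>S. c j * z powi j)"
      unfolding finite_jtheta_def by (rule infsum_cong_neutral) (use c0 in \<open>auto simp: c_def mult_ac\<close>)
    then show ?thesis by (simp add: S_def)
  qed
  have L: "((\<lambda>z. \<Sum>j\<in>S. c j * z powi j) has_field_derivative (\<Sum>j\<in>S. c j * of_int j)) (at 1)"
  proof (rule DERIV_sum)
    fix j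
    have "((\<lambda>z. z powi j) has_field_derivative (of_int j)) (at (1::complex))"
      using has_derivative_power_int'[of "1::complex" j UNIV] unfolding has_field_derivative_def
      by (simp add: mult.commute[of _ "of_int j"] flip: fun_eq_iff)
    then show "((\<lambda>z. c j * z powi j) has_field_derivative c j * of_int j) (at 1)" by (rule DERIV_cmult)
  qed
  define R where "R = (\<lambda>z. qpoch (q * z) q n * qpoch (q / z) q m / qpoch q q (m + m))"
  have "isCont R 1" unfolding R_def qpoch_def using qpoch_self_nonzero[OF q(1), of "m + m", unfolded qpoch_def]
    by (intro continuous_intros) auto
  then have D: "((\<lambda>z. (1 - z) * R z) has_field_derivative (- R 1)) (at 1)"
    unfolding CARAT_DERIV by (intro exI[of _ "\<lambda>z. - R z"]) (auto simp: algebra_simps intro!: continuous_intros)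
  have eq: "(\<Sum>j\<in>S. c j * z powi j) = (1 - z) * R z" if "z \<noteq> 0" for z
    unfolding qb[symmetric] finite_jacobi_triple[OF q that] by (simp add: R_def m_def qpoch_Suc')
  have "((\<lambda>z. \<Sum>j\<in>S. c j * z powi j) has_field_derivative (- R 1)) (at 1)"
    by (rule has_field_derivative_transform_within_open[OF D, of "- {0}"]) (auto simp: eq)
  then have "(\<Sum>j\<in>S. c j * of_int j) = - R 1" using DERIV_unique[OF L] by simp
  moreover have "(\<Sum>\<^sub>\<infinity>j. of_int j * theta_coeff q j * rec_qpoch q (int m - j) * rec_qpoch q (int m + j)) = (\<Sum>\<^sub>\<infinity>j\<in>S. c j * of_int j)"
    by (rule infsum_cong_neutral) (auto simp: c_def S_def)
  ultimately show ?thesis unfolding R_def m_def by (simp add: S_def)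
qed

text \<open>
  Jacobi's formula for the cube of the Euler product.  Differentiating the finite identity and passing to
  the limit avoids termwise differentiation of an infinite series.
\<close>

theorem sum_index_theta_coeff:
  assumes q: "norm q < 1" "q \<noteq> 0"
  shows "(\<Sum>\<^sub>\<infinity>j. of_int j * theta_coeff q j) = - ((qinf q q) ^ 3)"
proof -
  have b: "(\<lambda>j. of_int j * theta_coeff q j) summable_on UNIV" by (rule entire_times_index[OF theta_coeff_summable[OF q]])
  have nz: "qinf q q \<noteq> 0" by (rule qinf_self_nonzero[OF q(1)])
  have "(\<lambda>n. \<Sum>\<^sub>\<infinity>j. of_int j * theta_coeff q j * rec_qpoch q (int (n + 0) - j) * rec_qpoch q (int n + j)) \<longlonglongrightarrow> (\<Sum>\<^sub>\<infinity>j. of_int j * theta_coeff q j) / (qinf q q)\<^sup>2"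
    by (rule finite_jtheta_limit[OF q b])
  then have "(\<lambda>n. \<Sum>\<^sub>\<infinity>j. of_int j * theta_coeff q j * rec_qpoch q (int (n + 1 + 0) - j) * rec_qpoch q (int (n + 1) + j)) \<longlonglongrightarrow> (\<Sum>\<^sub>\<infinity>j. of_int j * theta_coeff q j) / (qinf q q)\<^sup>2"
    by (rule LIMSEQ_ignore_initial_segment)
  then have 1: "(\<lambda>n. - (qpoch q q n * qpoch q q (n + 1) / qpoch q q (n + 1 + (n + 1)))) \<longlonglongrightarrow> (\<Sum>\<^sub>\<infinity>j. of_int j * theta_coeff q j) / (qinf q q)\<^sup>2"
    unfolding add_0_right finite_jtheta_deriv[OF q] .
  have "filterlim (\<lambda>n::nat. n + 1 + (n + 1)) sequentially sequentially"
    by (rule filterlim_subseq) (auto simp: strict_mono_def)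
  then have "(\<lambda>n. qpoch q q (n + 1 + (n + 1))) \<longlonglongrightarrow> qinf q q" by (rule filterlim_compose[OF qpoch_LIMSEQ[OF q(1)]])
  then have "(\<lambda>n. - (qpoch q q n * qpoch q q (n + 1) / qpoch q q (n + 1 + (n + 1)))) \<longlonglongrightarrow> - (qinf q q * qinf q q / qinf q q)"
    using nz by (intro tendsto_minus tendsto_divide tendsto_mult qpoch_LIMSEQ[OF q(1)] LIMSEQ_ignore_initial_segment[OF qpoch_LIMSEQ[OF q(1)]])
  then have "(\<Sum>\<^sub>\<infinity>j. of_int j * theta_coeff q j) / (qinf q q)\<^sup>2 = - (qinf q q * qinf q q / qinf q q)" using 1 LIMSEQ_unique by blast
  then show ?thesis using nz by (simp add: field_simps power2_eq_square power3_eq_cube)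
qed

section \<open>Laurent coefficients of the Appell series\<close>

text \<open>
  Power series coefficients of the part s \<ge> 1 of the Appell series.  The recursion is the functional
  equation appell_half_step read off at u^n.
\<close>

fun appell_half_coeff :: "complex \<Rightarrow> nat \<Rightarrow> complex" where
  "appell_half_coeff Q n = (if n < 4 then 0 else Q ^ (n - 2) * (appell_half_coeff Q (n - 4) + (if n = 4 then 1 else 2)))"

declare appell_half_coeff.simps [simp del]

text \<open>
  The coefficients of (1 + u) / (1 - u).
\<close>

definition eps :: "nat \<Rightarrow> complex" where "eps n = (if n = 0 then 1 else 2)"

lemma appell_half_coeff_small: "n < 4 \<Longrightarrow> appell_half_coeff Q n = 0" by (subst appell_half_coeff.simps) simp
lemma appell_half_coeff_step: "appell_half_coeff Q (n + 4) = Q ^ (n + 2) * (appell_half_coeff Q n + eps n)"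
  by (subst appell_half_coeff.simps) (simp add: eps_def)

text \<open>
  The decay like Q^n, obtained by feeding the constant bound into the recursion once more, gives
  convergence for |u| < 1/|Q|.
\<close>

lemma appell_half_coeff_bound:
  assumes Q: "norm Q < 1"
  obtains B where "B \<ge> 0" "\<And>n. norm (appell_half_coeff Q n) \<le> B * norm Q ^ n" "\<And>n. norm (appell_half_coeff Q n) \<le> B"
proof (cases "Q = 0")
  case True
  have "appell_half_coeff Q n = 0" for n by (subst appell_half_coeff.simps) (simp add: True)
  then show thesis using that[of 0] by simp
next
  case False
  define x where "x = norm Q"
  have x: "0 < x" "x < 1" using Q False by (auto simp: x_def)
  define B where "B = 2 / (1 - x)"
  have B: "B \<ge> 0" "x * (B + 2) \<le> B"
  proof -
    show "B \<ge> 0" using x by (simp add: B_def)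
    have "B * (1 - x) = 2" using x nonzero_eq_divide_eq[of "1 - x" B 2] B_def by simp
    then show "x * (B + 2) \<le> B" using x by (simp add: algebra_simps)
  qed
  have bd: "norm (appell_half_coeff Q n) \<le> B" for n
  proof (induction n rule: less_induct)
    case (less n)
    show ?case
    proof (cases "n < 4")
      case False
      then obtain k where k: "n = k + 4" by (metis add.commute le_Suc_ex not_less)
      have "norm (appell_half_coeff Q k + eps k) \<le> B + 2"
        using less[of k] k norm_triangle_ineq[of "appell_half_coeff Q k" "eps k"] by (auto simp: eps_def split: if_splits)
      then have "norm (appell_half_coeff Q n) \<le> x ^ (k + 2) * (B + 2)" unfolding k appell_half_coeff_step norm_mult norm_power x_def
        by (intro mult_left_mono) auto
      also have "\<dots> \<le> x ^ 1 * (B + 2)" using x B by (intro mult_right_mono power_decreasing) auto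
      finally show ?thesis using B by simp
    qed (simp add: appell_half_coeff_small B)
  qed
  have "norm (appell_half_coeff Q n) \<le> ((B + 2) / x ^ 2) * x ^ n" for n
  proof (cases "n < 4")
    case False
    then obtain k where k: "n = k + 4" by (metis add.commute le_Suc_ex not_less)
    have "norm (appell_half_coeff Q k + eps k) \<le> B + 2"
      using bd[of k] norm_triangle_ineq[of "appell_half_coeff Q k" "eps k"] by (auto simp: eps_def split: if_splits)
    then have "norm (appell_half_coeff Q n) \<le> x ^ (k + 2) * (B + 2)" unfolding k appell_half_coeff_step norm_mult norm_power x_def
      by (intro mult_left_mono) auto
    also have "x ^ (k + 2) = x ^ n / x ^ 2" unfolding k using x by (simp add: power_add field_simps power2_eq_square numeral_eq_Suc)
    finally show ?thesis by (simp add: mult.commute)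
  qed (use x B in \<open>simp add: appell_half_coeff_small\<close>)
  moreover have "(B + 2) / x ^ 2 \<ge> B"
  proof -
    have "B * x ^ 2 \<le> B * 1" using x B by (intro mult_left_mono) (auto simp: power_le_one)
    then show ?thesis using x B by (simp add: pos_le_divide_eq)
  qed
  ultimately show thesis using that[of "(B + 2) / x ^ 2"] bd B x unfolding x_def by (smt (verit) divide_nonneg_nonneg zero_le_power)
qed

definition appell_half :: "complex \<Rightarrow> complex \<Rightarrow> complex" where "appell_half Q u = (\<Sum>n. appell_half_coeff Q n * u ^ n)"

lemma appell_half_summable: assumes Q: "norm Q < 1" and u: "norm (u * Q) < 1" shows "summable (\<lambda>n. norm (appell_half_coeff Q n * u ^ n))"
proof -
  obtain B where B: "B \<ge> 0" "\<And>n. norm (appell_half_coeff Q n) \<le> B * norm Q ^ n" using appell_half_coeff_bound[OF Q] by metis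
  show ?thesis
  proof (rule summable_comparison_test'[where g = "\<lambda>n. B * norm (u * Q) ^ n" and N = 0])
    show "summable (\<lambda>n. B * norm (u * Q) ^ n)" using u by (intro summable_mult summable_geometric) simp
    show "norm (norm (appell_half_coeff Q n * u ^ n)) \<le> B * norm (u * Q) ^ n" for n
      using mult_right_mono[OF B(2)[of n], of "norm u ^ n"] by (simp add: norm_mult norm_power power_mult_distrib mult_ac)
  qed
qed

lemma appell_half_step:
  assumes Q: "norm Q < 1" and u: "norm (u * Q) < 1"
  shows "appell_half Q u = Q\<^sup>2 * u ^ 4 * ((1 + u * Q) / (1 - u * Q) + appell_half Q (u * Q))"
proof -
  have s: "summable (\<lambda>n. appell_half_coeff Q n * u ^ n)" using appell_half_summable[OF assms] by (rule summable_norm_cancel)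
  have uQ: "norm ((u * Q) * Q) < 1"
  proof -
    have "norm (u * Q) * norm Q \<le> norm (u * Q) * 1" using Q by (intro mult_left_mono) auto
    then show ?thesis using u by (simp only: norm_mult mult_1_right)
  qed
  have s': "summable (\<lambda>n. appell_half_coeff Q n * (u * Q) ^ n)" using appell_half_summable[OF Q uQ] by (rule summable_norm_cancel)
  have g: "(\<lambda>n. eps n * (u * Q) ^ n) sums ((1 + u * Q) / (1 - u * Q))"
  proof -
    have "(\<lambda>n. 2 * (u * Q) ^ n - (if n = 0 then 1 else 0)) sums (2 * (1 / (1 - u * Q)) - 1)"
      using sums_single[of 0 "\<lambda>_. 1::complex"] u by (intro sums_diff sums_mult geometric_sums) (auto simp: eq_commute[of 0])
    also have "(\<lambda>n. 2 * (u * Q) ^ n - (if n = 0 then 1 else 0)) = (\<lambda>n. eps n * (u * Q) ^ n)" by (auto simp: eps_def)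
    also have "2 * (1 / (1 - u * Q)) - 1 = (1 + u * Q) / (1 - u * Q)"
    proof -
      have "1 - u * Q \<noteq> 0" using u by auto
      then show ?thesis by (simp add: field_simps)
    qed
    finally show ?thesis .
  qed
  have "(\<Sum>n. appell_half_coeff Q n * u ^ n) = (\<Sum>n. appell_half_coeff Q (n + 4) * u ^ (n + 4))"
    using suminf_split_initial_segment[OF s, of 4] by (simp add: appell_half_coeff_small)
  also have "\<dots> = (\<Sum>n. Q\<^sup>2 * u ^ 4 * (eps n * (u * Q) ^ n + appell_half_coeff Q n * (u * Q) ^ n))"
    unfolding appell_half_coeff_step by (rule suminf_cong) (simp add: power_add power_mult_distrib algebra_simps power2_eq_square)
  also have "\<dots> = Q\<^sup>2 * u ^ 4 * (\<Sum>n. eps n * (u * Q) ^ n + appell_half_coeff Q n * (u * Q) ^ n)"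
    using g s' by (intro suminf_mult summable_add) (auto simp: sums_iff)
  also have "(\<Sum>n. eps n * (u * Q) ^ n + appell_half_coeff Q n * (u * Q) ^ n) = (1 + u * Q) / (1 - u * Q) + appell_half Q (u * Q)"
    unfolding appell_half_def using g s' by (subst suminf_add[symmetric]) (auto simp: sums_iff)
  finally show ?thesis unfolding appell_half_def .
qed

definition appell_term :: "complex \<Rightarrow> complex \<Rightarrow> int \<Rightarrow> complex" where
  "appell_term Q u s = Q powi (2 * s * s) * u powi (4 * s) * (1 + u * Q powi s) / (1 - u * Q powi s)"

lemma appell_term_neg: assumes "Q \<noteq> 0" "u \<noteq> 0" "1 - u * Q powi (- s) \<noteq> 0" shows "appell_term Q u (- s) = - appell_term Q (1 / u) s"
proof -
  define w where "w = Q powi s / u"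
  have w: "w \<noteq> 0" "u * Q powi (- s) = 1 / w" "1 / u * Q powi s = w" using assms by (auto simp: w_def power_int_minus field_simps)
  have "1 - 1 / w \<noteq> 0" using assms(3) unfolding w(2) .
  then have "w \<noteq> 1" using w(1) by auto
  have e: "u powi (4 * - s) = (1 / u) powi (4 * s)" using assms by (simp add: power_int_minus power_int_one_over inverse_eq_divide)
  have "(1 + 1 / w) / (1 - 1 / w) = - ((1 + w) / (1 - w))" using w(1) \<open>w \<noteq> 1\<close> by (simp add: divide_simps) (simp add: algebra_simps)
  then show ?thesis unfolding appell_term_def w e by (simp flip: times_divide_eq_right)
qed

text \<open>
  Iterating appell_half_step splits off the terms s = 1, 2, ... one by one; the remaining factor P N
  decays like Q^(2 N^2).
\<close>

lemma appell_term_sums: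
  assumes Q: "norm Q < 1" "Q \<noteq> 0" and u: "norm (u * Q) < 1"
  shows "(\<lambda>n. appell_term Q u (int n + 1)) sums appell_half Q u" "(\<lambda>n. appell_term Q u (int n + 1)) summable_on UNIV"
proof -
  have kt: "appell_term Q u (int n) = Q ^ (2 * n * n) * u ^ (4 * n) * (1 + u * Q ^ n) / (1 - u * Q ^ n)" for n
  proof -
    have "2 * int n * int n = int (2 * n * n)" "4 * int n = int (4 * n)" by simp_all
    then show ?thesis unfolding appell_term_def by (simp only: power_int_of_nat)
  qed
  have nz: "1 - u * Q ^ Suc n \<noteq> 0" and uQ: "norm (u * Q ^ n * Q) < 1" for n
  proof -
    have "norm (u * Q) * norm Q ^ n \<le> norm (u * Q) * 1" using Q by (intro mult_left_mono) (auto simp: power_le_one)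
    then show uQ: "norm (u * Q ^ n * Q) < 1" using u by (simp add: norm_mult norm_power mult_ac)
    then show "1 - u * Q ^ Suc n \<noteq> 0" by (auto simp: mult_ac)
  qed
  obtain B where B: "B \<ge> 0" "\<And>n. norm (appell_half_coeff Q n) \<le> B" using appell_half_coeff_bound[OF Q(1)] by metis
  define P where "P = (\<lambda>n. Q ^ (2 * n * n) * u ^ (4 * n))"
  have step: "P n * appell_half Q (u * Q ^ n) = appell_term Q u (int n + 1) + P (Suc n) * appell_half Q (u * Q ^ Suc n)" for n
  proof -
    have P: "P (Suc n) = P n * (Q\<^sup>2 * (u * Q ^ n) ^ 4)"
    proof -
      have "2 * Suc n * Suc n = 2 * n * n + (2 + n * 4)" "4 * Suc n = 4 * n + 4" by simp_all
      then show ?thesis unfolding P_def by (simp only: power_add power_mult power_mult_distrib mult_ac)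
    qed
    have "appell_term Q u (int n + 1) = P (Suc n) * ((1 + u * Q ^ n * Q) / (1 - u * Q ^ n * Q))"
      using kt[of "Suc n", unfolded of_nat_Suc add.commute[of 1]] by (simp add: P_def mult_ac)
    then show ?thesis unfolding appell_half_step[OF Q(1) uQ[of n]] P by (simp add: algebra_simps)
  qed
  have part: "appell_half Q u = (\<Sum>n<N. appell_term Q u (int n + 1)) + P N * appell_half Q (u * Q ^ N)" for N
  proof (induction N)
    case (Suc N)
    then show ?case unfolding step[of N] by (simp add: add.assoc)
  qed (simp add: P_def)
  have Ps: "summable (\<lambda>n. norm (P n))"
  proof -
    have "(\<lambda>n. P n) summable_on UNIV"
    proof (rule summable_on_nat_ratio[where r = "\<lambda>n. norm (Q\<^sup>2 * (u * Q ^ n) ^ 4)" and c = 0])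
      show "norm (P (Suc n)) \<le> norm (Q\<^sup>2 * (u * Q ^ n) ^ 4) * norm (P n)" for n
      proof -
        have "2 * Suc n * Suc n = 2 * n * n + (2 + n * 4)" "4 * Suc n = 4 * n + 4" by simp_all
        then have "P (Suc n) = P n * (Q\<^sup>2 * (u * Q ^ n) ^ 4)" unfolding P_def by (simp only: power_add power_mult power_mult_distrib mult_ac)
        then show ?thesis by (simp add: norm_mult)
      qed
      have "(\<lambda>n. norm (Q\<^sup>2 * (u * Q ^ n) ^ 4)) \<longlonglongrightarrow> norm (Q\<^sup>2 * (u * 0) ^ 4)"
        by (intro tendsto_intros LIMSEQ_power_zero Q)
      then show "(\<lambda>n. norm (Q\<^sup>2 * (u * Q ^ n) ^ 4)) \<longlonglongrightarrow> 0" by simp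
    qed simp
    then show ?thesis by (metis summable_on_UNIV_nonneg_real_iff norm_ge_zero summable_on_iff_abs_summable_on_complex)
  qed
  have Plim: "P \<longlonglongrightarrow> 0" using Ps by (intro summable_LIMSEQ_zero) (rule summable_norm_cancel)
  have qn: "(\<lambda>n. u * Q ^ n) \<longlonglongrightarrow> 0" by (rule tendsto_mult_right_zero[OF LIMSEQ_power_zero[OF Q(1)]])
  have Afb: "norm (appell_half Q (u * Q ^ n)) \<le> (\<Sum>k. norm (appell_half_coeff Q k * u ^ k))" for n
    unfolding appell_half_def
  proof (rule norm_suminf_le)
    show "summable (\<lambda>k. norm (appell_half_coeff Q k * u ^ k))" by (rule appell_half_summable[OF Q(1) u])
    show "norm (appell_half_coeff Q k * (u * Q ^ n) ^ k) \<le> norm (appell_half_coeff Q k * u ^ k)" for k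
    proof -
      have "norm (Q ^ n) ^ k \<le> 1" using Q by (simp add: norm_power power_le_one)
      then show ?thesis by (simp add: norm_mult norm_power power_mult_distrib mult_left_le flip: mult.assoc)
    qed
  qed
  have "(\<lambda>N. P N * appell_half Q (u * Q ^ N)) \<longlonglongrightarrow> 0"
  proof (rule Lim_null_comparison)
    show "\<forall>\<^sub>F N in sequentially. norm (P N * appell_half Q (u * Q ^ N)) \<le> norm (P N) * (\<Sum>k. norm (appell_half_coeff Q k * u ^ k))"
      unfolding norm_mult[of "P _"] by (intro always_eventually allI mult_left_mono Afb norm_ge_zero)
    show "(\<lambda>N. norm (P N) * (\<Sum>k. norm (appell_half_coeff Q k * u ^ k))) \<longlonglongrightarrow> 0" by (rule tendsto_mult_left_zero[OF tendsto_norm_zero[OF Plim]])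
  qed
  then have "(\<lambda>N. appell_half Q u - P N * appell_half Q (u * Q ^ N)) \<longlonglongrightarrow> appell_half Q u - 0" by (intro tendsto_intros)
  also have "(\<lambda>N. appell_half Q u - P N * appell_half Q (u * Q ^ N)) = (\<lambda>N. \<Sum>n<N. appell_term Q u (int n + 1))" using part by (simp add: fun_eq_iff algebra_simps)
  finally show "(\<lambda>n. appell_term Q u (int n + 1)) sums appell_half Q u" by (simp add: sums_def)
  have "(\<lambda>n. P (Suc n) * ((1 + u * Q ^ Suc n) / (1 - u * Q ^ Suc n))) summable_on UNIV"
  proof -
    have "(\<lambda>n. (1 + u * Q ^ Suc n) / (1 - u * Q ^ Suc n)) \<longlonglongrightarrow> (1 + 0) / (1 - 0)"
      by (intro tendsto_intros LIMSEQ_Suc[OF qn]) simp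
    then have "Bseq (\<lambda>n. (1 + u * Q ^ Suc n) / (1 - u * Q ^ Suc n))" using convergentI convergent_imp_Bseq by blast
    then obtain D where D: "\<And>n. norm ((1 + u * Q ^ Suc n) / (1 - u * Q ^ Suc n)) \<le> D" unfolding Bseq_def by blast
    have "summable (\<lambda>n. norm (P (Suc n)))" using Ps by (subst summable_Suc_iff)
    then have "(\<lambda>n. P (Suc n)) summable_on UNIV" by (rule norm_summable_imp_summable_on)
    then show ?thesis by (rule summable_mult_bounded) (rule D)
  qed
  also have "(\<lambda>n. P (Suc n) * ((1 + u * Q ^ Suc n) / (1 - u * Q ^ Suc n))) = (\<lambda>n. appell_term Q u (int n + 1))"
    using kt[of "Suc _", unfolded of_nat_Suc add.commute[of 1]] by (simp add: P_def fun_eq_iff)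
  finally show "(\<lambda>n. appell_term Q u (int n + 1)) summable_on UNIV" .
qed

lemma has_sum_int_split:
  fixes f :: "int \<Rightarrow> complex"
  assumes "((\<lambda>n. f (int n + 1)) has_sum a) UNIV" "((\<lambda>n. f (- (int n + 1))) has_sum b) UNIV"
  shows "(f has_sum (f 0 + a + b)) UNIV"
proof -
  define A where "A = range (\<lambda>n::nat. int n + 1)"
  define B where "B = range (\<lambda>n::nat. - (int n + 1))"
  have "(f has_sum a) A" unfolding A_def using assms(1) by (subst has_sum_reindex) (auto simp: inj_def o_def)
  moreover have "(f has_sum b) B" unfolding B_def using assms(2) by (subst has_sum_reindex) (auto simp: inj_def o_def)
  moreover have "A \<inter> B = {}" by (auto simp: A_def B_def)
  ultimately have "(f has_sum (a + b)) (A \<union> B)" by (rule has_sum_Un_disjoint)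
  moreover have "0 \<notin> A \<union> B" by (auto simp: A_def B_def)
  ultimately have "(f has_sum (f 0 + (a + b))) (insert 0 (A \<union> B))" by (intro has_sum_insert)
  moreover have "insert 0 (A \<union> B) = UNIV"
  proof (intro set_eqI iffI UNIV_I)
    fix k :: int
    consider "k = 0" | "k > 0" | "k < 0" by linarith
    then show "k \<in> insert 0 (A \<union> B)"
    proof cases
      case 2 then have "k = int (nat (k - 1)) + 1" by simp
      then show ?thesis unfolding A_def by blast
    next
      case 3 then have "k = - (int (nat (- k - 1)) + 1)" by simp
      then show ?thesis unfolding B_def by blast
    qed simp
  qed
  ultimately show ?thesis by (simp add: add.assoc)
qed

text \<open>
  The region around the unit circle in which u = 1 is the only pole of the Appell series.
\<close>

definition annulus :: "complex \<Rightarrow> complex set" where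
  "annulus Q = {u. norm Q < norm u \<and> norm (u * Q) < 1}"

lemma annulusD:
  assumes "u \<in> annulus Q" shows "u \<noteq> 0" "norm (u * Q) < 1" "norm (1 / u * Q) < 1"
proof -
  have "norm u > 0" using assms norm_ge_zero[of Q] unfolding annulus_def by (smt (verit) mem_Collect_eq)
  then show "u \<noteq> 0" by auto
  then show "norm (1 / u * Q) < 1" using assms by (simp add: annulus_def norm_divide)
qed (use assms in \<open>simp add: annulus_def\<close>)

text \<open>
  Under u \<mapsto> 1/u the terms s and -s are exchanged with opposite sign.
\<close>

lemma appell_split:
  assumes Q: "norm Q < 1" "Q \<noteq> 0" and u: "u \<in> annulus Q"
  shows "appell u Q = (1 + u) / (1 - u) + appell_half Q u - appell_half Q (1 / u)"
proof -
  note u' = annulusD[OF u]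
  have neg: "appell_term Q u (- (int n + 1)) = - appell_term Q (1 / u) (int n + 1)" for n
  proof (rule appell_term_neg[OF Q(2) u'(1)])
    show "1 - u * Q powi (- (int n + 1)) \<noteq> 0"
    proof
      assume "1 - u * Q powi (- (int n + 1)) = 0"
      moreover have "Q powi (- (int n + 1)) = 1 / Q ^ (n + 1)"
        using power_int_of_nat[of Q "n + 1"] by (simp only: power_int_minus_divide of_nat_add of_nat_1)
      ultimately have "u = Q ^ (n + 1)" using Q by simp
      then have "norm u \<le> norm Q" using Q power_le_one[of "norm Q" n] by (simp add: norm_mult norm_power mult_left_le)
      then show False using u by (simp add: annulus_def)
    qed
  qed
  have "(appell_term Q u has_sum (appell_term Q u 0 + appell_half Q u + (- appell_half Q (1 / u)))) UNIV"
  proof (rule has_sum_int_split)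
    show "((\<lambda>n. appell_term Q u (int n + 1)) has_sum appell_half Q u) UNIV"
      using appell_term_sums[OF Q u'(2)] by (metis has_sum_imp_sums has_sum_infsum sums_unique2)
    have "((\<lambda>n. appell_term Q (1 / u) (int n + 1)) has_sum appell_half Q (1 / u)) UNIV"
      using appell_term_sums[OF Q u'(3)] by (metis has_sum_imp_sums has_sum_infsum sums_unique2)
    then show "((\<lambda>n. appell_term Q u (- (int n + 1))) has_sum (- appell_half Q (1 / u))) UNIV" unfolding neg by (rule has_sum_uminusI)
  qed
  then show ?thesis unfolding appell_def appell_term_def by (simp add: has_sum_iff)
qed

text \<open>
  The Laurent coefficients of the Appell series for |Q| < |u| < 1, where the pole at u = 1 contributes
  (1 + u) / (1 - u) = 1 + 2 u + 2 u^2 + ...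
\<close>

definition appell_coeff :: "complex \<Rightarrow> int \<Rightarrow> complex" where
  "appell_coeff Q k = (if k > 0 then 2 + appell_half_coeff Q (nat k) else if k = 0 then 1 else - appell_half_coeff Q (nat (- k)))"

lemma appell_coeff_neg: "appell_coeff Q (- k) = 2 - appell_coeff Q k" by (auto simp: appell_coeff_def)

text \<open>
  The shift s \<mapsto> s + 1 gives Q^2 u^4 appell (u Q) Q = appell u Q.  In coefficients the pole at u = 1, which lies
  between the two annuli, adds the term 2.
\<close>

lemma appell_coeff_step: assumes "Q \<noteq> 0" shows "appell_coeff Q (k + 4) = Q powi (k + 2) * appell_coeff Q k + 2"
proof -
  have pos: "appell_coeff Q (int n) = appell_half_coeff Q n + eps n" for n by (simp add: appell_coeff_def eps_def appell_half_coeff_small)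
  have key: "appell_coeff Q (k + 4) = Q powi (k + 2) * appell_coeff Q k + 2" if "k \<ge> 0" for k
  proof -
    define n where "n = nat k"
    have k: "k = int n" using that by (simp add: n_def)
    have "appell_coeff Q (k + 4) = 2 + appell_half_coeff Q (n + 4)" unfolding k appell_coeff_def by (simp add: nat_add_distrib)
    moreover have "Q powi (k + 2) = Q ^ (n + 2)" unfolding k by (metis int_ops(3) of_nat_add of_nat_numeral power_int_of_nat)
    ultimately show ?thesis unfolding k pos appell_half_coeff_step by simp
  qed
  consider "k \<ge> 0" | "k = -1 \<or> k = -2 \<or> k = -3" | "k \<le> -4" by linarith
  then show ?thesis
  proof cases
    case 2 then show ?thesis by (auto simp: appell_coeff_def appell_half_coeff_small)
  next
    case 3
    define m where "m = - k - 4"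
    have "appell_coeff Q (m + 4) = Q powi (m + 2) * appell_coeff Q m + 2" by (rule key) (use 3 in \<open>simp add: m_def\<close>)
    moreover have "appell_coeff Q m = 2 - appell_coeff Q (k + 4)" using appell_coeff_neg[of Q "k + 4"] by (simp add: m_def)
    moreover have "appell_coeff Q (m + 4) = 2 - appell_coeff Q k" using appell_coeff_neg[of Q k] by (simp add: m_def)
    ultimately have "Q powi (m + 2) * appell_coeff Q (k + 4) = appell_coeff Q k + Q powi (m + 2) * 2" by (simp add: algebra_simps)
    moreover have "Q powi (k + 2) * Q powi (m + 2) = 1"
    proof -
      have "(k + 2) + (m + 2) = 0" by (simp add: m_def)
      then show ?thesis using power_int_add[of Q "k + 2" "m + 2"] assms by simp
    qed
    ultimately have "1 * appell_coeff Q (k + 4) = Q powi (k + 2) * appell_coeff Q k + 1 * 2" by (metis distrib_left mult.assoc)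
    then show ?thesis by simp
  qed (rule key)
qed

lemma appell_coeff_bounded: assumes "norm Q < 1" obtains B where "\<And>k. norm (appell_coeff Q k) \<le> B"
proof -
  obtain B where B: "B \<ge> 0" "\<And>n. norm (appell_half_coeff Q n) \<le> B" using appell_half_coeff_bound[OF assms] by metis
  have 1: "norm (2 + appell_half_coeff Q m) \<le> 2 + B" for m using norm_triangle_ineq[of 2 "appell_half_coeff Q m"] B(2)[of m] by simp
  have 2: "norm (appell_half_coeff Q m) \<le> 2 + B" for m using B(2)[of m] by simp
  have "norm (appell_coeff Q k) \<le> 2 + B" for k using 1[of "nat k"] 2[of "nat (- k)"] B(1) by (simp add: appell_coeff_def)
  then show thesis by (rule that)
qed

text \<open>
  The coefficients of (1 - u) * appell u Q.  This function has no pole at 1, so its Laurent series converges in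
  the whole annulus, including the unit circle.
\<close>

definition appell_diff :: "complex \<Rightarrow> int \<Rightarrow> complex" where "appell_diff Q k = appell_coeff Q k - appell_coeff Q (k - 1)"

lemma appell_diff_has_sum:
  assumes Q: "norm Q < 1" and u: "u \<in> annulus Q"
  shows "((\<lambda>k. appell_diff Q k * u powi k) has_sum ((1 - u) * (appell_half Q u - appell_half Q (1 / u)) + 1 + u)) UNIV"
proof -
  note u' = annulusD[OF u]
  define K' where "K' = (\<lambda>k. if k \<ge> 0 then appell_half_coeff Q (nat k) else - appell_half_coeff Q (nat (- k)))"
  have AF: "((\<lambda>n. appell_half_coeff Q (n + 1) * v ^ (n + 1)) has_sum appell_half Q v) UNIV" if "norm (v * Q) < 1" for v
  proof -
    have s: "summable (\<lambda>n. norm (appell_half_coeff Q n * v ^ n))" by (rule appell_half_summable[OF Q that])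
    have "(\<lambda>n. appell_half_coeff Q (Suc n) * v ^ Suc n) sums (appell_half Q v)"
      using summable_sums[OF summable_norm_cancel[OF s]] unfolding appell_half_def by (subst sums_Suc_iff) (simp add: appell_half_coeff_small)
    moreover have "summable (\<lambda>n. norm (appell_half_coeff Q (Suc n) * v ^ Suc n))" using s by (subst summable_Suc_iff)
    ultimately show ?thesis using norm_summable_imp_has_sum by fastforce
  qed
  have "((\<lambda>k. K' k * u powi k) has_sum (K' 0 * u powi 0 + appell_half Q u + (- appell_half Q (1 / u)))) UNIV"
  proof (rule has_sum_int_split)
    have "K' (int n + 1) * u powi (int n + 1) = appell_half_coeff Q (n + 1) * u ^ (n + 1)" for n
      using u'(1) by (simp add: K'_def nat_add_distrib power_int_add)
    then show "((\<lambda>n. K' (int n + 1) * u powi (int n + 1)) has_sum appell_half Q u) UNIV" using AF[OF u'(2)] by simp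
    have "K' (- (int n + 1)) * u powi (- (int n + 1)) = - (appell_half_coeff Q (n + 1) * (1 / u) ^ (n + 1))" for n
    proof -
      have "u powi (- (int n + 1)) = (1 / u) ^ (n + 1)"
        using u'(1) power_int_of_nat[of u "n + 1"] by (simp only: power_int_minus of_nat_add of_nat_1 power_one_over inverse_eq_divide)
      moreover have "K' (- (int n + 1)) = - appell_half_coeff Q (n + 1)" by (simp add: K'_def nat_add_distrib)
      ultimately show ?thesis by simp
    qed
    then show "((\<lambda>n. K' (- (int n + 1)) * u powi (- (int n + 1))) has_sum (- appell_half Q (1 / u))) UNIV"
      using has_sum_uminusI[OF AF[OF u'(3)]] by simp
  qed
  then have 1: "((\<lambda>k. K' k * u powi k) has_sum (appell_half Q u - appell_half Q (1 / u))) UNIV" by (simp add: K'_def appell_half_coeff_small)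
  have "((\<lambda>k. u * (K' k * u powi k)) has_sum (u * (appell_half Q u - appell_half Q (1 / u)))) UNIV" by (rule has_sum_cmult_right[OF 1])
  then have 2: "((\<lambda>k. K' (k - 1) * u powi k) has_sum (u * (appell_half Q u - appell_half Q (1 / u)))) UNIV"
    by (subst (asm) has_sum_reindex_bij_witness[of _ "\<lambda>k. k - 1" "\<lambda>k. k + 1"]) (use u'(1) in \<open>auto simp: power_int_add\<close>)
  have 3: "((\<lambda>k::int. (if k = 0 then 1 else if k = 1 then u else 0)) has_sum (1 + u)) UNIV"
    by (rule has_sum_finite_neutralI[where B = "{0, 1::int}"]) auto
  have "((\<lambda>k. (K' k * u powi k + - (K' (k - 1) * u powi k)) + (if k = 0 then 1 else if k = 1 then u else 0))
     has_sum ((appell_half Q u - appell_half Q (1 / u) + - (u * (appell_half Q u - appell_half Q (1 / u)))) + (1 + u))) UNIV"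
    by (intro has_sum_add 1 3 has_sum_uminusI[OF 2])
  also have "(\<lambda>k. (K' k * u powi k + - (K' (k - 1) * u powi k)) + (if k = 0 then 1 else if k = 1 then u else 0)) = (\<lambda>k. appell_diff Q k * u powi k)"
  proof
    fix k
    have "appell_diff Q k = K' k - K' (k - 1) + (if k = 0 then 1 else if k = 1 then 1 else 0)"
      unfolding appell_diff_def appell_coeff_def K'_def by (auto simp: appell_half_coeff_small)
    note khk = this
    show "(K' k * u powi k + - (K' (k - 1) * u powi k)) + (if k = 0 then 1 else if k = 1 then u else 0) = appell_diff Q k * u powi k"
      unfolding khk by (auto simp: algebra_simps)
  qed
  finally show ?thesis by (simp add: algebra_simps)
qed

section \<open>Functional equations as laws for coefficients\<close>

text \<open>
  For f u = laurent a u this says f u = c * u^d * f (Q * u).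
\<close>

definition quasi_periodic :: "complex \<Rightarrow> int \<Rightarrow> complex \<Rightarrow> (int \<Rightarrow> complex) \<Rightarrow> bool" where
  "quasi_periodic Q d c a \<longleftrightarrow> (\<forall>k. a (k + d) = c * Q powi k * a k)"

text \<open>
  For f u = laurent a u this says f u = u^e * f (1/u).
\<close>

definition reflective :: "int \<Rightarrow> (int \<Rightarrow> complex) \<Rightarrow> bool" where
  "reflective e a \<longleftrightarrow> (\<forall>k. a (e - k) = a k)"

lemma quasi_periodic_conv:
  assumes Q: "Q \<noteq> 0" and a: "quasi_periodic Q d1 c1 a" and b: "quasi_periodic Q d2 c2 b"
  shows "quasi_periodic Q (d1 + d2) (c1 * c2) (conv a b)"
  unfolding quasi_periodic_def
proof
  fix k
  have "conv a b (k + (d1 + d2)) = (\<Sum>\<^sub>\<infinity>s. a (k + (d1 + d2) - (s + d2)) * b (s + d2))"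
    unfolding conv_def by (rule infsum_int_shift[symmetric])
  also have "\<dots> = (\<Sum>\<^sub>\<infinity>s. c1 * c2 * Q powi k * (a (k - s) * b s))"
  proof (rule infsum_cong)
    fix s
    have e: "k + (d1 + d2) - (s + d2) = (k - s) + d1" by simp
    have p: "Q powi k = Q powi (k - s) * Q powi s" using Q by (simp flip: power_int_add)
    have a': "a ((k - s) + d1) = c1 * Q powi (k - s) * a (k - s)" using a unfolding quasi_periodic_def by blast
    have b': "b (s + d2) = c2 * Q powi s * b s" using b unfolding quasi_periodic_def by blast
    show "a (k + (d1 + d2) - (s + d2)) * b (s + d2) = c1 * c2 * Q powi k * (a (k - s) * b s)"
      unfolding e a' b' p by simp
  qed
  finally show "conv a b (k + (d1 + d2)) = c1 * c2 * Q powi k * conv a b k" unfolding conv_def infsum_cmult_right' .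
qed

lemma reflective_conv:
  assumes a: "reflective e1 a" and b: "reflective e2 b" shows "reflective (e1 + e2) (conv a b)"
  unfolding reflective_def
proof
  fix k
  have "conv a b (e1 + e2 - k) = (\<Sum>\<^sub>\<infinity>s. a (e1 + e2 - k - (e2 - s)) * b (e2 - s))"
    unfolding conv_def by (rule infsum_int_reflect[symmetric])
  also have "\<dots> = conv a b k" unfolding conv_def
  proof (rule infsum_cong)
    fix s
    have "e1 + e2 - k - (e2 - s) = e1 - (k - s)" by simp
    then show "a (e1 + e2 - k - (e2 - s)) * b (e2 - s) = a (k - s) * b s" using a b unfolding reflective_def by metis
  qed
  finally show "conv a b (e1 + e2 - k) = conv a b k" .
qed

lemma quasi_periodic_lincomb: "quasi_periodic Q d c a \<Longrightarrow> quasi_periodic Q d c b \<Longrightarrow> quasi_periodic Q d c (\<lambda>k. x * a k + y * b k)"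
  unfolding quasi_periodic_def by (simp add: algebra_simps)
lemma reflective_lincomb: "reflective e a \<Longrightarrow> reflective e b \<Longrightarrow> reflective e (\<lambda>k. x * a k + y * b k)"
  unfolding reflective_def by simp

lemma quasi_periodic_zero:
  assumes Q: "Q \<noteq> 0" "c \<noteq> 0" and a: "quasi_periodic Q d c a" and r: "a r = 0" shows "a (r + d * m) = 0"
proof -
  have step: "a (k + d) = 0 \<longleftrightarrow> a k = 0" for k using a Q unfolding quasi_periodic_def by simp
  show ?thesis
  proof (induction m rule: int_induct[where k = 0])
    case (step1 i)
    then show ?case using step[of "r + d * i"] by (simp add: algebra_simps)
  next
    case (step2 i)
    then show ?case using step[of "r + d * (i - 1)"] by (simp add: algebra_simps)
  qed (simp add: r)
qed

lemma diff_zero_D: "1 * x + (-1) * z = 0 \<Longrightarrow> x = (z::complex)"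
  by simp

text \<open>
  The two laws connect every index with 0 or 1, except those congruent to 4 modulo 5.  For these, the
  step of length 5 and the reflection map -1 to 4 with opposite signs, so a 4 = 0 in any case.
\<close>

lemma theta5_zero:
  assumes Q: "Q \<noteq> 0" and a: "quasi_periodic Q 5 (- Q) a" "reflective 3 a" and z: "a 0 = 0" "a 1 = 0"
  shows "a k = 0"
proof -
  have r: "a (3 - k) = a k" for k using a(2) unfolding reflective_def by blast
  have "a 3 = 0" "a 2 = 0" using r[of 0] r[of 1] z by simp_all
  moreover have "a 4 = 0"
  proof -
    have "a (-1 + 5) = - Q * Q powi (-1) * a (-1)" using a(1) unfolding quasi_periodic_def by blast
    then have "a 4 = - Q * Q powi (-1) * a (-1)" by simp
    also have "\<dots> = - a (-1)" using Q by (simp add: power_int_minus)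
    also have "a (-1) = a 4" using r[of 4] by simp
    finally show ?thesis by simp
  qed
  ultimately have "a (k mod 5) = 0"
  proof -
    have "k mod 5 = 0 \<or> k mod 5 = 1 \<or> k mod 5 = 2 \<or> k mod 5 = 3 \<or> k mod 5 = 4" by presburger
    then show ?thesis using z \<open>a 3 = 0\<close> \<open>a 2 = 0\<close> \<open>a 4 = 0\<close> by auto
  qed
  then have "a (k mod 5 + 5 * (k div 5)) = 0" using Q by (intro quasi_periodic_zero[OF Q _ a(1)]) auto
  then show ?thesis by simp
qed

text \<open>
  By theta5_zero a solution is determined by its entries 0 and 1, so any two independent solutions f and
  g span.  Independence is detected by the values of the Laurent series at u and v.
\<close>

lemma theta5_span:
  assumes Q: "Q \<noteq> 0" and f: "quasi_periodic Q 5 (- Q) f" "reflective 3 f" and g: "quasi_periodic Q 5 (- Q) g" "reflective 3 g" and y: "quasi_periodic Q 5 (- Q) y" "reflective 3 y"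
    and e: "entire f" "entire g" and u: "laurent f u = 0" "laurent g u \<noteq> 0" "u \<noteq> 0" and v: "laurent f v \<noteq> 0"
  obtains c0 c1 where "\<And>k. y k = c0 * f k + c1 * g k"
proof -
  define D where "D = f 0 * g 1 - f 1 * g 0"
  have indep: "\<beta> = 0" if "\<And>k. \<alpha> * f k + \<beta> * g k = 0" for \<alpha> \<beta>
  proof -
    have "0 = (\<Sum>\<^sub>\<infinity>k. \<alpha> * (f k * u powi k) + \<beta> * (g k * u powi k))"
    proof -
      have "\<alpha> * (f k * u powi k) + \<beta> * (g k * u powi k) = 0" for k
        using arg_cong[OF that[of k], of "\<lambda>x. x * u powi k"] by (simp add: algebra_simps)
      then show ?thesis by simp
    qed
    also have "\<dots> = \<alpha> * laurent f u + \<beta> * laurent g u"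
      unfolding laurent_def by (rule infsum_lincomb[OF entireD[OF e(1) u(3)] entireD[OF e(2) u(3)]])
    finally show ?thesis using u by simp
  qed
  have D: "D \<noteq> 0"
  proof
    assume D0: "D = 0"
    have 0: "x * f k + w * g k = 0" if "x * f 0 + w * g 0 = 0" "x * f 1 + w * g 1 = 0" for x w k
      by (rule theta5_zero[OF Q quasi_periodic_lincomb[OF f(1) g(1)] reflective_lincomb[OF f(2) g(2)] that])
    have "- f 0 = 0" by (rule indep[of "g 0"], rule 0) (use D0 in \<open>simp_all add: D_def algebra_simps\<close>)
    moreover have "- f 1 = 0" by (rule indep[of "g 1"], rule 0) (use D0 in \<open>simp_all add: D_def algebra_simps\<close>)
    ultimately have "f k = 0" for k using theta5_zero[OF Q f] by simp
    then show False using v by (simp add: laurent_def)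
  qed
  define c0 where "c0 = (y 0 * g 1 - y 1 * g 0) / D"
  define c1 where "c1 = (f 0 * y 1 - f 1 * y 0) / D"
  have "1 * y k + (-1) * (c0 * f k + c1 * g k) = 0" for k
  proof (rule theta5_zero[OF Q quasi_periodic_lincomb[OF y(1) quasi_periodic_lincomb[OF f(1) g(1)]] reflective_lincomb[OF y(2) reflective_lincomb[OF f(2) g(2)]]])
    have "c0 * f 0 + c1 * g 0 = (y 0 * D) / D" unfolding c0_def c1_def D_def
      by (simp add: algebra_simps flip: add_divide_distrib diff_divide_distrib)
    then show "1 * y 0 + (-1) * (c0 * f 0 + c1 * g 0) = 0" using D by simp
    have "c0 * f 1 + c1 * g 1 = (y 1 * D) / D" unfolding c0_def c1_def D_def
      by (simp add: algebra_simps flip: add_divide_distrib diff_divide_distrib)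
    then show "1 * y 1 + (-1) * (c0 * f 1 + c1 * g 1) = 0" using D by simp
  qed
  then show thesis using that[of c0 c1] diff_zero_D by blast
qed

section \<open>Theta functions of degree one and two\<close>

text \<open>
  The coefficients of the Laurent series of c at u^2.
\<close>

definition spread :: "(int \<Rightarrow> complex) \<Rightarrow> int \<Rightarrow> complex" where
  "spread c k = (if even k then c (k div 2) else 0)"

lemma spread_laurent:
  assumes "u \<noteq> 0"
  shows "laurent (spread c) u = laurent c (u\<^sup>2)"
    "(\<lambda>k. spread c k * u powi k) summable_on UNIV \<longleftrightarrow> (\<lambda>k. c k * (u\<^sup>2) powi k) summable_on UNIV"
proof -
  have inj: "inj (\<lambda>t::int. 2 * t)" by (simp add: inj_def)
  have z: "spread c k * u powi k = 0" if "k \<notin> range (\<lambda>t. 2 * t)" for k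
    using that by (auto simp: spread_def elim!: evenE)
  have e: "(\<lambda>k. spread c k * u powi k) \<circ> (\<lambda>t. 2 * t) = (\<lambda>k. c k * (u\<^sup>2) powi k)"
    by (auto simp: spread_def power_int_power)
  have "laurent (spread c) u = infsum (\<lambda>k. spread c k * u powi k) (range (\<lambda>t. 2 * t))"
    unfolding laurent_def by (rule infsum_cong_neutral) (use z in auto)
  also have "\<dots> = laurent c (u\<^sup>2)" unfolding laurent_def infsum_reindex[OF inj] e ..
  finally show "laurent (spread c) u = laurent c (u\<^sup>2)" .
  have "(\<lambda>k. spread c k * u powi k) summable_on UNIV \<longleftrightarrow> (\<lambda>k. spread c k * u powi k) summable_on (range (\<lambda>t. 2 * t))"
    by (rule summable_on_cong_neutral) (use z in auto)
  also have "\<dots> \<longleftrightarrow> (\<lambda>k. c k * (u\<^sup>2) powi k) summable_on UNIV" unfolding summable_on_reindex[OF inj] e ..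
  finally show "(\<lambda>k. spread c k * u powi k) summable_on UNIV \<longleftrightarrow> (\<lambda>k. c k * (u\<^sup>2) powi k) summable_on UNIV" .
qed

text \<open>
  E0 and E1 are the even and the odd theta series spanning the functions f with f u = u^2 * f (Q * u);
  Ob is a further even theta series of degree two.
\<close>

definition E0 :: "complex \<Rightarrow> int \<Rightarrow> complex" where "E0 Q = spread (\<lambda>t. Q powi (2 * tri t))"
definition E1 :: "complex \<Rightarrow> int \<Rightarrow> complex" where "E1 Q k = spread (\<lambda>t. Q powi (t * t)) (k - 1)"
definition Ob :: "complex \<Rightarrow> int \<Rightarrow> complex" where "Ob Q = spread (\<lambda>t. msgn t * Q powi (t * t))"

lemma square_tri: "t * t = 2 * tri t + t" using tri_double[of t] by (simp add: algebra_simps)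

lemma E0_laurent:
  assumes Q: "norm Q < 1" "Q \<noteq> 0" shows "entire (E0 Q)" "u \<noteq> 0 \<Longrightarrow> laurent (E0 Q) u = jtheta (- (u\<^sup>2)) (Q\<^sup>2)"
proof -
  have e: "Q powi (2 * tri k) * (u\<^sup>2) powi k = theta_coeff (Q\<^sup>2) k * (- (u\<^sup>2)) powi k" for u k
  proof -
    have "(- (u\<^sup>2)) powi k = msgn k * (u\<^sup>2) powi k" using power_int_mult_distrib[of "-1" "u\<^sup>2" k] by (simp add: msgn_powi)
    then show ?thesis by (simp add: theta_coeff_def power_int_power)
  qed
  show "entire (E0 Q)" unfolding entire_def E0_def
    using entireD[OF theta_coeff_summable[of "Q\<^sup>2"]] sq_norm[OF Q] by (simp add: spread_laurent e)
  show "laurent (E0 Q) u = jtheta (- (u\<^sup>2)) (Q\<^sup>2)" if "u \<noteq> 0"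
    unfolding E0_def spread_laurent(1)[OF that] unfolding laurent_def jtheta_def e ..
qed

lemma Ob_laurent:
  assumes Q: "norm Q < 1" "Q \<noteq> 0" shows "entire (Ob Q)" "u \<noteq> 0 \<Longrightarrow> laurent (Ob Q) u = jtheta (Q * u\<^sup>2) (Q\<^sup>2)"
proof -
  have e: "msgn k * Q powi (k * k) * (u\<^sup>2) powi k = theta_coeff (Q\<^sup>2) k * (Q * u\<^sup>2) powi k" for u k
    unfolding square_tri[of k] using Q by (simp add: theta_coeff_def power_int_power power_int_add power_int_mult_distrib)
  show "entire (Ob Q)" unfolding entire_def Ob_def
    using entireD[OF theta_coeff_summable[of "Q\<^sup>2"]] sq_norm[OF Q] Q by (simp add: spread_laurent e)
  show "laurent (Ob Q) u = jtheta (Q * u\<^sup>2) (Q\<^sup>2)" if "u \<noteq> 0"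
    unfolding Ob_def spread_laurent(1)[OF that] unfolding laurent_def jtheta_def e ..
qed

lemma E1_laurent:
  assumes Q: "norm Q < 1" "Q \<noteq> 0" shows "entire (E1 Q)" "u \<noteq> 0 \<Longrightarrow> laurent (E1 Q) u = u * jtheta (- (Q * u\<^sup>2)) (Q\<^sup>2)"
proof -
  have e: "Q powi (k * k) * (u\<^sup>2) powi k = theta_coeff (Q\<^sup>2) k * (- (Q * u\<^sup>2)) powi k" for u k
  proof -
    have "(- (Q * u\<^sup>2)) powi k = msgn k * (Q * u\<^sup>2) powi k" using power_int_mult_distrib[of "-1" "Q * u\<^sup>2" k] by (simp add: msgn_powi)
    then show ?thesis unfolding square_tri[of k] using Q by (simp add: theta_coeff_def power_int_power power_int_add power_int_mult_distrib)
  qed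
  have sh: "E1 Q k * u powi k = u * (spread (\<lambda>t. Q powi (t * t)) (k + (-1)) * u powi (k + (-1)))" if "u \<noteq> 0" for u k
    using that by (simp add: E1_def power_int_diff)
  show "entire (E1 Q)" unfolding entire_def
  proof (intro allI impI)
    fix u :: complex assume u: "u \<noteq> 0"
    have "(\<lambda>k. spread (\<lambda>t. Q powi (t * t)) k * u powi k) summable_on UNIV"
      using entireD[OF theta_coeff_summable[of "Q\<^sup>2"]] sq_norm[OF Q] Q u by (simp add: spread_laurent e)
    then have "(\<lambda>k. spread (\<lambda>t. Q powi (t * t)) (k + (-1)) * u powi (k + (-1))) summable_on UNIV"
      by (rule summable_on_int_shift[THEN iffD2])
    then show "(\<lambda>k. E1 Q k * u powi k) summable_on UNIV" unfolding sh[OF u] by (rule summable_on_cmult_right)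
  qed
  show "laurent (E1 Q) u = u * jtheta (- (Q * u\<^sup>2)) (Q\<^sup>2)" if u: "u \<noteq> 0"
  proof -
    have "laurent (E1 Q) u = u * laurent (spread (\<lambda>t. Q powi (t * t))) u"
      unfolding laurent_def sh[OF u] infsum_cmult_right' infsum_int_shift[of "\<lambda>k. spread (\<lambda>t. Q powi (t * t)) k * u powi k" "-1"] ..
    also have "laurent (spread (\<lambda>t. Q powi (t * t))) u = jtheta (- (Q * u\<^sup>2)) (Q\<^sup>2)"
      unfolding spread_laurent(1)[OF u] unfolding laurent_def jtheta_def e ..
    finally show ?thesis .
  qed
qed

lemma ptheta_coeff_laurent:
  assumes Q: "norm Q < 1" "Q \<noteq> 0" shows "entire (ptheta_coeff Q)" "u \<noteq> 0 \<Longrightarrow> laurent (ptheta_coeff Q) u = jtheta (- u) Q"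
proof -
  have e: "ptheta_coeff Q k * u powi k = theta_coeff Q k * (- u) powi k" for u k
    using power_int_mult_distrib[of "-1" u k] by (simp add: ptheta_theta_coeff msgn_powi mult_ac)
  show "entire (ptheta_coeff Q)" unfolding entire_def e using entireD[OF theta_coeff_summable[OF Q]] by simp
  show "laurent (ptheta_coeff Q) u = jtheta (- u) Q" unfolding laurent_def jtheta_def e ..
qed

lemma spread_quasi_periodic:
  assumes "\<And>t. c (t + 1) = x * Q powi (2 * t) * c t" shows "quasi_periodic Q 2 x (spread c)"
  unfolding quasi_periodic_def
proof
  fix k
  show "spread c (k + 2) = x * Q powi k * spread c k"
  proof (cases "even k")
    case True
    then obtain t where k: "k = 2 * t" by (elim evenE)
    have "(2 * t + 2) div 2 = t + 1" by simp
    then show ?thesis using assms[of t] by (simp add: spread_def k)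
  qed (simp add: spread_def)
qed

lemma E0_laws: assumes "Q \<noteq> 0" shows "quasi_periodic Q 2 1 (E0 Q)" "reflective 2 (E0 Q)"
proof -
  show "quasi_periodic Q 2 1 (E0 Q)" unfolding E0_def
    by (rule spread_quasi_periodic) (use assms in \<open>simp add: tri_Suc algebra_simps power_int_add\<close>)
  show "reflective 2 (E0 Q)" unfolding reflective_def
  proof
    fix k show "E0 Q (2 - k) = E0 Q k"
    proof (cases "even k")
      case True
      then obtain t where k: "k = 2 * t" by (elim evenE)
      have "(2 - 2 * t) div 2 = 1 - t" by simp
      then show ?thesis by (simp add: E0_def spread_def k tri_reflect)
    qed (simp add: E0_def spread_def)
  qed
qed

lemma Ob_laws: assumes "Q \<noteq> 0" shows "quasi_periodic Q 2 (- Q) (Ob Q)" "reflective 0 (Ob Q)"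
proof -
  have e: "(t + 1) * (t + 1) = 1 + (2 * t + t * t)" for t :: int by (simp add: algebra_simps)
  show "quasi_periodic Q 2 (- Q) (Ob Q)" unfolding Ob_def
    by (rule spread_quasi_periodic) (use assms in \<open>simp add: e power_int_add\<close>)
  show "reflective 0 (Ob Q)" unfolding reflective_def
  proof
    fix k show "Ob Q (0 - k) = Ob Q k"
    proof (cases "even k")
      case True
      then obtain t where k: "k = 2 * t" by (elim evenE)
      have "- (2 * t) div 2 = - t" by simp
      then show ?thesis by (simp add: Ob_def spread_def k)
    qed (simp add: Ob_def spread_def)
  qed
qed

lemma E1_laws: assumes "Q \<noteq> 0" shows "quasi_periodic Q 2 1 (E1 Q)" "reflective 2 (E1 Q)"
proof -
  have e: "(t + 1) * (t + 1) = 1 + (2 * t + t * t)" for t :: int by (simp add: algebra_simps)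
  have s: "quasi_periodic Q 2 Q (spread (\<lambda>t. Q powi (t * t)))"
    by (rule spread_quasi_periodic) (use assms in \<open>simp add: e power_int_add\<close>)
  show "quasi_periodic Q 2 1 (E1 Q)" unfolding quasi_periodic_def
  proof
    fix k
    have "E1 Q (k + 2) = spread (\<lambda>t. Q powi (t * t)) ((k - 1) + 2)" by (simp add: E1_def)
    also have "\<dots> = Q * Q powi (k - 1) * E1 Q k" using s unfolding quasi_periodic_def E1_def by blast
    also have "Q * Q powi (k - 1) = 1 * Q powi k" using assms by (simp add: power_int_diff)
    finally show "E1 Q (k + 2) = 1 * Q powi k * E1 Q k" .
  qed
  show "reflective 2 (E1 Q)" unfolding reflective_def
  proof
    fix k show "E1 Q (2 - k) = E1 Q k"
    proof (cases "even k")
      case False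
      then obtain t where k: "k = 2 * t + 1" by (elim oddE)
      have "- (2 * t) div 2 = - t" by simp
      then show ?thesis by (simp add: E1_def spread_def k)
    qed (simp add: E1_def spread_def)
  qed
qed

lemma ptheta_coeff_laws: assumes "Q \<noteq> 0" shows "quasi_periodic Q 1 1 (ptheta_coeff Q)" "reflective 1 (ptheta_coeff Q)"
  unfolding quasi_periodic_def reflective_def ptheta_coeff_def using assms by (simp_all add: tri_Suc tri_reflect power_int_add)

text \<open>
  By the triple product, the zeros are the integral powers of Q.
\<close>

lemma jtheta_nonzero:
  assumes Q: "norm Q < 1" "Q \<noteq> 0" and u: "norm Q < norm u" "norm u \<le> 1" "u \<noteq> 1"
  shows "jtheta u Q \<noteq> 0"
proof -
  have u0: "u \<noteq> 0" using u(1) by auto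
  have "1 - u \<noteq> 0" using u by simp
  moreover have "norm Q * norm u \<le> norm Q * 1" using u by (intro mult_left_mono) auto
  then have "norm Q * norm u < 1" using Q by linarith
  then have "qinf (Q * u) Q \<noteq> 0" by (intro qinf_nonzero_norm[OF Q(1)]) (simp add: norm_mult)
  ultimately have "qinf u Q \<noteq> 0" using qinf_Suc[OF Q(1), of u] by simp
  moreover have "qinf (Q / u) Q \<noteq> 0" using u u0 by (intro qinf_nonzero_norm[OF Q(1)]) (simp add: norm_divide)
  ultimately show ?thesis using jacobi_triple[OF Q u0] qinf_self_nonzero[OF Q(1)] by simp
qed

text \<open>
  The coefficients of the square satisfy a(k+2) = Q^k a(k), so they are determined by a(0) and a(1),
  and the square is a combination of E0 and E1.  Its entry at index 0 is the sum of all Q^(s^2), which is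
  a0; the other one follows from the zero at u = 1.
\<close>

lemma jtheta_square:
  assumes Q: "norm Q < 1" "Q \<noteq> 0" and u: "u \<noteq> 0"
  defines "a0 \<equiv> laurent (E1 Q) 1" and "b0 \<equiv> laurent (E0 Q) 1"
  shows "(jtheta u Q)\<^sup>2 = a0 * laurent (E0 Q) u - b0 * laurent (E1 Q) u"
proof -
  define pp where "pp = conv (theta_coeff Q) (theta_coeff Q)"
  have p: "quasi_periodic Q 1 (-1) (theta_coeff Q)" unfolding quasi_periodic_def using theta_coeff_Suc[OF Q(2)] by simp
  have pp: "quasi_periodic Q 2 1 pp" using quasi_periodic_conv[OF Q(2) p p] by (simp add: pp_def)
  have E00: "E0 Q 0 = 1" "E0 Q 1 = 0" "E1 Q 0 = 0" "E1 Q 1 = 1" by (simp_all add: E0_def E1_def spread_def)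
  have span: "pp k = pp 0 * E0 Q k + pp 1 * E1 Q k" for k
  proof -
    let ?d = "\<lambda>k. 1 * pp k + (-1) * (pp 0 * E0 Q k + pp 1 * E1 Q k)"
    have d: "quasi_periodic Q 2 1 ?d" by (intro quasi_periodic_lincomb pp E0_laws E1_laws Q)
    have "?d (k mod 2) = 0"
    proof -
      have "k mod 2 = 0 \<or> k mod 2 = 1" by presburger
      then show ?thesis by (auto simp: E00)
    qed
    then have "?d (k mod 2 + 2 * (k div 2)) = 0" by (intro quasi_periodic_zero[OF Q(2) _ d]) auto
    then have "?d k = 0" by simp
    then show ?thesis by (rule diff_zero_D)
  qed
  have L: "(jtheta v Q)\<^sup>2 = pp 0 * laurent (E0 Q) v + pp 1 * laurent (E1 Q) v" if v: "v \<noteq> 0" for v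
  proof -
    have "(jtheta v Q)\<^sup>2 = laurent pp v"
      using laurent_conv(2)[OF v entireD[OF theta_coeff_summable[OF Q] v] entireD[OF theta_coeff_summable[OF Q] v]]
      by (simp add: pp_def jtheta_def power2_eq_square)
    also have "\<dots> = (\<Sum>\<^sub>\<infinity>k. pp 0 * (E0 Q k * v powi k) + pp 1 * (E1 Q k * v powi k))"
      unfolding laurent_def by (rule infsum_cong) (subst span, simp add: algebra_simps)
    also have "\<dots> = pp 0 * laurent (E0 Q) v + pp 1 * laurent (E1 Q) v"
      unfolding laurent_def by (rule infsum_lincomb[OF entireD[OF E0_laurent(1)[OF Q] v] entireD[OF E1_laurent(1)[OF Q] v]])
    finally show ?thesis .
  qed
  have "pp 0 = a0"
  proof -
    have "pp 0 = (\<Sum>\<^sub>\<infinity>s. Q powi (s * s))" unfolding pp_def conv_def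
    proof (rule infsum_cong)
      fix s
      have "theta_coeff Q (0 - s) * theta_coeff Q s = (msgn s * msgn s) * (Q powi tri (- s) * Q powi tri s)" by (simp add: theta_coeff_def)
      also have "Q powi tri (- s) * Q powi tri s = Q powi (s * s)"
        using Q by (simp add: tri_uminus square_tri flip: power_int_add)
      finally show "theta_coeff Q (0 - s) * theta_coeff Q s = Q powi (s * s)" by simp
    qed
    also have "\<dots> = laurent (spread (\<lambda>t. Q powi (t * t))) 1" unfolding spread_laurent(1)[OF one_neq_zero] by (simp add: laurent_def)
    also have "\<dots> = a0" unfolding a0_def laurent_def
      using infsum_int_shift[of "\<lambda>k. spread (\<lambda>t. Q powi (t * t)) k * 1 powi k" "-1"] by (simp add: E1_def)
    finally show ?thesis .
  qed
  moreover have "a0 \<noteq> 0"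
  proof -
    have "a0 = jtheta (- Q) (Q\<^sup>2)" unfolding a0_def using E1_laurent(2)[OF Q, of 1] by simp
    moreover have "norm Q * norm Q < norm Q * 1" using Q by (intro mult_strict_left_mono) auto
    then have "norm (Q\<^sup>2) < norm (- Q)" by (simp add: norm_mult power2_eq_square)
    moreover have "- Q \<noteq> 1" using Q by (metis norm_minus_cancel norm_one less_irrefl)
    ultimately show ?thesis using jtheta_nonzero[of "Q\<^sup>2" "- Q"] sq_norm[OF Q] Q by simp
  qed
  moreover have "pp 0 * b0 + pp 1 * a0 = 0"
    using L[of 1] jtheta_1[OF Q] unfolding a0_def b0_def by simp
  ultimately have "a0 * (pp 1 + b0) = 0" by (simp add: algebra_simps)
  then have "pp 1 = - b0" using \<open>a0 \<noteq> 0\<close> by (simp add: eq_neg_iff_add_eq_0)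
  then show ?thesis using L[OF u] \<open>pp 0 = a0\<close> by simp
qed

section \<open>The Appell series as a quotient of theta functions\<close>

text \<open>
  Let V be the convolution of theta_coeff with appell_coeff.  Its shift y k = V (k - 1) obeys the laws of
  theta5_span: the inhomogeneous terms in appell_coeff_step and in the reflection law disappear because
  the theta coefficients sum to zero.  Multiplying theta functions of degrees 1, 2 and 2 gives two
  solutions f and g, hence the first claim.

  Since appell_coeff is not summable on the unit circle, the product of the two series is formed with
  appell_diff instead, which represents (1 - u) * appell u Q.

  For the second claim let d be the convolution of theta_coeff with appell_diff, so that
  d k = V k - V (k - 1).  Summation by parts gives sum k d_k = - sum V_k, whereas the product rule for
  convolutions expresses sum k d_k by sum_index_theta_coeff and the value 2 of (1 - u) * appell u Q at 1.
\<close>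

lemma appell_theta:
  assumes Q: "norm Q < 1" "Q \<noteq> 0"
  obtains c0 c1 where
    "\<And>u. u \<in> annulus Q \<Longrightarrow> u \<noteq> 1 \<Longrightarrow>
       u * (jtheta u Q * appell u Q) = jtheta (- u) Q * jtheta (Q * u\<^sup>2) (Q\<^sup>2) * (c0 * laurent (E0 Q) u + c1 * laurent (E1 Q) u)"
    "jtheta (-1) Q * jtheta Q (Q\<^sup>2) * (c0 * laurent (E0 Q) 1 + c1 * laurent (E1 Q) 1) = 2 * (qinf Q Q) ^ 3"
proof -
  define V where "V = conv (theta_coeff Q) (appell_coeff Q)"
  have pS: "theta_coeff Q summable_on UNIV" using entireD[OF theta_coeff_summable[OF Q], of 1] by simp
  have p0: "(\<Sum>\<^sub>\<infinity>k. theta_coeff Q k) = 0" using jtheta_1[OF Q] by (simp add: jtheta_def laurent_def)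
  obtain B where B: "\<And>k. norm (appell_coeff Q k) \<le> B" using appell_coeff_bounded[OF Q(1)] by metis
  have Vs: "(\<lambda>s. theta_coeff Q (k - s) * appell_coeff Q s) summable_on UNIV" for k by (rule conv_summand[OF pS B])
  have pm: "theta_coeff Q (m + 1) = - (Q powi m) * theta_coeff Q m" for m by (rule theta_coeff_Suc[OF Q(2)])
  have V5: "V (k + 5) = - (Q powi (k + 2)) * V k" for k
  proof -
    have "V (k + 5) = (\<Sum>\<^sub>\<infinity>s. theta_coeff Q (k + 5 - (s + 4)) * appell_coeff Q (s + 4))"
      unfolding V_def conv_def by (rule infsum_int_shift[symmetric])
    also have "\<dots> = (\<Sum>\<^sub>\<infinity>s. - (Q powi (k + 2)) * (theta_coeff Q (k - s) * appell_coeff Q s) + 2 * theta_coeff Q (k + 1 - s))"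
    proof (rule infsum_cong)
      fix s
      have e: "k + 5 - (s + 4) = (k - s) + 1" "k + 1 - s = (k - s) + 1" by simp_all
      have p: "Q powi (k + 2) = Q powi (k - s) * Q powi (s + 2)" using Q by (simp flip: power_int_add)
      show "theta_coeff Q (k + 5 - (s + 4)) * appell_coeff Q (s + 4) = - (Q powi (k + 2)) * (theta_coeff Q (k - s) * appell_coeff Q s) + 2 * theta_coeff Q (k + 1 - s)"
        unfolding appell_coeff_step[OF Q(2)] e pm p by (simp only: distrib_left mult_minus_left mult.commute mult.left_commute mult.assoc)
    qed
    also have "\<dots> = - (Q powi (k + 2)) * V k + 2 * (\<Sum>\<^sub>\<infinity>s. theta_coeff Q (k + 1 - s))"
      unfolding V_def conv_def
      by (rule infsum_lincomb[OF Vs]) (rule summable_on_int_reflect[THEN iffD2, OF pS])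
    also have "(\<Sum>\<^sub>\<infinity>s. theta_coeff Q (k + 1 - s)) = 0" unfolding infsum_int_reflect p0 ..
    finally show ?thesis by simp
  qed
  have Vneg: "V (- k) = V (k + 1)" for k
  proof -
    have "V (- k) = (\<Sum>\<^sub>\<infinity>s. theta_coeff Q (- k - (0 - s)) * appell_coeff Q (0 - s))"
      unfolding V_def conv_def by (rule infsum_int_reflect[symmetric])
    also have "\<dots> = (\<Sum>\<^sub>\<infinity>s. 2 * theta_coeff Q (0 - k + s) + (-1) * (theta_coeff Q (0 - k + s) * appell_coeff Q s))"
      by (rule infsum_cong) (simp add: appell_coeff_neg algebra_simps)
    also have "\<dots> = 2 * (\<Sum>\<^sub>\<infinity>s. theta_coeff Q (0 - k + s)) + (-1) * (\<Sum>\<^sub>\<infinity>s. theta_coeff Q (0 - k + s) * appell_coeff Q s)"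
    proof (rule infsum_lincomb)
      show 1: "(\<lambda>s. theta_coeff Q (0 - k + s)) summable_on UNIV"
        using summable_on_int_shift[of "theta_coeff Q" "0 - k"] pS by (simp add: add.commute)
      show "(\<lambda>s. theta_coeff Q (0 - k + s) * appell_coeff Q s) summable_on UNIV" by (rule summable_mult_bounded[OF 1 B])
    qed
    also have "(\<Sum>\<^sub>\<infinity>s. theta_coeff Q (0 - k + s)) = 0" using infsum_int_shift[of "theta_coeff Q" "0 - k"] p0 by (simp add: add.commute)
    also have "(\<Sum>\<^sub>\<infinity>s. theta_coeff Q (0 - k + s) * appell_coeff Q s) = - V (k + 1)"
      unfolding V_def conv_def infsum_uminus[symmetric]
    proof (rule infsum_cong)
      fix s
      have "theta_coeff Q (k + 1 - s) = - theta_coeff Q (0 - k + s)" using theta_coeff_reflect[of Q "0 - k + s"] by (simp add: algebra_simps)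
      then show "theta_coeff Q (0 - k + s) * appell_coeff Q s = - (theta_coeff Q (k + 1 - s) * appell_coeff Q s)" by simp
    qed
    finally show ?thesis by simp
  qed
  define y where "y = (\<lambda>k. V (k - 1))"
  have yq: "quasi_periodic Q 5 (- Q) y" unfolding quasi_periodic_def y_def
  proof
    fix k
    have "V (k + 5 - 1) = - (Q powi (k + 1)) * V (k - 1)" using V5[of "k - 1"] by (simp add: algebra_simps)
    then show "V (k + 5 - 1) = - Q * Q powi k * V (k - 1)" using Q by (simp add: power_int_add)
  qed
  have yr: "reflective 3 y" unfolding reflective_def y_def
  proof
    fix k :: int
    have e: "3 - k - 1 = - (k - 2)" "k - 1 = (k - 2) + 1" by simp_all
    show "V (3 - k - 1) = V (k - 1)" unfolding e by (rule Vneg)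
  qed
  define f where "f = conv (ptheta_coeff Q) (conv (Ob Q) (E0 Q))"
  define g where "g = conv (ptheta_coeff Q) (conv (Ob Q) (E1 Q))"
  have fl: "quasi_periodic Q 5 (- Q) f" "reflective 3 f"
    using quasi_periodic_conv[OF Q(2) ptheta_coeff_laws(1)[OF Q(2)] quasi_periodic_conv[OF Q(2) Ob_laws(1)[OF Q(2)] E0_laws(1)[OF Q(2)]]]
      reflective_conv[OF ptheta_coeff_laws(2)[OF Q(2)] reflective_conv[OF Ob_laws(2)[OF Q(2)] E0_laws(2)[OF Q(2)]]] by (simp_all add: f_def)
  have gl: "quasi_periodic Q 5 (- Q) g" "reflective 3 g"
    using quasi_periodic_conv[OF Q(2) ptheta_coeff_laws(1)[OF Q(2)] quasi_periodic_conv[OF Q(2) Ob_laws(1)[OF Q(2)] E1_laws(1)[OF Q(2)]]]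
      reflective_conv[OF ptheta_coeff_laws(2)[OF Q(2)] reflective_conv[OF Ob_laws(2)[OF Q(2)] E1_laws(2)[OF Q(2)]]] by (simp_all add: g_def)
  note en = ptheta_coeff_laurent(1)[OF Q] Ob_laurent(1)[OF Q] E0_laurent(1)[OF Q] E1_laurent(1)[OF Q]
  have fe: "entire f" "entire g" unfolding f_def g_def by (intro entire_conv en)+
  have fv: "laurent f u = jtheta (- u) Q * jtheta (Q * u\<^sup>2) (Q\<^sup>2) * laurent (E0 Q) u"
    and gv: "laurent g u = jtheta (- u) Q * jtheta (Q * u\<^sup>2) (Q\<^sup>2) * laurent (E1 Q) u" if u: "u \<noteq> 0" for u
    unfolding f_def g_def
    using laurent_conv(2)[OF u entireD[OF en(1) u] entireD[OF entire_conv[OF en(2,3)] u]]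
      laurent_conv(2)[OF u entireD[OF en(1) u] entireD[OF entire_conv[OF en(2,4)] u]]
      laurent_conv(2)[OF u entireD[OF en(2) u] entireD[OF en(3) u]]
      laurent_conv(2)[OF u entireD[OF en(2) u] entireD[OF en(4) u]] ptheta_coeff_laurent(2)[OF Q u] Ob_laurent(2)[OF Q u] by simp_all
  have Q2: "norm (Q\<^sup>2) < 1" "Q\<^sup>2 \<noteq> 0" using sq_norm[OF Q] by auto
  have lt: "norm (Q\<^sup>2) < norm Q"
    using Q mult_strict_left_mono[of "norm Q" 1 "norm Q"] by (simp add: norm_mult power2_eq_square)
  have ne1: "Q \<noteq> 1" "- Q \<noteq> 1" using Q by (metis norm_minus_cancel norm_one less_irrefl)+
  have nz: "jtheta (- \<i>) Q \<noteq> 0" "jtheta (-1) Q \<noteq> 0" "jtheta (- Q) (Q\<^sup>2) \<noteq> 0" "jtheta Q (Q\<^sup>2) \<noteq> 0" "jtheta (-1) (Q\<^sup>2) \<noteq> 0"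
  proof -
    have "- \<i> \<noteq> 1" by (simp add: complex_eq_iff)
    then show "jtheta (- \<i>) Q \<noteq> 0" by (intro jtheta_nonzero Q) (use Q in simp_all)
    show "jtheta (-1) Q \<noteq> 0" by (intro jtheta_nonzero Q) (use Q in simp_all)
    show "jtheta (- Q) (Q\<^sup>2) \<noteq> 0" by (intro jtheta_nonzero Q2) (use Q lt ne1 in simp_all)
    show "jtheta Q (Q\<^sup>2) \<noteq> 0" by (intro jtheta_nonzero Q2) (use Q lt ne1 in simp_all)
    show "jtheta (-1) (Q\<^sup>2) \<noteq> 0" by (intro jtheta_nonzero Q2) (use Q2 in simp_all)
  qed
  have u: "laurent f \<i> = 0" using fv[of \<i>] E0_laurent(2)[OF Q, of \<i>] jtheta_1[OF Q2] by simp
  have v: "laurent g \<i> \<noteq> 0" using gv[of \<i>] E1_laurent(2)[OF Q, of \<i>] nz by simp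
  have w: "laurent f 1 \<noteq> 0" using fv[of 1] E0_laurent(2)[OF Q, of 1] nz by simp
  obtain c0 c1 where yc: "\<And>k. y k = c0 * f k + c1 * g k"
    using theta5_span[OF Q(2) fl gl yq yr fe u v _ w] by auto
  have ye: "(\<lambda>k. y k * u powi k) summable_on UNIV" and
    yv: "laurent y u = jtheta (- u) Q * jtheta (Q * u\<^sup>2) (Q\<^sup>2) * (c0 * laurent (E0 Q) u + c1 * laurent (E1 Q) u)" if u: "u \<noteq> 0" for u
  proof -
    have e: "y k * u powi k = c0 * (f k * u powi k) + c1 * (g k * u powi k)" for k unfolding yc by (simp add: algebra_simps)
    show "(\<lambda>k. y k * u powi k) summable_on UNIV" unfolding e
      by (intro summable_on_add summable_on_cmult_right entireD[OF fe(1) u] entireD[OF fe(2) u])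
    have "laurent y u = c0 * laurent f u + c1 * laurent g u" unfolding laurent_def e
      by (rule infsum_lincomb[OF entireD[OF fe(1) u] entireD[OF fe(2) u]])
    then show "laurent y u = jtheta (- u) Q * jtheta (Q * u\<^sup>2) (Q\<^sup>2) * (c0 * laurent (E0 Q) u + c1 * laurent (E1 Q) u)"
      unfolding fv[OF u] gv[OF u] by (simp add: algebra_simps)
  qed
  have Vy: "V k * u powi k = 1 / u * (y (k + 1) * u powi (k + 1))" if "u \<noteq> 0" for u k
    using that by (simp add: y_def power_int_add)
  have Ve: "(\<lambda>k. V k * u powi k) summable_on UNIV" if u: "u \<noteq> 0" for u
    unfolding Vy[OF u] by (rule summable_on_cmult_right, rule summable_on_int_shift[THEN iffD2, OF ye[OF u]])
  have Vl: "laurent y u = u * laurent V u" if u: "u \<noteq> 0" for u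
    unfolding laurent_def Vy[OF u] infsum_cmult_right' infsum_int_shift[of "\<lambda>k. y k * u powi k" 1] using u by simp
  define d where "d = conv (theta_coeff Q) (appell_diff Q)"
  have dV: "d k = V k - V (k - 1)" for k
  proof -
    have "V (k - 1) = (\<Sum>\<^sub>\<infinity>s. theta_coeff Q (k - 1 - (s + (-1))) * appell_coeff Q (s + (-1)))"
      unfolding V_def conv_def by (rule infsum_int_shift[symmetric])
    then have V1: "V (k - 1) = (\<Sum>\<^sub>\<infinity>s. theta_coeff Q (k - s) * appell_coeff Q (s - 1))" by simp
    have s1: "(\<lambda>s. theta_coeff Q (k - s) * appell_coeff Q (s - 1)) summable_on UNIV" by (rule conv_summand[OF pS B])
    have "d k = (\<Sum>\<^sub>\<infinity>s. 1 * (theta_coeff Q (k - s) * appell_coeff Q s) + (-1) * (theta_coeff Q (k - s) * appell_coeff Q (s - 1)))"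
      unfolding d_def conv_def appell_diff_def by (rule infsum_cong) (simp add: algebra_simps)
    also have "\<dots> = 1 * V k + (-1) * V (k - 1)" unfolding V1 unfolding V_def conv_def by (rule infsum_lincomb[OF Vs s1])
    finally show ?thesis by simp
  qed
  have main: "jtheta u Q * appell u Q = laurent V u" if u: "u \<in> annulus Q" "u \<noteq> 1" for u
  proof -
    note u' = annulusD[OF u(1)]
    have "laurent d u = jtheta u Q * ((1 - u) * (appell_half Q u - appell_half Q (1 / u)) + 1 + u)"
      using laurent_conv(2)[OF u'(1) entireD[OF theta_coeff_summable[OF Q] u'(1)] has_sum_imp_summable[OF appell_diff_has_sum[OF Q(1) u(1)]]]
        infsumI[OF appell_diff_has_sum[OF Q(1) u(1)]] by (simp add: d_def jtheta_def laurent_def)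
    also have "(1 - u) * (appell_half Q u - appell_half Q (1 / u)) + 1 + u = (1 - u) * appell u Q"
      unfolding appell_split[OF Q u(1)] using u(2) by (simp add: field_simps)
    finally have 1: "laurent d u = (1 - u) * (jtheta u Q * appell u Q)" by simp
    have "laurent d u = (\<Sum>\<^sub>\<infinity>k. 1 * (V k * u powi k) + (- u) * (V (k + (-1)) * u powi (k + (-1))))"
      unfolding laurent_def dV using u'(1) by (intro infsum_cong) (simp add: power_int_diff algebra_simps)
    also have "\<dots> = 1 * laurent V u + (- u) * laurent V u"
      unfolding laurent_def
      by (subst infsum_lincomb[OF Ve[OF u'(1)] summable_on_int_shift[THEN iffD2, OF Ve[OF u'(1)]]])
        (simp only: infsum_int_shift[of "\<lambda>k. V k * u powi k" "-1"])
    finally have "(1 - u) * laurent V u = (1 - u) * (jtheta u Q * appell u Q)" using 1 by (simp add: algebra_simps)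
    then show ?thesis using u(2) by simp
  qed
  have const: "laurent V 1 = 2 * (qinf Q Q) ^ 3"
  proof -
    have V1: "V summable_on UNIV" using Ve[of 1] by simp
    have kV: "(\<lambda>k. of_int k * V k) summable_on UNIV"
      by (rule entire_times_index) (use Ve in \<open>simp add: entire_def\<close>)
    have kp: "(\<lambda>k. of_int k * theta_coeff Q k) summable_on UNIV" by (rule entire_times_index[OF theta_coeff_summable[OF Q]])
    \<comment> \<open>Two points of the annulus on either side of the unit circle, for summable_times_index.\<close>
    obtain x where x: "1 < x" "x < 1 / norm Q" using dense[of 1 "1 / norm Q"] Q by auto
    have xa: "complex_of_real x \<in> annulus Q" "complex_of_real (1 / x) \<in> annulus Q" "1 \<in> annulus Q"
    proof -
      have 1: "x * norm Q < 1" using x Q by (simp add: field_simps)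
      have 2: "norm Q / x < 1" using x Q by (simp add: divide_less_eq)
      have "norm Q < 1 / x" using 1 x by (simp add: field_simps)
      then show "complex_of_real x \<in> annulus Q" "complex_of_real (1 / x) \<in> annulus Q" "1 \<in> annulus Q"
        using 1 2 x Q by (auto simp: annulus_def norm_mult norm_divide)
    qed
    have k1: "appell_diff Q summable_on UNIV" "infsum (appell_diff Q) UNIV = 2"
      using appell_diff_has_sum[OF Q(1) xa(3)] by (auto simp: has_sum_iff)
    have kk: "(\<lambda>k. of_int k * appell_diff Q k) summable_on UNIV"
      by (rule summable_times_index[OF x(1)]) (use appell_diff_has_sum[OF Q(1) xa(1)] appell_diff_has_sum[OF Q(1) xa(2)] has_sum_imp_summable in blast)+
    have c1: "conv (\<lambda>k. of_int k * theta_coeff Q k) (appell_diff Q) summable_on UNIV"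
      "infsum (conv (\<lambda>k. of_int k * theta_coeff Q k) (appell_diff Q)) UNIV = - ((qinf Q Q) ^ 3) * 2"
      using conv_has_sum[OF kp k1(1)] unfolding sum_index_theta_coeff[OF Q] k1(2) by (auto simp: has_sum_iff)
    have c2: "conv (theta_coeff Q) (\<lambda>k. of_int k * appell_diff Q k) summable_on UNIV"
      "infsum (conv (theta_coeff Q) (\<lambda>k. of_int k * appell_diff Q k)) UNIV = 0"
      using conv_has_sum[OF pS kk] unfolding p0 by (auto simp: has_sum_iff)
    have bd: "\<exists>B. \<forall>s. norm (a s) \<le> B" if "a summable_on UNIV" for a :: "int \<Rightarrow> complex"
    proof -
      have "(\<lambda>s. norm (a s)) summable_on UNIV" using that by (simp flip: summable_on_iff_abs_summable_on_complex)
      then have "norm (a s) \<le> (\<Sum>\<^sub>\<infinity>s. norm (a s))" for s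
        using finite_sum_le_infsum[of "\<lambda>s. norm (a s)" UNIV "{s}"] by simp
      then show ?thesis by blast
    qed
    obtain B1 where B1: "\<And>s. norm (appell_diff Q s) \<le> B1" using bd[OF k1(1)] by blast
    obtain B2 where B2: "\<And>s. norm (of_int s * appell_diff Q s) \<le> B2" using bd[OF kk] by blast
    have kd: "of_int k * d k = conv (\<lambda>k. of_int k * theta_coeff Q k) (appell_diff Q) k + conv (theta_coeff Q) (\<lambda>k. of_int k * appell_diff Q k) k" for k
    proof -
      have "of_int k * d k = (\<Sum>\<^sub>\<infinity>s. 1 * ((of_int (k - s) * theta_coeff Q (k - s)) * appell_diff Q s) + 1 * (theta_coeff Q (k - s) * (of_int s * appell_diff Q s)))"
        unfolding d_def conv_def infsum_cmult_right'[symmetric] by (rule infsum_cong) (simp add: algebra_simps)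
      also have "\<dots> = 1 * conv (\<lambda>k. of_int k * theta_coeff Q k) (appell_diff Q) k + 1 * conv (theta_coeff Q) (\<lambda>k. of_int k * appell_diff Q k) k"
        unfolding conv_def by (rule infsum_lincomb) (rule conv_summand[OF kp B1], rule conv_summand[OF pS B2])
      finally show ?thesis by simp
    qed
    have "(\<Sum>\<^sub>\<infinity>k. of_int k * d k) = - ((qinf Q Q) ^ 3) * 2"
      unfolding kd using infsum_add[OF c1(1) c2(1)] c1(2) c2(2) by simp
    moreover have "(\<Sum>\<^sub>\<infinity>k. of_int k * d k) = - infsum V UNIV"
    proof -
      have sh: "(\<lambda>k. of_int (k + (-1)) * V (k + (-1))) summable_on UNIV" "(\<lambda>k. V (k + (-1))) summable_on UNIV"
        by (rule summable_on_int_shift[THEN iffD2, OF kV], rule summable_on_int_shift[THEN iffD2, OF V1])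
      have "(\<Sum>\<^sub>\<infinity>k. of_int k * d k) = (\<Sum>\<^sub>\<infinity>k. 1 * (of_int k * V k) + (-1) * (1 * (of_int (k + (-1)) * V (k + (-1))) + 1 * V (k + (-1))))"
        unfolding dV by (rule infsum_cong) (simp add: algebra_simps)
      also have "\<dots> = 1 * (\<Sum>\<^sub>\<infinity>k. of_int k * V k) + (-1) * (\<Sum>\<^sub>\<infinity>k. 1 * (of_int (k + (-1)) * V (k + (-1))) + 1 * V (k + (-1)))"
        by (rule infsum_lincomb[OF kV]) (intro summable_on_add summable_on_cmult_right sh)
      also have "(\<Sum>\<^sub>\<infinity>k. 1 * (of_int (k + (-1)) * V (k + (-1))) + 1 * V (k + (-1)))
         = 1 * (\<Sum>\<^sub>\<infinity>k. of_int (k + (-1)) * V (k + (-1))) + 1 * (\<Sum>\<^sub>\<infinity>k. V (k + (-1)))"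
        by (rule infsum_lincomb[OF sh])
      also have "(\<Sum>\<^sub>\<infinity>k. of_int (k + (-1)) * V (k + (-1))) = (\<Sum>\<^sub>\<infinity>k. of_int k * V k)" by (rule infsum_int_shift)
      also have "(\<Sum>\<^sub>\<infinity>k. V (k + (-1))) = infsum V UNIV" by (rule infsum_int_shift)
      finally show ?thesis by simp
    qed
    ultimately show ?thesis by (simp add: laurent_def)
  qed
  show thesis
  proof (rule that[of c0 c1])
    fix u assume u: "u \<in> annulus Q" "u \<noteq> 1"
    show "u * (jtheta u Q * appell u Q) = jtheta (- u) Q * jtheta (Q * u\<^sup>2) (Q\<^sup>2) * (c0 * laurent (E0 Q) u + c1 * laurent (E1 Q) u)"
      unfolding main[OF u] Vl[OF annulusD(1)[OF u(1)], symmetric] by (rule yv[OF annulusD(1)[OF u(1)]])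
  next
    show "jtheta (-1) Q * jtheta Q (Q\<^sup>2) * (c0 * laurent (E0 Q) 1 + c1 * laurent (E1 Q) 1) = 2 * (qinf Q Q) ^ 3"
      using yv[of 1] Vl[of 1] const by simp
  qed
qed

section \<open>Values of the Appell series on the imaginary axis\<close>

lemma gauss_summable:
  fixes Q :: complex
  assumes Q: "norm Q < 1" "Q \<noteq> 0" shows "(\<lambda>s. Q powi (2 * s * s + m * s)) summable_on UNIV"
proof -
  have Q4: "norm (Q ^ 4) < 1" "Q ^ 4 \<noteq> 0" using Q norm_lt_1_power[OF Q(1), of 4] by auto
  have "theta_coeff (Q ^ 4) s * (- (Q powi (m + 2))) powi s = Q powi (2 * s * s + m * s)" for s
  proof -
    have "(- (Q powi (m + 2))) powi s = msgn s * Q powi ((m + 2) * s)"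
      using power_int_mult_distrib[of "-1" "Q powi (m + 2)" s] by (simp add: msgn_powi power_int_mult)
    then have "theta_coeff (Q ^ 4) s * (- (Q powi (m + 2))) powi s = (msgn s * msgn s) * (Q powi (4 * tri s) * Q powi ((m + 2) * s))"
      by (simp add: theta_coeff_def power_int_power)
    also have "\<dots> = Q powi (4 * tri s + (m + 2) * s)" using Q by (simp add: power_int_add)
    also have "4 * tri s + (m + 2) * s = 2 * s * s + m * s" using tri_double[of s] by (simp add: algebra_simps)
    finally show ?thesis .
  qed
  moreover have "- (Q powi (m + 2)) \<noteq> 0" using Q by simp
  ultimately show ?thesis using entireD[OF theta_coeff_summable[OF Q4], of "- (Q powi (m + 2))"] by simp
qed

lemma recip_plus_bounded:
  fixes Q :: complex
  assumes Q: "norm Q < 1" "Q \<noteq> 0" shows "norm (1 / (1 + Q powi k)) \<le> 1 / (1 - norm Q)"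
proof (cases "k = 0")
  case True
  have "1 \<le> 1 / (1 - norm Q)" using Q by simp
  moreover have "norm (1 / (1 + Q powi k)) \<le> 1" using True by simp
  ultimately show ?thesis by linarith
next
  case False
  then show ?thesis using norm_recip_bound[OF Q, of "-1" k] by simp
qed

lemma plus_nonzero:
  fixes Q :: complex
  assumes Q: "norm Q < 1" "Q \<noteq> 0" shows "1 + Q powi k \<noteq> 0"
  using powi_ne[OF Q, of "-1" k] by (cases "k = 0") auto

text \<open>
  Separation of the even and the odd part in w.
\<close>

lemma mobius_split:
  fixes w :: complex assumes "1 + w\<^sup>2 \<noteq> 0"
  shows "(1 + \<i> * w) / (1 - \<i> * w) = (1 - w\<^sup>2) / (1 + w\<^sup>2) + 2 * \<i> * w / (1 + w\<^sup>2)"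
proof -
  have e: "1 + w\<^sup>2 = (1 - \<i> * w) * (1 + \<i> * w)" by (simp add: algebra_simps power2_eq_square)
  then have nz: "1 - \<i> * w \<noteq> 0" "1 + \<i> * w \<noteq> 0" using assms by auto
  have "(1 - w\<^sup>2) + 2 * \<i> * w = (1 + \<i> * w) * (1 + \<i> * w)" by (simp add: algebra_simps power2_eq_square)
  then show ?thesis unfolding add_divide_distrib[symmetric] using nz by (simp add: e)
qed

text \<open>
  By mobius_split every summand is a sum of two parts; the first one is antisymmetric under
  s \<mapsto> - m - s, so only the second one survives.
\<close>

lemma appell_imaginary:
  assumes Q: "norm Q < 1" "Q \<noteq> 0" and v: "v \<noteq> 0" "v\<^sup>2 = Q powi m"
  shows "appell (\<i> * v) Q = \<i> * v * (\<Sum>\<^sub>\<infinity>s. 2 * Q powi (2 * s * s + (2 * m + 1) * s) / (1 + Q powi (2 * s + m)))"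
proof -
  define f where "f = (\<lambda>s. Q powi (2 * s * s + (2 * m) * s) * ((1 - Q powi (2 * s + m)) / (1 + Q powi (2 * s + m))))"
  define g where "g = (\<lambda>s. 2 * Q powi (2 * s * s + (2 * m + 1) * s) / (1 + Q powi (2 * s + m)))"
  note nz = plus_nonzero[OF Q]
  have t: "Q powi (2 * s * s) * (\<i> * v) powi (4 * s) * (1 + (\<i> * v) * Q powi s) / (1 - (\<i> * v) * Q powi s)
      = 1 * f s + (\<i> * v) * g s" for s
  proof -
    define w where "w = v * Q powi s"
    have w2: "w\<^sup>2 = Q powi (2 * s + m)"
    proof -
      have "w\<^sup>2 = v\<^sup>2 * (Q powi s * Q powi s)" by (simp add: w_def power2_eq_square mult_ac)
      also have "\<dots> = Q powi (2 * s + m)" unfolding v(2) using Q by (simp add: algebra_simps flip: power_int_add)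
      finally show ?thesis .
    qed
    have "(\<i> * v) ^ 4 = (v\<^sup>2)\<^sup>2" by (simp add: power_mult_distrib flip: power_mult)
    then have "(\<i> * v) powi (4 * s) = ((v\<^sup>2)\<^sup>2) powi s" using power_int_power[of "\<i> * v" 4 s] by simp
    also have "\<dots> = Q powi (2 * m * s)" unfolding v(2) by (simp add: power_int_power' power_int_mult mult.commute flip: power_int_mult)
    finally have p4: "(\<i> * v) powi (4 * s) = Q powi (2 * m * s)" .
    have p5: "Q powi (2 * s * s) * Q powi (2 * m * s) = Q powi (2 * s * s + (2 * m) * s)" using Q by (simp add: power_int_add)
    have p6: "Q powi (2 * s * s + (2 * m + 1) * s) = Q powi (2 * s * s + (2 * m) * s) * Q powi s"
      using Q by (simp add: algebra_simps flip: power_int_add)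
    have "1 + w\<^sup>2 \<noteq> 0" unfolding w2 by (rule nz)
    from mobius_split[OF this] have "(1 + \<i> * v * Q powi s) / (1 - \<i> * v * Q powi s) = (1 - w\<^sup>2) / (1 + w\<^sup>2) + 2 * \<i> * w / (1 + w\<^sup>2)"
      by (simp add: w_def mult.assoc)
    then have "Q powi (2 * s * s) * (\<i> * v) powi (4 * s) * ((1 + (\<i> * v) * Q powi s) / (1 - (\<i> * v) * Q powi s))
       = Q powi (2 * s * s + (2 * m) * s) * ((1 - w\<^sup>2) / (1 + w\<^sup>2) + 2 * \<i> * w / (1 + w\<^sup>2))"
      by (simp only: p4 p5)
    also have "\<dots> = f s + (\<i> * v) * g s" unfolding f_def g_def p6 w2 by (simp add: w_def distrib_left mult_ac)
    finally show ?thesis by simp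
  qed
  have fs: "f summable_on UNIV" unfolding f_def
  proof (rule summable_mult_bounded[OF gauss_summable[OF Q]])
    fix s
    have e: "(1 - Q powi (2 * s + m)) / (1 + Q powi (2 * s + m)) = 2 * (1 / (1 + Q powi (2 * s + m))) - 1"
      using nz[of "2 * s + m"] by (simp add: divide_simps)
    have "norm (2 * (1 / (1 + Q powi (2 * s + m))) - 1) \<le> norm (2 * (1 / (1 + Q powi (2 * s + m)))) + norm (1::complex)" by (rule norm_triangle_ineq4)
    also have "\<dots> \<le> 2 * (1 / (1 - norm Q)) + 1" using recip_plus_bounded[OF Q, of "2 * s + m"] by (simp add: norm_mult norm_divide)
    finally show "norm ((1 - Q powi (2 * s + m)) / (1 + Q powi (2 * s + m))) \<le> 2 * (1 / (1 - norm Q)) + 1" unfolding e .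
  qed
  have gs: "g summable_on UNIV"
  proof -
    have "(\<lambda>s. Q powi (2 * s * s + (2 * m + 1) * s) * (2 * (1 / (1 + Q powi (2 * s + m))))) summable_on UNIV"
    proof (rule summable_mult_bounded[OF gauss_summable[OF Q], where B = "2 * (1 / (1 - norm Q))"])
      show "norm (2 * (1 / (1 + Q powi (2 * s + m)))) \<le> 2 * (1 / (1 - norm Q))" for s
        using mult_left_mono[OF recip_plus_bounded[OF Q, of "2 * s + m"], of 2] by (simp only: norm_mult norm_numeral zero_le_numeral)
    qed
    then show ?thesis by (simp add: g_def mult_ac)
  qed
  have f0: "infsum f UNIV = 0"
  proof (rule infsum_antisym[where a = "- m"])
    fix s
    define X where "X = Q powi (2 * s + m)"
    have X: "X \<noteq> 0" "1 + X \<noteq> 0" using Q nz[of "2 * s + m"] by (auto simp: X_def)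
    have e1: "2 * (- m - s) * (- m - s) + 2 * m * (- m - s) = 2 * s * s + 2 * m * s" by (simp add: algebra_simps)
    have "2 * (- m - s) + m = - (2 * s + m)" by simp
    then have e2: "Q powi (2 * (- m - s) + m) = 1 / X" by (simp only: X_def power_int_minus_divide)
    have "(1 - 1 / X) / (1 + 1 / X) = - ((1 - X) / (1 + X))" using X by (simp add: divide_simps) (simp add: algebra_simps)
    then show "f (- m - s) = - f s" unfolding f_def e1 e2 X_def[symmetric] by simp
  qed
  have "appell (\<i> * v) Q = 1 * infsum f UNIV + (\<i> * v) * infsum g UNIV"
    unfolding appell_def t by (rule infsum_lincomb[OF fs gs])
  then show ?thesis unfolding f0 g_def by simp
qed

section \<open>Theta products\<close>

lemma Theta_qinf: "Theta m q = qinf (q ^ m) (q ^ m)"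
  unfolding Theta_def qinf_def by (intro prodinf_cong) (simp add: power_mult[symmetric] power_add[symmetric] algebra_simps)

lemma Theta_nonzero: assumes "norm q < 1" "m > 0" shows "Theta m q \<noteq> 0"
  unfolding Theta_qinf by (intro qinf_self_nonzero norm_lt_1_power assms)

text \<open>
  R6 and S3 are the products of 1 - x^n over all n prime to 6 and to 3, and R6m and S3m are those of
  1 + x^n over the same n.
\<close>

definition R6 :: "complex \<Rightarrow> complex" where "R6 x = qinf x (x ^ 6) * qinf (x ^ 5) (x ^ 6)"
definition S3 :: "complex \<Rightarrow> complex" where "S3 x = qinf x (x ^ 3) * qinf (x\<^sup>2) (x ^ 3)"
definition R6m :: "complex \<Rightarrow> complex" where "R6m x = qinf (- x) (x ^ 6) * qinf (- (x ^ 5)) (x ^ 6)"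
definition S3m :: "complex \<Rightarrow> complex" where "S3m x = qinf (- x) (x ^ 3) * qinf (- (x\<^sup>2)) (x ^ 3)"

text \<open>
  Sieving the multiples of 2 and 3 out of the Euler product.
\<close>

lemma R6_theta:
  assumes x: "norm x < 1"
  shows "R6 x * qinf (x ^ 2) (x ^ 2) * qinf (x ^ 3) (x ^ 3) = qinf x x * qinf (x ^ 6) (x ^ 6)"
proof -
  have n: "norm (x\<^sup>2) < 1" "norm (x ^ 3) < 1" using norm_lt_1_power[OF x] by simp_all
  have a: "qinf x x = qinf x (x\<^sup>2) * qinf (x ^ 2) (x ^ 2)" using qinf_split2[OF x, of x] by (simp add: power2_eq_square)
  have b: "qinf x (x\<^sup>2) = qinf x (x ^ 6) * qinf (x ^ 3) (x ^ 6) * qinf (x ^ 5) (x ^ 6)"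
    using qinf_split3[OF n(1), of x] by (simp flip: power_mult power_Suc2 power_Suc)
  have c: "qinf (x ^ 3) (x ^ 3) = qinf (x ^ 3) (x ^ 6) * qinf (x ^ 6) (x ^ 6)"
    using qinf_split2[OF n(2), of "x ^ 3"] by (simp flip: power_mult power_add)
  show ?thesis unfolding a b c R6_def by (simp add: mult_ac)
qed

lemma S3_theta: assumes x: "norm x < 1" shows "S3 x * qinf (x ^ 3) (x ^ 3) = qinf x x"
  using qinf_split3[OF x, of x] unfolding S3_def by (simp add: power2_eq_square power3_eq_cube)

lemma R6m_theta: assumes x: "norm x < 1" shows "R6 x * R6m x = R6 (x\<^sup>2)"
proof -
  have n: "norm (x ^ 6) < 1" using norm_lt_1_power[OF x] by simp
  have e: "(x\<^sup>2) ^ 6 = (x ^ 6)\<^sup>2" "(x\<^sup>2) ^ 5 = (x ^ 5)\<^sup>2" by (simp_all flip: power_mult)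
  show ?thesis unfolding R6_def R6m_def e qinf_square[OF n] by (simp only: mult_ac)
qed

lemma S3m_theta: assumes x: "norm x < 1" shows "S3 x * S3m x = S3 (x\<^sup>2)"
proof -
  have n: "norm (x ^ 3) < 1" using norm_lt_1_power[OF x] by simp
  have e: "(x\<^sup>2) ^ 3 = (x ^ 3)\<^sup>2" by (simp flip: power_mult)
  show ?thesis unfolding S3_def S3m_def e qinf_square[OF n] by (simp add: mult_ac)
qed

text \<open>
  Each product in the triple product at u^2 is split into even and odd powers of Q, and
  1 - Q^(2n) u^2 = (1 - Q^n u)(1 + Q^n u).
\<close>

lemma jtheta_double:
  assumes Q: "norm Q < 1" "Q \<noteq> 0" and u: "u \<noteq> 0"
  shows "jtheta (u\<^sup>2) Q * (qinf Q Q * qinf (Q\<^sup>2) (Q\<^sup>2)) = jtheta u Q * (jtheta (- u) Q * jtheta (Q * u\<^sup>2) (Q\<^sup>2))"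
proof -
  have Q2: "norm (Q\<^sup>2) < 1" "Q\<^sup>2 \<noteq> 0" using sq_norm[OF Q] by auto
  have a: "qinf (u\<^sup>2) Q = qinf u Q * qinf (- u) Q * qinf (Q * u\<^sup>2) (Q\<^sup>2)"
    using qinf_split2[OF Q(1), of "u\<^sup>2"] qinf_square[OF Q(1), of u] by simp
  have sq: "Q * (Q / u\<^sup>2) = (Q / u)\<^sup>2" by (simp add: power2_eq_square power_divide)
  have b: "qinf (Q / u\<^sup>2) Q = qinf (Q / u\<^sup>2) (Q\<^sup>2) * (qinf (Q / u) Q * qinf (- (Q / u)) Q)"
    using qinf_split2[OF Q(1), of "Q / u\<^sup>2"] qinf_square[OF Q(1), of "Q / u"] unfolding sq by simp
  have c: "Q\<^sup>2 / (Q * u\<^sup>2) = Q / u\<^sup>2" using Q by (simp add: power2_eq_square)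
  have d: "Q / - u = - (Q / u)" by simp
  have nz: "u\<^sup>2 \<noteq> 0" "- u \<noteq> 0" "Q * u\<^sup>2 \<noteq> 0" using u Q by auto
  show ?thesis unfolding jacobi_triple[OF Q u] jacobi_triple[OF Q nz(1)] jacobi_triple[OF Q nz(2)] jacobi_triple[OF Q2 nz(3)] a b c d
    by (simp add: mult_ac)
qed

text \<open>
  The factor jtheta (- u) Q * jtheta (Q u^2) (Q^2) in appell_theta is replaced by the quotient of
  jtheta (u^2) Q and jtheta u Q with the help of jtheta_double.
\<close>

lemma appell_quotient:
  assumes Q: "norm Q < 1" "Q \<noteq> 0"
  obtains c0 c1 where
    "\<And>u. norm Q < norm u \<Longrightarrow> norm u \<le> 1 \<Longrightarrow> u \<noteq> 1 \<Longrightarrow>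
       u * appell u Q * (jtheta u Q)\<^sup>2 = jtheta (u\<^sup>2) Q * (qinf Q Q * qinf (Q\<^sup>2) (Q\<^sup>2)) * (c0 * laurent (E0 Q) u + c1 * laurent (E1 Q) u)"
    "(qinf Q Q * qinf (Q\<^sup>2) (Q\<^sup>2)) * (c0 * laurent (E0 Q) 1 + c1 * laurent (E1 Q) 1) = (qinf Q Q) ^ 3"
    "jtheta (-1) Q = 2 * (qinf (- Q) Q)\<^sup>2 * qinf Q Q"
    "qinf (- Q) Q * qinf Q (Q\<^sup>2) = 1"
proof -
  obtain c0 c1 where c: "\<And>u. u \<in> annulus Q \<Longrightarrow> u \<noteq> 1 \<Longrightarrow>
       u * (jtheta u Q * appell u Q) = jtheta (- u) Q * jtheta (Q * u\<^sup>2) (Q\<^sup>2) * (c0 * laurent (E0 Q) u + c1 * laurent (E1 Q) u)"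
    and k: "jtheta (-1) Q * jtheta Q (Q\<^sup>2) * (c0 * laurent (E0 Q) 1 + c1 * laurent (E1 Q) 1) = 2 * (qinf Q Q) ^ 3"
    using appell_theta[OF Q] by metis
  have Q2: "norm (Q\<^sup>2) < 1" "Q\<^sup>2 \<noteq> 0" using sq_norm[OF Q] by auto
  have j1: "jtheta (-1) Q = 2 * (qinf (- Q) Q)\<^sup>2 * qinf Q Q"
    using jacobi_triple[OF Q, of "-1"] qinf_Suc[OF Q(1), of "-1"] by (simp add: power2_eq_square)
  have j2: "jtheta Q (Q\<^sup>2) = (qinf Q (Q\<^sup>2))\<^sup>2 * qinf (Q\<^sup>2) (Q\<^sup>2)"
    using jacobi_triple[OF Q2 Q(2)] Q(2) by (simp add: power2_eq_square)
  have pr: "qinf (- Q) Q * qinf Q (Q\<^sup>2) = 1"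
  proof -
    have "qinf (Q\<^sup>2) (Q\<^sup>2) = (qinf (- Q) Q * qinf Q (Q\<^sup>2)) * qinf (Q\<^sup>2) (Q\<^sup>2)"
      using qinf_square[OF Q(1), of Q] qinf_split2[OF Q(1), of Q] by (simp add: power2_eq_square mult_ac)
    then show ?thesis using qinf_self_nonzero[OF Q2(1)] by simp
  qed
  have "jtheta (-1) Q * jtheta Q (Q\<^sup>2) = 2 * (qinf (- Q) Q * qinf Q (Q\<^sup>2))\<^sup>2 * (qinf Q Q * qinf (Q\<^sup>2) (Q\<^sup>2))"
    unfolding j1 j2 by (simp add: power_mult_distrib mult_ac)
  then have jj: "jtheta (-1) Q * jtheta Q (Q\<^sup>2) = 2 * (qinf Q Q * qinf (Q\<^sup>2) (Q\<^sup>2))" unfolding pr by simp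
  show thesis
  proof (rule that[of c0 c1, OF _ _ j1 pr])
    show "(qinf Q Q * qinf (Q\<^sup>2) (Q\<^sup>2)) * (c0 * laurent (E0 Q) 1 + c1 * laurent (E1 Q) 1) = (qinf Q Q) ^ 3"
      using k unfolding jj by (simp add: mult.assoc)
    fix u :: complex assume u: "norm Q < norm u" "norm u \<le> 1" "u \<noteq> 1"
    have "norm u * norm Q \<le> 1 * norm Q" using u by (intro mult_right_mono) auto
    then have "norm u * norm Q < 1" using Q by linarith
    then have "u \<in> annulus Q" using u Q by (simp add: annulus_def norm_mult)
    note cu = c[OF this u(3)]
    have u0: "u \<noteq> 0" using u by auto
    have "u * appell u Q * (jtheta u Q)\<^sup>2 = jtheta u Q * (u * (jtheta u Q * appell u Q))" by (simp add: power2_eq_square mult_ac)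
    also have "\<dots> = jtheta (u\<^sup>2) Q * (qinf Q Q * qinf (Q\<^sup>2) (Q\<^sup>2)) * (c0 * laurent (E0 Q) u + c1 * laurent (E1 Q) u)"
      unfolding cu jtheta_double[OF Q u0] by (simp only: mult.assoc)
    finally show "u * appell u Q * (jtheta u Q)\<^sup>2 = jtheta (u\<^sup>2) Q * (qinf Q Q * qinf (Q\<^sup>2) (Q\<^sup>2)) * (c0 * laurent (E0 Q) u + c1 * laurent (E1 Q) u)" .
  qed
qed

lemma mu2_appell:
  assumes Q: "norm Q < 1" "Q \<noteq> 0"
  shows "mu2 Q = - (qinf Q (Q\<^sup>2) / qinf (Q\<^sup>2) (Q\<^sup>2)) * (\<i> * appell \<i> Q)"
proof -
  have "appell \<i> Q = \<i> * (\<Sum>\<^sub>\<infinity>s. 2 * Q powi (2 * s * s + s) / (1 + Q powi (2 * s)))"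
    using appell_imaginary[OF Q, of 1 0] by simp
  then have "- (\<i> * appell \<i> Q) = (\<Sum>\<^sub>\<infinity>s. 2 * Q powi (2 * s * s + s) / (1 + Q powi (2 * s)))" by simp
  then show ?thesis unfolding mu2_lambert[OF Q] by (metis mult_minus_left mult_minus_right)
qed

text \<open>
  Replacing q by - Q in A2_lambert gives the denominator 1 - X^2 with X = Q^(2s+1).  In its partial
  fractions, the part with 1 - X is antisymmetric under s \<mapsto> - 1 - s and sums to zero.
\<close>

lemma A2_appell:
  assumes Q: "norm Q < 1" "Q \<noteq> 0" and r: "r\<^sup>2 = Q"
  shows "2 * A2 (- Q) = qinf Q (Q\<^sup>2) / qinf (Q\<^sup>2) (Q\<^sup>2) * (\<i> * r * appell (\<i> * r) Q) / 2"
proof -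
  have r0: "r \<noteq> 0" using r Q by auto
  define G where "G = (\<Sum>\<^sub>\<infinity>s. Q powi (2 * s * s + 3 * s + 1) / (1 + Q powi (2 * s + 1)))"
  have "appell (\<i> * r) Q = \<i> * r * (\<Sum>\<^sub>\<infinity>s. 2 * Q powi (2 * s * s + (2 * 1 + 1) * s) / (1 + Q powi (2 * s + 1)))"
    by (rule appell_imaginary[OF Q r0]) (simp add: r)
  then have "\<i> * r * appell (\<i> * r) Q = - (r\<^sup>2 * (\<Sum>\<^sub>\<infinity>s. 2 * Q powi (2 * s * s + 3 * s) / (1 + Q powi (2 * s + 1))))"
    by (simp add: power2_eq_square mult_ac)
  also have "r\<^sup>2 * (\<Sum>\<^sub>\<infinity>s. 2 * Q powi (2 * s * s + 3 * s) / (1 + Q powi (2 * s + 1))) = 2 * G"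
    unfolding G_def r infsum_cmult_right'[symmetric]
    by (rule infsum_cong) (use Q in \<open>simp add: power_int_add\<close>)
  finally have K: "\<i> * r * appell (\<i> * r) Q = - 2 * G" by simp
  have mQ: "norm (- Q) < 1" "- Q \<noteq> 0" using Q by auto
  have odd: "2 * s + 1 \<noteq> 0" for s :: int by presburger
  have nz: "1 + Q powi (2 * s + 1) \<noteq> 0" "1 - Q powi (2 * s + 1) \<noteq> 0" for s
    using plus_nonzero[OF Q, of "2 * s + 1"] powi_ne[OF Q, of 1 "2 * s + 1"] odd[of s] by auto
  have "(\<Sum>\<^sub>\<infinity>s. msgn s * (- Q) powi (2 * s * s + 3 * s + 1) / (1 - (- Q) powi (4 * s + 2)))
    = (\<Sum>\<^sub>\<infinity>s. (-1/2) * (Q powi (2 * s * s + 3 * s + 1) / (1 + Q powi (2 * s + 1))) + (-1/2) * (Q powi (2 * s * s + 3 * s + 1) / (1 - Q powi (2 * s + 1))))"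
  proof (rule infsum_cong)
    fix s
    have mp: "(- Q) powi k = msgn k * Q powi k" for k
      using power_int_mult_distrib[of "-1" Q k] by (simp add: msgn_powi)
    have m1: "msgn s * (- Q) powi (2 * s * s + 3 * s + 1) = - (Q powi (2 * s * s + 3 * s + 1))"
      unfolding mp by (auto simp: msgn_def)
    have "(- Q) powi (4 * s + 2) = Q powi ((2 * s + 1) + (2 * s + 1))" unfolding mp by (simp add: msgn_def)
    also have "\<dots> = Q powi (2 * s + 1) * Q powi (2 * s + 1)" by (rule power_int_add) (use Q in simp)
    finally have m2: "1 - (- Q) powi (4 * s + 2) = (1 + Q powi (2 * s + 1)) * (1 - Q powi (2 * s + 1))" by (simp add: algebra_simps)
    have "- E / ((1 + X) * (1 - X)) = (-1/2) * (E / (1 + X)) + (-1/2) * (E / (1 - X))" if "1 + X \<noteq> 0" "1 - X \<noteq> 0" for E X :: complex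
    proof -
      have "E / (1 + X) + E / (1 - X) = (E * (1 - X) + E * (1 + X)) / ((1 + X) * (1 - X))" by (rule add_frac_eq[OF that])
      also have "E * (1 - X) + E * (1 + X) = 2 * E" by (simp add: algebra_simps)
      finally have "(-1/2) * (E / (1 + X) + E / (1 - X)) = - E / ((1 + X) * (1 - X))" by simp
      then show ?thesis by (simp only: distrib_left)
    qed
    from this[OF nz] show "msgn s * (- Q) powi (2 * s * s + 3 * s + 1) / (1 - (- Q) powi (4 * s + 2))
       = (-1/2) * (Q powi (2 * s * s + 3 * s + 1) / (1 + Q powi (2 * s + 1))) + (-1/2) * (Q powi (2 * s * s + 3 * s + 1) / (1 - Q powi (2 * s + 1)))"
      unfolding m1 m2 .
  qed
  also have "\<dots> = (-1/2) * G + (-1/2) * (\<Sum>\<^sub>\<infinity>s. Q powi (2 * s * s + 3 * s + 1) / (1 - Q powi (2 * s + 1)))"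
    unfolding G_def
  proof (rule infsum_lincomb)
    have gs: "(\<lambda>s. Q powi (2 * s * s + 3 * s + 1)) summable_on UNIV"
      using summable_on_cmult_left[OF gauss_summable[OF Q, of 3], of Q] Q by (simp add: power_int_add)
    show "(\<lambda>s. Q powi (2 * s * s + 3 * s + 1) / (1 + Q powi (2 * s + 1))) summable_on UNIV"
      using summable_mult_bounded[OF gs, of "\<lambda>s. 1 / (1 + Q powi (2 * s + 1))"] recip_plus_bounded[OF Q] by fastforce
    show "(\<lambda>s. Q powi (2 * s * s + 3 * s + 1) / (1 - Q powi (2 * s + 1))) summable_on UNIV"
      using summable_mult_bounded[OF gs, of "\<lambda>s. 1 / (1 - Q powi (2 * s + 1))"] norm_recip_bound[OF Q, of 1 "2 * _ + 1"] odd by fastforce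
  qed
  also have "(\<Sum>\<^sub>\<infinity>s. Q powi (2 * s * s + 3 * s + 1) / (1 - Q powi (2 * s + 1))) = 0"
  proof (rule infsum_antisym[where a = "-1"])
    fix s
    define X where "X = Q powi (2 * s + 1)"
    have X: "X \<noteq> 0" "1 - X \<noteq> 0" using Q nz(2)[of s] by (auto simp: X_def)
    have e1: "2 * (- 1 - s) * (- 1 - s) + 3 * (- 1 - s) + 1 = (2 * s * s + 3 * s + 1) - (2 * s + 1)" by (simp add: algebra_simps)
    have e3: "Q powi ((2 * s * s + 3 * s + 1) - (2 * s + 1)) = Q powi (2 * s * s + 3 * s + 1) / X"
      unfolding X_def by (rule power_int_diff) (use Q in simp)
    have "2 * (- 1 - s) + 1 = - (2 * s + 1)" by simp
    then have e2: "Q powi (2 * (- 1 - s) + 1) = 1 / X" by (simp only: X_def power_int_minus_divide)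
    have "E / X / (1 - 1 / X) = - (E / (1 - X))" for E using X by (simp add: divide_simps) (simp add: algebra_simps)
    then show "Q powi (2 * (- 1 - s) * (- 1 - s) + 3 * (- 1 - s) + 1) / (1 - Q powi (2 * (- 1 - s) + 1)) = - (Q powi (2 * s * s + 3 * s + 1) / (1 - Q powi (2 * s + 1)))"
      unfolding e1 e2 e3 X_def[symmetric] .
  qed
  finally have "A2 (- Q) = qinf Q (Q\<^sup>2) / qinf (Q\<^sup>2) (Q\<^sup>2) * ((-1/2) * G)"
    unfolding A2_lambert[OF mQ] by simp
  then show ?thesis unfolding K by simp
qed

section \<open>The identities\<close>

text \<open>
  The relation of appell_quotient is evaluated at \<i>, \<i> q^3 and q.  The first two points are zeros of
  E0 and E1, where it gives c1 and c0 as multiples of mu and A; inserted at q, only the combination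
  c0 b0 + c1 a0 remains, which is known from u = 1.
\<close>

lemma theta_identities:
  fixes q :: complex
  assumes q: "norm q < 1" "q \<noteq> 0"
  defines "Q \<equiv> q ^ 6"
  defines "j \<equiv> jtheta q Q" and "e0 \<equiv> laurent (E0 Q) q" and "e1 \<equiv> laurent (E1 Q) q"
    and "a0 \<equiv> laurent (E1 Q) 1" and "b0 \<equiv> laurent (E0 Q) 1"
  shows "(q * rho6 q - 2 * A2 (- Q)) * (a0 * j\<^sup>2) = (qinf Q Q) ^ 3 * e1"
    "(q * rho6 q + 1/2 * mu2 Q) * (b0 * j\<^sup>2) = (qinf Q Q) ^ 3 * e0"
    "j\<^sup>2 = a0 * e0 - b0 * e1" "(jtheta (- q) Q)\<^sup>2 = a0 * e0 + b0 * e1"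
proof -
  have Q: "norm Q < 1" "Q \<noteq> 0" using q norm_lt_1_power[OF q(1), of 6] by (auto simp: Q_def)
  have Q2: "norm (Q\<^sup>2) < 1" "Q\<^sup>2 \<noteq> 0" using sq_norm[OF Q] by auto
  define J where "J = qinf Q Q * qinf (Q\<^sup>2) (Q\<^sup>2)"
  obtain c0 c1 where c: "\<And>u. norm Q < norm u \<Longrightarrow> norm u \<le> 1 \<Longrightarrow> u \<noteq> 1 \<Longrightarrow>
       u * appell u Q * (jtheta u Q)\<^sup>2 = jtheta (u\<^sup>2) Q * J * (c0 * laurent (E0 Q) u + c1 * laurent (E1 Q) u)"
    and k: "J * (c0 * b0 + c1 * a0) = (qinf Q Q) ^ 3"
    and j1: "jtheta (-1) Q = 2 * (qinf (- Q) Q)\<^sup>2 * qinf Q Q"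
    and pr: "qinf (- Q) Q * qinf Q (Q\<^sup>2) = 1"
    using appell_quotient[OF Q] unfolding J_def a0_def b0_def by metis
  define C where "C = qinf Q (Q\<^sup>2) / qinf (Q\<^sup>2) (Q\<^sup>2)"
  have J2: "qinf (Q\<^sup>2) (Q\<^sup>2) = qinf Q Q * qinf (- Q) Q" by (rule qinf_square[OF Q(1)])
  have C: "C * jtheta (-1) Q = 2"
  proof -
    have nz: "qinf (Q\<^sup>2) (Q\<^sup>2) \<noteq> 0" by (rule qinf_self_nonzero[OF Q2(1)])
    have "C * jtheta (-1) Q = 2 * (qinf (- Q) Q * qinf Q (Q\<^sup>2)) * (qinf Q Q * qinf (- Q) Q) / qinf (Q\<^sup>2) (Q\<^sup>2)"
      unfolding C_def j1 by (simp add: power2_eq_square mult_ac)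
    then show ?thesis unfolding pr J2[symmetric] using nz by simp
  qed
  have lt: "norm Q < norm (q ^ 3)" "norm (q ^ 3) \<le> 1" "norm Q < norm q"
  proof -
    have n: "0 < norm q" "norm q < 1" using q by auto
    have "norm q ^ 6 < norm q ^ 3" "norm q ^ 6 < norm q ^ 1" by (rule power_strict_decreasing; use n in simp)+
    then show "norm Q < norm (q ^ 3)" "norm Q < norm q" by (simp_all add: Q_def norm_power)
    show "norm (q ^ 3) \<le> 1" using n by (simp add: norm_power power_le_one)
  qed
  have sq: "(jtheta u Q)\<^sup>2 = a0 * laurent (E0 Q) u - b0 * laurent (E1 Q) u" if "u \<noteq> 0" for u
    unfolding a0_def b0_def by (rule jtheta_square[OF Q that])
  \<comment> \<open>The zero of E0 isolates c1 on the right and b0 in (jtheta u Q)^2.\<close>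
  have i1: "\<i> \<noteq> 1" by (simp add: complex_eq_iff)
  have ji: "jtheta \<i> Q \<noteq> 0" by (intro jtheta_nonzero Q) (use Q i1 in simp_all)
  have E0i: "laurent (E0 Q) \<i> = 0" using E0_laurent(2)[OF Q, of \<i>] jtheta_1[OF Q2] by simp
  have "\<i> * appell \<i> Q * (- b0 * laurent (E1 Q) \<i>) = jtheta (-1) Q * J * (c1 * laurent (E1 Q) \<i>)"
    using c[of \<i>] Q i1 unfolding sq[OF complex_i_not_zero] E0i by simp
  moreover have "laurent (E1 Q) \<i> \<noteq> 0" using ji sq[of \<i>] E0i by auto
  ultimately have i2: "\<i> * appell \<i> Q * (- b0) = jtheta (-1) Q * J * c1"
    by (metis (no_types, lifting) mult.assoc mult_right_cancel)
  have mu: "b0 * mu2 Q = 2 * (J * c1)"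
  proof -
    have "b0 * mu2 Q = C * (\<i> * appell \<i> Q * (- b0))" unfolding mu2_appell[OF Q] C_def by simp
    also have "\<dots> = (C * jtheta (-1) Q) * (J * c1)" unfolding i2 by simp
    finally show ?thesis unfolding C .
  qed
  \<comment> \<open>At \<i> r, with r^2 = Q, the roles of E0 and E1 are exchanged.\<close>
  define r where "r = q ^ 3"
  have r: "r\<^sup>2 = Q" "r \<noteq> 0" using q by (simp_all add: r_def Q_def flip: power_mult)
  have r1: "\<i> * r \<noteq> 1"
  proof
    assume "\<i> * r = 1"
    then have "norm r = 1" by (metis mult_1 norm_ii norm_mult norm_one)
    moreover have "norm r < 1" unfolding r_def using norm_lt_1_power[OF q(1), of 3] by simp
    ultimately show False by simp
  qed
  have jr: "jtheta (\<i> * r) Q \<noteq> 0" by (intro jtheta_nonzero Q) (use lt r1 in \<open>simp_all add: norm_mult r_def\<close>)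
  have ir2: "(\<i> * r)\<^sup>2 = - Q" using r by (simp add: power_mult_distrib)
  have E1r: "laurent (E1 Q) (\<i> * r) = 0"
  proof -
    have "- (Q * (\<i> * r)\<^sup>2) = Q\<^sup>2" unfolding ir2 by (simp add: power2_eq_square)
    moreover have "jtheta (Q\<^sup>2) (Q\<^sup>2) = 0" using jacobi_triple[OF Q2 Q2(2)] qinf_1[OF Q2(1)] Q2 by simp
    ultimately show ?thesis using E1_laurent(2)[OF Q, of "\<i> * r"] r by simp
  qed
  have jmQ: "jtheta (- Q) Q = jtheta (-1) Q"
    using jacobi_triple[OF Q, of "- Q"] jacobi_triple[OF Q, of "-1"] Q by simp
  have "\<i> * r * appell (\<i> * r) Q * (a0 * laurent (E0 Q) (\<i> * r)) = jtheta (-1) Q * J * (c0 * laurent (E0 Q) (\<i> * r))"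
    using c[of "\<i> * r"] lt r1 sq[of "\<i> * r"] r unfolding ir2 E1r jmQ by (simp add: norm_mult r_def)
  moreover have "laurent (E0 Q) (\<i> * r) \<noteq> 0" using jr sq[of "\<i> * r"] E1r r by auto
  ultimately have r3: "\<i> * r * appell (\<i> * r) Q * a0 = jtheta (-1) Q * J * c0"
    by (metis (no_types, lifting) mult.assoc mult_right_cancel)
  have A: "a0 * (2 * A2 (- Q)) = J * c0"
  proof -
    have "a0 * (2 * A2 (- Q)) = C * (\<i> * r * appell (\<i> * r) Q * a0) / 2" unfolding A2_appell[OF Q r(1)] C_def by simp
    also have "\<dots> = (C * jtheta (-1) Q) * (J * c0) / 2" unfolding r3 by simp
    finally show ?thesis unfolding C by simp
  qed
  have q1: "q \<noteq> 1" using q by auto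
  have n2: "norm (q\<^sup>2) < 1" "q\<^sup>2 \<noteq> 0" using sq_norm[OF q] by auto
  \<comment> \<open>The residues 2, 4, 6 modulo 6 exhaust the even numbers, so the triple product at q^2 collapses.\<close>
  have jq2: "jtheta (q\<^sup>2) Q = qinf (q\<^sup>2) (q\<^sup>2)"
  proof -
    have "(q\<^sup>2) ^ 3 = Q" "q\<^sup>2 * q\<^sup>2 = Q / q\<^sup>2" "(q\<^sup>2)\<^sup>2 * q\<^sup>2 = Q"
      using q by (simp_all add: Q_def power2_eq_square eval_nat_numeral)
    then show ?thesis using qinf_split3[OF n2(1), of "q\<^sup>2"] jacobi_triple[OF Q n2(2)] by simp
  qed
  have rho: "q * rho6 q * j\<^sup>2 = J * (c0 * e0 + c1 * e1)"
  proof -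
    have "q * appell q Q * j\<^sup>2 = qinf (q\<^sup>2) (q\<^sup>2) * (J * (c0 * e0 + c1 * e1))"
      using c[of q] lt q q1 unfolding jq2 j_def e0_def e1_def by simp
    moreover have "qinf (q\<^sup>2) (q\<^sup>2) \<noteq> 0" by (rule qinf_self_nonzero[OF n2(1)])
    ultimately show ?thesis unfolding rho_appell[OF q] Q_def[symmetric] by (simp add: field_simps)
  qed
  show jj: "j\<^sup>2 = a0 * e0 - b0 * e1" unfolding j_def e0_def e1_def by (rule sq[OF q(2)])
  have "laurent (E0 Q) (- q) = e0" "laurent (E1 Q) (- q) = - e1"
    unfolding e0_def e1_def using E0_laurent(2)[OF Q, of q] E0_laurent(2)[OF Q, of "- q"]
      E1_laurent(2)[OF Q, of q] E1_laurent(2)[OF Q, of "- q"] q by simp_all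
  then show "(jtheta (- q) Q)\<^sup>2 = a0 * e0 + b0 * e1" using sq[of "- q"] q by simp
  have "(q * rho6 q - 2 * A2 (- Q)) * (a0 * j\<^sup>2) = a0 * (q * rho6 q * j\<^sup>2) - (a0 * (2 * A2 (- Q))) * j\<^sup>2"
    by (simp add: algebra_simps)
  also have "\<dots> = J * (c0 * b0 + c1 * a0) * e1" unfolding rho A unfolding jj by (simp add: algebra_simps)
  finally show "(q * rho6 q - 2 * A2 (- Q)) * (a0 * j\<^sup>2) = (qinf Q Q) ^ 3 * e1" unfolding k .
  have "(q * rho6 q + 1/2 * mu2 Q) * (b0 * j\<^sup>2) = b0 * (q * rho6 q * j\<^sup>2) + 1/2 * (b0 * mu2 Q) * j\<^sup>2"
    by (simp add: algebra_simps)
  also have "\<dots> = J * (c0 * b0 + c1 * a0) * e0" unfolding rho mu unfolding jj by (simp add: algebra_simps)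
  finally show "(q * rho6 q + 1/2 * mu2 Q) * (b0 * j\<^sup>2) = (qinf Q Q) ^ 3 * e0" unfolding k .
qed

text \<open>
  Each theta value is a triple product whose factors form residue classes modulo 6 or 3, and the sieving
  lemmas turn these into quotients of Theta m q.
\<close>

lemma theta_values:
  fixes q :: complex
  assumes q: "norm q < 1" "q \<noteq> 0"
  defines "Q \<equiv> q ^ 6" and "T \<equiv> \<lambda>m. Theta m q"
  shows "jtheta q Q = T 1 * (T 6)\<^sup>2 / (T 2 * T 3)"
    "jtheta (- q) Q = (T 2)\<^sup>2 * T 3 * T 12 / (T 4 * T 1 * T 6)"
    "laurent (E0 Q) q = (T 4)\<^sup>2 * T 24 * T 6 / (T 8 * T 2 * T 12)"
    "laurent (E1 Q) q = q * (T 8 * (T 12)\<^sup>2 / (T 24 * T 4))"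
    "laurent (E1 Q) 1 = (T 12) ^ 5 / ((T 6)\<^sup>2 * (T 24)\<^sup>2)"
    "laurent (E0 Q) 1 = 2 * (T 24)\<^sup>2 / T 12"
proof -
  have Q: "norm Q < 1" "Q \<noteq> 0" using q norm_lt_1_power[OF q(1), of 6] by (auto simp: Q_def)
  have Q2: "norm (Q\<^sup>2) < 1" "Q\<^sup>2 \<noteq> 0" using sq_norm[OF Q] by auto
  have nz: "T m \<noteq> 0" if "m > 0" for m unfolding T_def by (rule Theta_nonzero[OF q(1) that])
  note T0 = nz[of 1, simplified] nz[of 2, simplified] nz[of 3, simplified] nz[of 4, simplified] nz[of 6, simplified]
    nz[of 8, simplified] nz[of 12, simplified] nz[of 24, simplified]
  have Tq: "qinf (q ^ m) (q ^ m) = T m" for m unfolding T_def Theta_qinf ..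
  have R: "R6 (q ^ m) = T m * T (m * 6) / (T (m * 2) * T (m * 3))" if "m > 0" for m
  proof -
    have "R6 (q ^ m) * T (m * 2) * T (m * 3) = T m * T (m * 6)"
      using R6_theta[OF norm_lt_1_power[OF q(1) that]] by (simp only: power_mult[symmetric] Tq)
    then show ?thesis using nz[of "m * 2"] nz[of "m * 3"] that by (simp add: field_simps)
  qed
  have S: "S3 (q ^ m) = T m / T (m * 3)" if "m > 0" for m
  proof -
    have "S3 (q ^ m) * T (m * 3) = T m"
      using S3_theta[OF norm_lt_1_power[OF q(1) that]] by (simp only: power_mult[symmetric] Tq)
    then show ?thesis using nz[of "m * 3"] that by (simp add: field_simps)
  qed
  have R1: "R6 q = T 1 * T 6 / (T 2 * T 3)" using R[of 1] by simp
  have R2: "R6 (q\<^sup>2) = T 2 * T 12 / (T 4 * T 6)" using R[of 2] by simp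
  have R4: "R6 (q ^ 4) = T 4 * T 24 / (T 8 * T 12)" using R[of 4] by simp
  have S4: "S3 (q ^ 4) = T 4 / T 12" using S[of 4] by simp
  have S8: "S3 (q ^ 8) = T 8 / T 24" using S[of 8] by simp
  have d: "Q / q = q ^ 5" "Q / - q = - (q ^ 5)" using q by (simp_all add: Q_def eval_nat_numeral)
  have nR: "R6 q \<noteq> 0" "R6 (q\<^sup>2) \<noteq> 0" "S3 (q ^ 4) \<noteq> 0" unfolding R1 R2 S4 using T0 by simp_all
  show j: "jtheta q Q = T 1 * (T 6)\<^sup>2 / (T 2 * T 3)"
  proof -
    have "jtheta q Q = R6 q * T 6" using jacobi_triple[OF Q q(2)] unfolding d R6_def by (simp add: Q_def Tq)
    then show ?thesis unfolding R1 by (simp add: power2_eq_square)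
  qed
  show "jtheta (- q) Q = (T 2)\<^sup>2 * T 3 * T 12 / (T 4 * T 1 * T 6)"
  proof -
    have "jtheta (- q) Q = R6m q * T 6"
      using jacobi_triple[OF Q, of "- q"] q unfolding d R6m_def by (simp add: Q_def Tq)
    moreover have "R6m q = R6 (q\<^sup>2) / R6 q"
      using R6m_theta[OF q(1)] nR by (simp add: nonzero_eq_divide_eq mult.commute)
    ultimately show ?thesis unfolding R1 R2 using T0 by (simp add: field_simps power2_eq_square)
  qed
  have Qsq: "Q\<^sup>2 = q ^ 12" by (simp add: Q_def flip: power_mult)
  show "laurent (E0 Q) q = (T 4)\<^sup>2 * T 24 * T 6 / (T 8 * T 2 * T 12)"
  proof -
    have n2: "norm (q\<^sup>2) < 1" by (rule norm_lt_1_power[OF q(1)]) simp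
    have "q ^ 12 / - (q\<^sup>2) = - (q ^ 10)" using q by (simp add: eval_nat_numeral)
    then have "laurent (E0 Q) q = R6m (q\<^sup>2) * T 12"
      using E0_laurent(2)[OF Q q(2)] jacobi_triple[OF Q2, of "- (q\<^sup>2)"] q
      unfolding R6m_def Qsq by (simp add: Tq flip: power_mult)
    moreover have "R6m (q\<^sup>2) = R6 (q ^ 4) / R6 (q\<^sup>2)"
      using R6m_theta[OF n2] nR by (simp add: nonzero_eq_divide_eq mult.commute flip: power_mult)
    ultimately show ?thesis unfolding R2 R4 using T0 by (simp add: field_simps power2_eq_square)
  qed
  show "laurent (E1 Q) q = q * (T 8 * (T 12)\<^sup>2 / (T 24 * T 4))"
  proof -
    have n4: "norm (q ^ 4) < 1" by (rule norm_lt_1_power[OF q(1)]) simp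
    have "q ^ 12 / - (q ^ 8) = - (q ^ 4)" "Q * q\<^sup>2 = q ^ 8" using q by (simp_all add: Q_def eval_nat_numeral)
    then have "laurent (E1 Q) q = q * (S3m (q ^ 4) * T 12)"
      using E1_laurent(2)[OF Q q(2)] jacobi_triple[OF Q2, of "- (q ^ 8)"] q
      unfolding S3m_def Qsq by (simp add: Tq mult_ac flip: power_mult)
    moreover have "S3m (q ^ 4) = S3 (q ^ 8) / S3 (q ^ 4)"
      using S3m_theta[OF n4] nR by (simp add: nonzero_eq_divide_eq mult.commute flip: power_mult)
    ultimately show ?thesis unfolding S4 S8 using T0 by (simp add: field_simps power2_eq_square)
  qed
  have Q4: "(Q\<^sup>2)\<^sup>2 = q ^ 24" by (simp add: Q_def flip: power_mult)
  have TQ2: "qinf (Q\<^sup>2) (Q\<^sup>2) = T 12" unfolding Qsq Tq ..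
  have g1: "qinf Q (Q\<^sup>2) * T 12 = T 6" using qinf_split2[OF Q(1), of Q] Tq[of 6] Tq[of 12]
    by (simp add: Qsq flip: Q_def power2_eq_square)
  have g2: "qinf Q (Q\<^sup>2) * qinf (- Q) (Q\<^sup>2) * T 24 = T 12"
  proof -
    have "qinf (Q\<^sup>2) (Q\<^sup>2) = qinf (Q\<^sup>2) ((Q\<^sup>2)\<^sup>2) * qinf ((Q\<^sup>2)\<^sup>2) ((Q\<^sup>2)\<^sup>2)"
      using qinf_split2[OF Q2(1), of "Q\<^sup>2"] by (simp only: power2_eq_square[of "Q\<^sup>2"])
    also have "qinf (Q\<^sup>2) ((Q\<^sup>2)\<^sup>2) = qinf Q (Q\<^sup>2) * qinf (- Q) (Q\<^sup>2)" by (rule qinf_square[OF Q2(1)])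
    also have "qinf ((Q\<^sup>2)\<^sup>2) ((Q\<^sup>2)\<^sup>2) = T 24" unfolding Q4 Tq ..
    finally show ?thesis unfolding TQ2 ..
  qed
  have g3: "T 12 * qinf (- (Q\<^sup>2)) (Q\<^sup>2) = T 24"
    using qinf_square[OF Q2(1), of "Q\<^sup>2"] unfolding Q4 Tq TQ2 by (rule sym)
  have g4: "qinf (- Q) (Q\<^sup>2) = (T 12)\<^sup>2 / (T 6 * T 24)"
  proof -
    have "qinf (- Q) (Q\<^sup>2) * (T 6 * T 24) = (qinf Q (Q\<^sup>2) * qinf (- Q) (Q\<^sup>2) * T 24) * T 12"
      unfolding g1[symmetric] by (simp add: mult_ac)
    also have "\<dots> = (T 12)\<^sup>2" unfolding g2 by (simp add: power2_eq_square)
    finally show ?thesis using T0 by (simp add: nonzero_eq_divide_eq)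
  qed
  have g5: "qinf (- (Q\<^sup>2)) (Q\<^sup>2) = T 24 / T 12" using g3 T0 by (simp add: nonzero_eq_divide_eq mult.commute)
  show "laurent (E1 Q) 1 = (T 12) ^ 5 / ((T 6)\<^sup>2 * (T 24)\<^sup>2)"
  proof -
    have "Q\<^sup>2 / - Q = - Q" using Q by (simp add: power2_eq_square)
    then have "laurent (E1 Q) 1 = (qinf (- Q) (Q\<^sup>2))\<^sup>2 * T 12"
      using E1_laurent(2)[OF Q, of 1] jacobi_triple[OF Q2, of "- Q"] Q by (simp add: TQ2 power2_eq_square[of "qinf _ _"])
    then show ?thesis unfolding g4 by (simp add: power_mult_distrib power_divide flip: power_mult) (simp add: eval_nat_numeral)
  qed
  show "laurent (E0 Q) 1 = 2 * (T 24)\<^sup>2 / T 12"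
  proof -
    have "qinf (-1) (Q\<^sup>2) = 2 * qinf (- (Q\<^sup>2)) (Q\<^sup>2)" using qinf_Suc[OF Q2(1), of "-1"] by simp
    then have "laurent (E0 Q) 1 = 2 * (qinf (- (Q\<^sup>2)) (Q\<^sup>2))\<^sup>2 * T 12"
      using E0_laurent(2)[OF Q, of 1] jacobi_triple[OF Q2, of "-1"] by (simp add: TQ2 power2_eq_square[of "qinf _ _"])
    then show ?thesis unfolding g5 using T0 by (simp add: power2_eq_square)
  qed
qed

theorem theorem2p2:
  fixes \<tau> q :: complex
  assumes "Im \<tau> > 0" and "q = exp (2 * of_real pi * \<i> * \<tau>)"
  shows "q * rho6 q - 2 * A2 (- (q^6)) =
           q * ((Theta 2 q)^2 * (Theta 3 q)^2 * Theta 6 q * Theta 8 q * Theta 24 q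
                / ((Theta 1 q)^2 * Theta 4 q * (Theta 12 q)^3)) \<and>
         q * rho6 q + 1/2 * mu2 (q^6) =
           1/2 * (Theta 2 q * (Theta 3 q)^2 * (Theta 4 q)^2
                  / ((Theta 1 q)^2 * Theta 8 q * Theta 24 q)) \<and>
         q * rho6 q + 1/4 * mu2 (q^6) - A2 (- (q^6)) =
           1/4 * ((Theta 2 q)^6 * (Theta 3 q)^4
                  / ((Theta 1 q)^4 * (Theta 4 q)^2 * Theta 6 q * (Theta 12 q)^2))"
proof -
  have q: "norm q < 1" "q \<noteq> 0" using assms by auto
  note T0 = Theta_nonzero[OF q(1), of 1, simplified] Theta_nonzero[OF q(1), of 2, simplified] Theta_nonzero[OF q(1), of 3, simplified]
    Theta_nonzero[OF q(1), of 4, simplified] Theta_nonzero[OF q(1), of 6, simplified] Theta_nonzero[OF q(1), of 8, simplified]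
    Theta_nonzero[OF q(1), of 12, simplified] Theta_nonzero[OF q(1), of 24, simplified]
  note V = theta_values[OF q]
  define j where "j = jtheta q (q ^ 6)"
  define e0 where "e0 = laurent (E0 (q ^ 6)) q"
  define e1 where "e1 = laurent (E1 (q ^ 6)) q"
  define a0 where "a0 = laurent (E1 (q ^ 6)) 1"
  define b0 where "b0 = laurent (E0 (q ^ 6)) 1"
  note I = theta_identities[OF q, folded j_def e0_def e1_def a0_def b0_def]
  have T6: "qinf (q ^ 6) (q ^ 6) = Theta 6 q" unfolding Theta_qinf ..
  have nz: "j \<noteq> 0" "a0 \<noteq> 0" "b0 \<noteq> 0" unfolding j_def a0_def b0_def V using T0 by simp_all
  have 1: "q * rho6 q - 2 * A2 (- (q^6)) = Theta 6 q ^ 3 * e1 / (a0 * j\<^sup>2)"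
    using I(1) nz unfolding T6 by (simp add: nonzero_eq_divide_eq)
  have 2: "q * rho6 q + 1/2 * mu2 (q^6) = Theta 6 q ^ 3 * e0 / (b0 * j\<^sup>2)"
    using I(2) nz unfolding T6 by (simp add: nonzero_eq_divide_eq)
  have 3: "q * rho6 q + 1/4 * mu2 (q^6) - A2 (- (q^6)) = Theta 6 q ^ 3 * (jtheta (- q) (q ^ 6))\<^sup>2 / (2 * a0 * b0 * j\<^sup>2)"
  proof -
    have "q * rho6 q + 1/4 * mu2 (q^6) - A2 (- (q^6)) = 1/2 * (q * rho6 q - 2 * A2 (- (q^6))) + 1/2 * (q * rho6 q + 1/2 * mu2 (q^6))"
      by (simp add: algebra_simps)
    also have "\<dots> = Theta 6 q ^ 3 * (a0 * e0 + b0 * e1) / (2 * a0 * b0 * j\<^sup>2)"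
      unfolding 1 2 using nz by (simp add: divide_simps) (simp add: algebra_simps)
    finally show ?thesis unfolding I(4) .
  qed
  show ?thesis
  proof (intro conjI)
    show "q * rho6 q - 2 * A2 (- (q^6)) = q * ((Theta 2 q)^2 * (Theta 3 q)^2 * Theta 6 q * Theta 8 q * Theta 24 q
                / ((Theta 1 q)^2 * Theta 4 q * (Theta 12 q)^3))"
      unfolding 1 j_def e1_def a0_def V using T0 by (simp add: divide_simps) (simp add: eval_nat_numeral)
    show "q * rho6 q + 1/2 * mu2 (q^6) = 1/2 * (Theta 2 q * (Theta 3 q)^2 * (Theta 4 q)^2
                  / ((Theta 1 q)^2 * Theta 8 q * Theta 24 q))"
      unfolding 2 j_def e0_def b0_def V using T0 by (simp add: divide_simps) (simp add: eval_nat_numeral)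
    show "q * rho6 q + 1/4 * mu2 (q^6) - A2 (- (q^6)) = 1/4 * ((Theta 2 q)^6 * (Theta 3 q)^4
                  / ((Theta 1 q)^4 * (Theta 4 q)^2 * Theta 6 q * (Theta 12 q)^2))"
      unfolding 3 j_def a0_def b0_def V using T0 by (simp add: divide_simps) (simp add: eval_nat_numeral)
  qed
qed

end
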